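(* For the stable retrial queue described in the context, and for each fixed $n\ge1$, the joint probabilities $\pi_{m,n}(0)$ have the following tail asymptotics as $m\to\infty$. Type 1 (exact geometric decay): under Condition 1, $$\pi_{m,n}(0)\sim\frac{\mu}{\alpha}A_1(x_+)\left(\frac1{Y_1(x_+)}\right)^{n-1}\left(\frac1{x_+}\right)^{m-1}.$$ Type 2 (geometric decay with prefactor $m^{-1/2}$): under Condition 2, $$\pi_{m,n}(0)\sim\frac{\mu}{\alpha}\frac{A_2(x_{dom})}{\sqrt\pi}\left(\frac1{Y_1(x_{dom})}\right)^{n-1}m^{-1/2}\left(\frac1{x_{dom}}\right)^{m-1}.$$ Type 3 (geometric decay with prefactor $m^{-3/2}$): under Condition 3, $$\pi_{m,n}(0)\sim\frac{\mu}{\alpha}\frac{A_3(x_3)+(n-1)B_3(x_3)}{\sqrt\pi}\left(\frac1{Y_1(x_3)}\right)^{n-1}m^{-3/2}\left(\frac1{x_3}\right)^{m-2}.$$ Here $A_i(x_{dom})=-\frac{b_1(x_{dom})}{c(x_{dom})}C_{i,0}$ for $i=1,2,3$ and $B_3(x_3)=-\frac{p_1(x_3)}{c(x_3)}C_{3,0}$, with all quantities and Conditions 1, 2, 3 as defined in the context.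
   Context: Model. $\lambda_1,\lambda_2,\mu,\mu_1,\mu_2>0$, $\lambda=\lambda_1+\lambda_2$, normalized so that $\lambda+\mu+\mu_1+\mu_2=1$. Consider the continuous-time Markov chain on $\{0,1,\dots\}^2\times\{0,1\}$ with states $(m,n,k)$ ($m,n$ = numbers of customers in orbits 1 and 2, $k=0$ idle server, $k=1$ busy server) and transition rates: from $(m,n,0)$ to $(m,n,1)$ at rate $\lambda$, to $(m-1,n,1)$ at rate $\mu_1$ if $m\ge1$, to $(m,n-1,1)$ at rate $\mu_2$ if $n\ge 1$; from $(m,n,1)$ to $(m+1,n,1)$ at rate $\lambda_1$, to $(m,n+1,1)$ at rate $\lambda_2$, to $(m,n,0)$ at rate $\mu$. Write $\alpha=\lambda+\mu_1+\mu_2=1-\mu$, $\hat\lambda_i=\alpha\lambda_i$, $\hat\mu_i=\mu\mu_i$. Standing assumptions: stability, i.e. $\lambda(\lambda_i+\mu_i)<\mu\mu_i$ for $i=1,2$; and $\hat\lambda_1<\hat\mu_1$. $\pi_{m,n}(k)$ denotes the unique stationary distribution. Generating functions: $\pi_1^{(1)}(x)=\sum_{m\ge1}\pi_{m,0}(1)x^{m-1}$, $\pi_2^{(1)}(y)=\sum_{n\ge1}\pi_{0,n}(1)y^{n-1}$; the same symbols denote their analytic continuations. The dominant singularity $x_{dom}$ of $\pi_1^{(1)}$ is its singularity of smallest modulus ($x_{dom}=x_+$ under Condition 1, $x_{dom}=x_3=x_+$ under Condition 2, $x_{dom}=x_3$ under Condition 3). Functions: $\hat b(x)=\hat\lambda_1x^2-(\hat\lambda_1+\hat\lambda_2+\hat\mu_1+\hat\mu_2)x+\hat\mu_1$;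 $b_\pm(x)=\hat b(x)\pm 2x\sqrt{\hat\lambda_2\hat\mu_2}$; $\Delta=b_+b_-$. The zeros of $b_+$ are $x_2<x_3$ and those of $b_-$ are $x_1<x_4$ (so $x_1<x_2<x_3<x_4$). $Y_\pm(x)=\frac{-\hat b(x)\pm\sqrt{\Delta(x)}}{2\hat\lambda_2x}$ are the two roots $y$ of the kernel equation $\hat\lambda_2xy^2+\hat b(x)y+\hat\mu_2x=0$; $Y_0(x)$ is the one of smaller modulus and $Y_1(x)$ the other ($Y_0=Y_-,Y_1=Y_+$ if $|Y_-|\le|Y_+|$, and otherwise interchanged). $h_1(x,y)=a_1(x)y+b_1(x)$ with $a_1(x)=\lambda_2x$, $b_1(x)=\lambda_1x^2-\big(\lambda+\frac{\hat\mu_1}{\lambda+\mu_1}\big)x+\frac{\hat\mu_1}{\lambda+\mu_1}$; $h_2(x,y)=\lambda_2y^2+\big(\lambda_1x-\lambda-\frac{\hat\mu_2}{\lambda+\mu_2}\big)y+\frac{\hat\mu_2}{\lambda+\mu_2}$; $h_0(x,y)=\lambda_1x+\lambda_2y-\lambda$; $c(x)=\frac{\hat\mu_2}{\alpha}x$; $p_1(x)=-\frac{\hat b(x)a_1(x)}{2\hat\lambda_2x}+b_1(x)$. $x_+>0>x_-$ are the two zeros of $g(x)=\lambda\lambda_1(\lambda+\mu_1)x^2+\lambda\mu_1(\lambda+\mu_1-\mu)x-\mu\mu_1^2$, and $Y(x_+)=1-\frac{[\lambda_1(\lambda+\mu_1)x_+-\mu\mu_1](x_+-1)}{\lambda_2(\lambda+\mu_1)x_+}$.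 Condition 1: $\hat\mu_2>\hat\lambda_2$, $x_+\in\big(\frac{\hat\mu_1}{\hat\lambda_1},\min(x_3,\frac{\mu\mu_1}{\lambda_1(\lambda+\mu_1)})\big)$ and $Y(x_+)<\sqrt{\hat\mu_2/\hat\lambda_2}$. Condition 2: $\hat\mu_2>\hat\lambda_2$ and $x_+=x_3\in\big(\frac{\hat\mu_1}{\hat\lambda_1},\frac{\mu\mu_1}{\lambda_1(\lambda+\mu_1)}\big)$. Condition 3: one of (a) $\hat\mu_2\le\hat\lambda_2$; (b) $\hat\mu_2>\hat\lambda_2$ and $x_+\in(1,\hat\mu_1/\hat\lambda_1]$; (c) $\hat\mu_2>\hat\lambda_2$, $x_+\in\big(\frac{\hat\mu_1}{\hat\lambda_1},\min(x_3,\frac{\mu\mu_1}{\lambda_1(\lambda+\mu_1)})\big)$ and $Y(x_+)\ge\sqrt{\hat\mu_2/\hat\lambda_2}$. Constants: with $N(x,y)=h_2(x,y)\pi_2^{(1)}(y)+h_0(x,y)\pi_{0,0}(1)$, $$C_{1,0}=\frac{(\lambda+\mu_1)\sqrt{\Delta(x_+)}\,N(x_+,Y_0(x_+))}{\hat\mu_2\lambda\lambda_1x_+(x_+-1)(x_+-x_-)},$$ $$C_{2,0}=\frac2{\lambda_1}\cdot\frac{N(x_{dom},Y_0(x_{dom}))}{\sqrt{x_{dom}(x_{dom}-x_1)(x_{dom}-x_2)(x_4-x_{dom})}},$$ $$C_{3,0}=-\frac{q(x_3)}{2x_3}\,\frac{\partial}{\partial y}\left[-\frac{N(x_3,y)}{h_1(x_3,y)}\right]_{y=Y_0(x_3)},\qquad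 q(x)=-\frac1{2\hat\lambda_2x}\sqrt{\frac{\Delta(x)}{1-x/x_3}}$$ (with $q(x_3)$ the limiting value at $x_3$). $a_m\sim b_m$ means $a_m/b_m\to1$. *)

theory Defs
  imports "HOL-Probability.Probability" "HOL-Complex_Analysis.Complex_Analysis"
begin

record queue =
  lam1 :: real
  lam2 :: real
  mu :: real
  mu1 :: real
  mu2 :: real

definition lam :: "queue \<Rightarrow> real" where
  "lam Q = lam1 Q + lam2 Q"

definition alpha :: "queue \<Rightarrow> real" where
  "alpha Q = lam Q + mu1 Q + mu2 Q"

definition hlam1 :: "queue \<Rightarrow> real" where "hlam1 Q = alpha Q * lam1 Q"
definition hlam2 :: "queue \<Rightarrow> real" where "hlam2 Q = alpha Q * lam2 Q"
definition hmu1 :: "queue \<Rightarrow> real" where "hmu1 Q = mu Q * mu1 Q"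
definition hmu2 :: "queue \<Rightarrow> real" where "hmu2 Q = mu Q * mu2 Q"

definition valid_queue :: "queue \<Rightarrow> bool" where
  "valid_queue Q \<longleftrightarrow>
     lam1 Q > 0 \<and> lam2 Q > 0 \<and> mu Q > 0 \<and> mu1 Q > 0 \<and> mu2 Q > 0 \<and>
     lam Q + mu Q + mu1 Q + mu2 Q = 1"

definition stable_queue :: "queue \<Rightarrow> bool" where
  "stable_queue Q \<longleftrightarrow>
     lam Q * (lam1 Q + mu1 Q) < mu Q * mu1 Q \<and>
     lam Q * (lam2 Q + mu2 Q) < mu Q * mu2 Q"

datatype server = Idle | Busy

text \<open>A state \<open>(m, n, k)\<close>: \<open>m\<close> and \<open>n\<close> customers in orbits 1 and 2, server in state \<open>k\<close>.\<close>

type_synonym state = "nat \<times> nat \<times> server"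

text \<open>Transition rates; the chain has no transition from a state to itself.\<close>

fun rate :: "queue \<Rightarrow> state \<Rightarrow> state \<Rightarrow> real" where
  "rate Q (m, n, Idle) (m', n', Busy) =
     (if m' = m \<and> n' = n then lam Q
      else if m \<ge> 1 \<and> m' = m - 1 \<and> n' = n then mu1 Q
      else if n \<ge> 1 \<and> m' = m \<and> n' = n - 1 then mu2 Q
      else 0)"
| "rate Q (m, n, Busy) (m', n', Busy) =
     (if m' = m + 1 \<and> n' = n then lam1 Q
      else if m' = m \<and> n' = n + 1 then lam2 Q
      else 0)"
| "rate Q (m, n, Busy) (m', n', Idle) = (if m' = m \<and> n' = n then mu Q else 0)"
| "rate Q (m, n, Idle) (m', n', Idle) = 0"

text \<open>Stationarity as global balance: the probability flow into every state equals the flow out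
  of it. The exit rates are bounded, so the chain does not explode and this characterises the
  invariant probability distributions of its transition semigroup.\<close>

definition stationary :: "queue \<Rightarrow> state pmf \<Rightarrow> bool" where
  "stationary Q \<pi> \<longleftrightarrow>
     (\<forall>t. ((\<lambda>s. pmf \<pi> s * rate Q s t) has_sum (pmf \<pi> t * (\<Sum>\<^sub>\<infinity>u. rate Q t u))) UNIV)"

text \<open>\<open>f\<close> is regarded as a germ at 0, which is continued along the straight segment from 0
  to \<open>z\<close>. The continued value is unique by the identity theorem on the connected component
  of \<open>D\<close> that contains the segment.\<close>

definition continues_to :: "(complex \<Rightarrow> complex) \<Rightarrow> complex \<Rightarrow> complex \<Rightarrow> bool" where
  "continues_to f z w \<longleftrightarrow>
     (\<exists>D F. open D \<and> closed_segment 0 z \<subseteq> D \<and> F holomorphic_on D \<and>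
            (\<forall>\<^sub>F u in nhds 0. F u = f u) \<and> F z = w)"

definition ancont :: "(complex \<Rightarrow> complex) \<Rightarrow> complex \<Rightarrow> complex" where
  "ancont f z = (THE w. continues_to f z w)"

definition singularity :: "(complex \<Rightarrow> complex) \<Rightarrow> complex \<Rightarrow> bool" where
  "singularity f z \<longleftrightarrow>
     (\<forall>w \<in> closed_segment 0 z - {z}. \<exists>v. continues_to f w v) \<and> (\<nexists>v. continues_to f z v)"

text \<open>The singularity of smallest modulus. For a power series with nonnegative coefficients one
  such singularity lies on the positive real axis, by Pringsheim's theorem.\<close>

definition dominant_singularity :: "(complex \<Rightarrow> complex) \<Rightarrow> real" where
  "dominant_singularity f =
     (THE r. r > 0 \<and> singularity f (of_real r) \<and> (\<forall>z. singularity f z \<longrightarrow> r \<le> cmod z))"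

definition gen1 :: "state pmf \<Rightarrow> complex \<Rightarrow> complex" where
  "gen1 \<pi> x = (\<Sum>m. of_real (pmf \<pi> (Suc m, 0, Busy)) * x ^ m)"

definition gen2 :: "state pmf \<Rightarrow> complex \<Rightarrow> complex" where
  "gen2 \<pi> y = (\<Sum>n. of_real (pmf \<pi> (0, Suc n, Busy)) * y ^ n)"

definition x_dom :: "state pmf \<Rightarrow> real" where
  "x_dom \<pi> = dominant_singularity (gen1 \<pi>)"

text \<open>The continuation of \<open>gen2\<close> is only evaluated at real points, where it is real since its
  coefficients are.\<close>

definition pi2 :: "state pmf \<Rightarrow> real \<Rightarrow> real" where
  "pi2 \<pi> y = Re (ancont (gen2 \<pi>) (of_real y))"

definition bhat :: "queue \<Rightarrow> real \<Rightarrow> real" where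
  "bhat Q x = hlam1 Q * x\<^sup>2 - (hlam1 Q + hlam2 Q + hmu1 Q + hmu2 Q) * x + hmu1 Q"

definition b_plus :: "queue \<Rightarrow> real \<Rightarrow> real" where
  "b_plus Q x = bhat Q x + 2 * x * sqrt (hlam2 Q * hmu2 Q)"

definition b_minus :: "queue \<Rightarrow> real \<Rightarrow> real" where
  "b_minus Q x = bhat Q x - 2 * x * sqrt (hlam2 Q * hmu2 Q)"

definition Delta :: "queue \<Rightarrow> real \<Rightarrow> real" where
  "Delta Q x = b_plus Q x * b_minus Q x"

definition x1 :: "queue \<Rightarrow> real" where "x1 Q = Min {x. b_minus Q x = 0}"
definition x2 :: "queue \<Rightarrow> real" where "x2 Q = Min {x. b_plus Q x = 0}"
definition x3 :: "queue \<Rightarrow> real" where "x3 Q = Max {x. b_plus Q x = 0}"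
definition x4 :: "queue \<Rightarrow> real" where "x4 Q = Max {x. b_minus Q x = 0}"

text \<open>The branches are needed at real points with \<open>Delta Q x \<ge> 0\<close> only.\<close>

definition Y_plus :: "queue \<Rightarrow> real \<Rightarrow> real" where
  "Y_plus Q x = (- bhat Q x + sqrt (Delta Q x)) / (2 * hlam2 Q * x)"

definition Y_minus :: "queue \<Rightarrow> real \<Rightarrow> real" where
  "Y_minus Q x = (- bhat Q x - sqrt (Delta Q x)) / (2 * hlam2 Q * x)"

definition Y0 :: "queue \<Rightarrow> real \<Rightarrow> real" where
  "Y0 Q x = (if \<bar>Y_minus Q x\<bar> \<le> \<bar>Y_plus Q x\<bar> then Y_minus Q x else Y_plus Q x)"

definition Y1 :: "queue \<Rightarrow> real \<Rightarrow> real" where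
  "Y1 Q x = (if \<bar>Y_minus Q x\<bar> \<le> \<bar>Y_plus Q x\<bar> then Y_plus Q x else Y_minus Q x)"

definition a1 :: "queue \<Rightarrow> real \<Rightarrow> real" where
  "a1 Q x = lam2 Q * x"

definition b1 :: "queue \<Rightarrow> real \<Rightarrow> real" where
  "b1 Q x = lam1 Q * x\<^sup>2 - (lam Q + hmu1 Q / (lam Q + mu1 Q)) * x + hmu1 Q / (lam Q + mu1 Q)"

definition h1 :: "queue \<Rightarrow> real \<Rightarrow> real \<Rightarrow> real" where
  "h1 Q x y = a1 Q x * y + b1 Q x"

definition h2 :: "queue \<Rightarrow> real \<Rightarrow> real \<Rightarrow> real" where
  "h2 Q x y = lam2 Q * y\<^sup>2 + (lam1 Q * x - lam Q - hmu2 Q / (lam Q + mu2 Q)) * y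
     + hmu2 Q / (lam Q + mu2 Q)"

definition h0 :: "queue \<Rightarrow> real \<Rightarrow> real \<Rightarrow> real" where
  "h0 Q x y = lam1 Q * x + lam2 Q * y - lam Q"

definition c_coeff :: "queue \<Rightarrow> real \<Rightarrow> real" where
  "c_coeff Q x = hmu2 Q / alpha Q * x"

definition p1 :: "queue \<Rightarrow> real \<Rightarrow> real" where
  "p1 Q x = - (bhat Q x * a1 Q x / (2 * hlam2 Q * x)) + b1 Q x"

definition g_poly :: "queue \<Rightarrow> real \<Rightarrow> real" where
  "g_poly Q x = lam Q * lam1 Q * (lam Q + mu1 Q) * x\<^sup>2
     + lam Q * mu1 Q * (lam Q + mu1 Q - mu Q) * x - mu Q * (mu1 Q)\<^sup>2"

definition x_plus :: "queue \<Rightarrow> real" where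
  "x_plus Q = (THE x. g_poly Q x = 0 \<and> x > 0)"

definition x_minus :: "queue \<Rightarrow> real" where
  "x_minus Q = (THE x. g_poly Q x = 0 \<and> x < 0)"

definition Y_at_x_plus :: "queue \<Rightarrow> real" where
  "Y_at_x_plus Q =
     1 - (lam1 Q * (lam Q + mu1 Q) * x_plus Q - mu Q * mu1 Q) * (x_plus Q - 1)
         / (lam2 Q * (lam Q + mu1 Q) * x_plus Q)"

definition x_upper :: "queue \<Rightarrow> real" where
  "x_upper Q = mu Q * mu1 Q / (lam1 Q * (lam Q + mu1 Q))"

definition condition1 :: "queue \<Rightarrow> bool" where
  "condition1 Q \<longleftrightarrow>
     hmu2 Q > hlam2 Q \<and>
     x_plus Q \<in> {hmu1 Q / hlam1 Q <..< min (x3 Q) (x_upper Q)} \<and>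
     Y_at_x_plus Q < sqrt (hmu2 Q / hlam2 Q)"

definition condition2 :: "queue \<Rightarrow> bool" where
  "condition2 Q \<longleftrightarrow>
     hmu2 Q > hlam2 Q \<and>
     x_plus Q = x3 Q \<and>
     x_plus Q \<in> {hmu1 Q / hlam1 Q <..< x_upper Q}"

definition condition3 :: "queue \<Rightarrow> bool" where
  "condition3 Q \<longleftrightarrow>
     hmu2 Q \<le> hlam2 Q \<or>
     (hmu2 Q > hlam2 Q \<and> x_plus Q \<in> {1 <.. hmu1 Q / hlam1 Q}) \<or>
     (hmu2 Q > hlam2 Q \<and>
      x_plus Q \<in> {hmu1 Q / hlam1 Q <..< min (x3 Q) (x_upper Q)} \<and>
      Y_at_x_plus Q \<ge> sqrt (hmu2 Q / hlam2 Q))"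

definition N_num :: "queue \<Rightarrow> state pmf \<Rightarrow> real \<Rightarrow> real \<Rightarrow> real" where
  "N_num Q \<pi> x y = h2 Q x y * pi2 \<pi> y + h0 Q x y * pmf \<pi> (0, 0, Busy)"

definition C10 :: "queue \<Rightarrow> state pmf \<Rightarrow> real" where
  "C10 Q \<pi> =
     (lam Q + mu1 Q) * sqrt (Delta Q (x_plus Q)) * N_num Q \<pi> (x_plus Q) (Y0 Q (x_plus Q))
     / (hmu2 Q * lam Q * lam1 Q * x_plus Q * (x_plus Q - 1) * (x_plus Q - x_minus Q))"

definition C20 :: "queue \<Rightarrow> state pmf \<Rightarrow> real" where
  "C20 Q \<pi> = (let x = x_dom \<pi> in
     2 / lam1 Q * (N_num Q \<pi> x (Y0 Q x) / sqrt (x * (x - x1 Q) * (x - x2 Q) * (x4 Q - x))))"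

text \<open>\<open>q_fun\<close> has a removable singularity at \<open>x3\<close>, where it takes its limiting value.\<close>

definition q_fun :: "queue \<Rightarrow> real \<Rightarrow> real" where
  "q_fun Q x = - (1 / (2 * hlam2 Q * x)) * sqrt (Delta Q x / (1 - x / x3 Q))"

definition q_at_x3 :: "queue \<Rightarrow> real" where
  "q_at_x3 Q = Lim (at (x3 Q)) (q_fun Q)"

definition C30 :: "queue \<Rightarrow> state pmf \<Rightarrow> real" where
  "C30 Q \<pi> = - (q_at_x3 Q / (2 * x3 Q))
     * deriv (\<lambda>y. - (N_num Q \<pi> (x3 Q) y / h1 Q (x3 Q) y)) (Y0 Q (x3 Q))"

definition A1 :: "queue \<Rightarrow> state pmf \<Rightarrow> real \<Rightarrow> real" where
  "A1 Q \<pi> x = - (b1 Q x / c_coeff Q x) * C10 Q \<pi>"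

definition A2 :: "queue \<Rightarrow> state pmf \<Rightarrow> real \<Rightarrow> real" where
  "A2 Q \<pi> x = - (b1 Q x / c_coeff Q x) * C20 Q \<pi>"

definition A3 :: "queue \<Rightarrow> state pmf \<Rightarrow> real \<Rightarrow> real" where
  "A3 Q \<pi> x = - (b1 Q x / c_coeff Q x) * C30 Q \<pi>"

definition B3 :: "queue \<Rightarrow> state pmf \<Rightarrow> real \<Rightarrow> real" where
  "B3 Q \<pi> x = - (p1 Q x / c_coeff Q x) * C30 Q \<pi>"

text \<open>\<open>u m \<sim> v m\<close> read as \<open>u m / v m \<longlonglongrightarrow> 1\<close>. As division by 0 yields 0, this forces
  \<open>v m \<noteq> 0\<close> for all large \<open>m\<close>.\<close>

definition tail_equiv :: "(nat \<Rightarrow> real) \<Rightarrow> (nat \<Rightarrow> real) \<Rightarrow> bool" where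
  "tail_equiv u v \<longleftrightarrow> (\<lambda>m. u m / v m) \<longlonglongrightarrow> 1"

end

(* Solving the balance equations of the idle states turns the busy probabilities into a stationary
   measure of a nearest neighbour walk in the quarter plane. Testing this measure with x^m y^n gives a
   Lyapunov criterion for its geometric moments and, at points where the kernel vanishes, the functional
   equation pi_1 = - N(x, Y_0(x)) / h_1(x, Y_0(x)) for 1 < |x| < R. On the kernel curve h_1(x, y) = 0 means
   1 - 1/y = rho_1 (1 - 1/x), which leads to the polynomial g; so h_1(x, Y_0(x)) has no zero with |x| > 1
   other than x_+, and pi_1 continues across |x| = R away from R. At R it is, according as Y(x_+) is
   below, at or above sqrt(mu_2^ / lambda_2^), a simple pole, or analytic in t = sqrt(1 - x/R) up to a
   factor 1/t, or analytic in t. Singularity analysis gives the row n = 0, and the balance equations carry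
   the limit to the other rows, where it satisfies a linear recurrence in n. *)

theory Submission
  imports Defs "HOL-Real_Asymp.Real_Asymp"
begin

section \<open>Singularity analysis at an algebraic branch point\<close>

text \<open>The equivalences demand nonzero constants, so besides the limits their signs must be
  settled. At a pole N is a sum of nonnegative terms; at a pure branch point the y-derivative of
  -N/h_1 has to be shown positive, which needs an argument of its own. A second obstacle is that N
  contains the other boundary function at Y_0(x), whose modulus reaches sqrt(mu_2^ / lambda_2^) at
  the branch point. Analyticity there needs a radius of convergence strictly beyond that number, and
  when mu_2^ = lambda_2^ no monomial in y alone provides it. Once this radius is known, a single
  point (x, y) with y > Y_0(x) and negative drifts gives convergence of the double series, and the
  continuation needs no uniformisation of the kernel curve. Contour integrals are avoided as well:
  enough half-integer powers of 1 - z are subtracted for the remainder to have a bounded second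
  derivative.\<close>

lemma norm_powser_coeff_le:
  fixes b :: "nat \<Rightarrow> complex" and g :: "complex \<Rightarrow> complex"
  assumes sums: "\<And>z. norm z < 1 \<Longrightarrow> (\<lambda>n. b n * z ^ n) sums g z"
    and bound: "\<And>z. norm z < 1 \<Longrightarrow> norm ((deriv ^^ 2) g z) \<le> M"
  shows "real ((n + 2) * (n + 1)) * norm (b (n + 2)) \<le> M"
proof -
  have hol: "g holomorphic_on ball 0 1"
    by (rule power_series_holomorphic[of 0 1 b]) (use sums in auto)
  have hol2: "(deriv ^^ 2) g holomorphic_on ball 0 1"
    by (rule holomorphic_higher_deriv[OF hol]) auto
  have coeff: "(deriv ^^ (n + 2)) g 0 = fact (n + 2) * b (n + 2)"
  proof -
    have "g has_fps_expansion Abs_fps b"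
    proof (rule has_fps_expansionI)
      have "eventually (\<lambda>z::complex. z \<in> ball 0 1) (nhds 0)"
        by (intro eventually_nhds_in_open) auto
      then show "eventually (\<lambda>u. (\<lambda>n. fps_nth (Abs_fps b) n * u ^ n) sums g u) (nhds 0)"
        by eventually_elim (use sums in auto)
    qed
    from fps_nth_fps_expansion[OF this, of "n + 2"] show ?thesis
      by (simp add: field_simps del: funpow.simps fact_Suc)
  qed
  \<comment> \<open>The second derivative need not extend to the closed disc, so Cauchy's inequality
    is taken on circles of radius \<open>r < 1\<close> and then \<open>r\<close> tends to 1.\<close>
  have le: "norm ((deriv ^^ n) ((deriv ^^ 2) g) 0) \<le> fact n * M / r ^ n" if "0 < r" "r < 1" for r
  proof (rule Cauchy_inequality)
    show "(deriv ^^ 2) g holomorphic_on ball 0 r"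
      by (rule holomorphic_on_subset[OF hol2]) (use that in auto)
    show "continuous_on (cball 0 r) ((deriv ^^ 2) g)"
      by (rule continuous_on_subset[OF holomorphic_on_imp_continuous_on[OF hol2]]) (use that in auto)
  qed (use that bound in auto)
  have "((\<lambda>r. fact n * M / r ^ n) \<longlongrightarrow> fact n * M / 1 ^ n) (at_left (1::real))"
    by (intro tendsto_intros) auto
  moreover have "eventually (\<lambda>r. norm ((deriv ^^ n) ((deriv ^^ 2) g) 0) \<le> fact n * M / r ^ n) (at_left (1::real))"
    using eventually_at_left_real[of 0 "1::real"] by (auto elim!: eventually_mono intro!: le)
  ultimately have "norm ((deriv ^^ n) ((deriv ^^ 2) g) 0) \<le> fact n * M / 1 ^ n"
    by (intro tendsto_lowerbound) auto
  moreover have "(deriv ^^ n) ((deriv ^^ 2) g) 0 = fact (n + 2) * b (n + 2)"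
    using coeff by (simp only: funpow_add o_apply)
  ultimately have "norm (fact (n + 2) * b (n + 2)) \<le> fact n * M" by simp
  moreover have "norm (fact (n + 2) * b (n + 2)) = fact n * (real ((n + 2) * (n + 1)) * norm (b (n + 2)))"
  proof -
    have "(fact (n + 2) :: complex) = of_nat (fact n * ((n + 2) * (n + 1)))"
      by (simp add: algebra_simps)
    then show ?thesis by (simp only: norm_mult norm_of_nat norm_fact of_nat_mult of_nat_fact mult.assoc)
  qed
  ultimately show ?thesis by simp
qed

lemma holomorphic_factor_linear:
  assumes "f holomorphic_on ball 0 d"
  obtains k where "k holomorphic_on ball 0 d" "\<And>u. f u - f 0 = u * k u"
proof
  show "(\<lambda>z. if z = 0 then deriv f 0 else (f z - f 0) / (z - 0)) holomorphic_on ball 0 d"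
    by (rule pole_lemma_open[OF assms]) auto
  show "f u - f 0 = u * (if u = 0 then deriv f 0 else (f u - f 0) / (u - 0))" for u by simp
qed

text \<open>Iterated division by \<open>u\<close>. Only the zeroth coefficient is identified with a
  value of \<open>f\<close>, because the limit in \<open>darboux_transfer\<close> depends on no
  other.\<close>

lemma holomorphic_taylor_remainder:
  assumes "f holomorphic_on ball 0 d"
  shows "\<exists>c k. k holomorphic_on ball 0 d \<and> c 0 = f 0 \<and>
     (\<forall>u. f u = (\<Sum>i<Suc N. c i * u ^ i) + u ^ Suc N * k u)"
proof (induction N)
  case 0
  obtain k where k: "k holomorphic_on ball 0 d" "\<And>u. f u - f 0 = u * k u"
    by (rule holomorphic_factor_linear[OF assms]) blast
  have *: "f u = (\<Sum>i<Suc 0. f 0 * u ^ i) + u ^ Suc 0 * k u" for u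
    using k(2)[of u] by (simp add: algebra_simps)
  show ?case
    by (intro exI[of _ "\<lambda>_. f 0"] exI[of _ k] conjI k(1) refl allI *)
next
  case (Suc N)
  then obtain c k where k: "k holomorphic_on ball 0 d" "c 0 = f 0"
     "\<And>u. f u = (\<Sum>i<Suc N. c i * u ^ i) + u ^ Suc N * k u" by blast
  obtain k2 where k2: "k2 holomorphic_on ball 0 d" "\<And>u. k u - k 0 = u * k2 u"
    by (rule holomorphic_factor_linear[OF k(1)]) blast
  define c' where "c' = c(Suc N := k 0)"
  have "f u = (\<Sum>i<Suc (Suc N). c' i * u ^ i) + u ^ Suc (Suc N) * k2 u" for u
  proof -
    have "(\<Sum>i<Suc N. c' i * u ^ i) = (\<Sum>i<Suc N. c i * u ^ i)"
      by (intro sum.cong) (auto simp: c'_def)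
    then have "(\<Sum>i<Suc (Suc N). c' i * u ^ i) = (\<Sum>i<Suc N. c i * u ^ i) + k 0 * u ^ Suc N"
      by (simp add: c'_def)
    moreover have "k u = k 0 + u * k2 u" using k2(2)[of u] by (simp add: algebra_simps)
    ultimately show ?thesis using k(3)[of u] by (simp add: distrib_left mult_ac)
  qed
  then show ?case using k2(1) k(2) by (intro exI[of _ c'] exI[of _ k2]) (auto simp: c'_def)
qed

lemma one_minus_notin_nonpos: "Re z < 1 \<Longrightarrow> 1 - z \<notin> \<real>\<^sub>\<le>\<^sub>0"
  by (auto simp: complex_nonpos_Reals_iff)

lemma norm_csqrt_sq: "cmod (csqrt z) ^ 2 = cmod z"
  by (metis norm_power power2_csqrt)

text \<open>In the coordinate \<open>t = sqrt (1 - z)\<close> a derivative in \<open>z\<close> costs two powers of \<open>t\<close>.\<close>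

lemma deriv_csqrt_power:
  assumes k: "k holomorphic_on ball 0 d" and d: "d > 0"
  obtains k' where "k' holomorphic_on ball 0 d"
    "\<And>z. Re z < 1 \<Longrightarrow> cmod (1 - z) < d ^ 2 \<Longrightarrow>
      ((\<lambda>z. csqrt (1 - z) ^ (j + 2) * k (csqrt (1 - z))) has_field_derivative
         csqrt (1 - z) ^ j * k' (csqrt (1 - z))) (at z)"
proof
  define k' where "k' = (\<lambda>u. - (of_nat (j + 2) * k u + u * deriv k u) / 2)"
  show "k' holomorphic_on ball 0 d" unfolding k'_def
    by (intro holomorphic_intros k holomorphic_deriv) auto
  fix z :: complex assume z: "Re z < 1" "cmod (1 - z) < d ^ 2"
  show "((\<lambda>z. csqrt (1 - z) ^ (j + 2) * k (csqrt (1 - z))) has_field_derivative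
         csqrt (1 - z) ^ j * k' (csqrt (1 - z))) (at z)"
  proof -
    have "cmod (csqrt (1 - z)) ^ 2 < d ^ 2" using z(2) by (simp add: norm_csqrt_sq)
    then have "cmod (csqrt (1 - z)) < d" by (rule power_less_imp_less_base) (use d in simp)
    then have dk: "(k has_field_derivative deriv k (csqrt (1 - z))) (at (csqrt (1 - z)))"
      by (intro holomorphic_derivI[OF k]) auto
    have ds: "((\<lambda>z. csqrt (1 - z)) has_field_derivative - 1 / (2 * csqrt (1 - z))) (at z)"
      using one_minus_notin_nonpos[OF z(1)] by (auto intro!: derivative_eq_intros)
    have nz: "csqrt (1 - z) \<noteq> 0" using z(1) by auto
    have dk': "((\<lambda>z. k (csqrt (1 - z))) has_field_derivative deriv k (csqrt (1 - z)) * (- 1 / (2 * csqrt (1 - z)))) (at z)"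
      using DERIV_chain2[OF dk ds] .
    show ?thesis
      by (rule derivative_eq_intros ds dk' refl)+
         (use nz in \<open>simp add: k'_def field_simps power_add power2_eq_square\<close>)
  qed
qed

lemma binomial_coeff_sums:
  fixes z :: complex
  assumes "norm z < 1"
  shows "(\<lambda>n. (- 1) ^ n * (a gchoose n) * z ^ n) sums (1 - z) powr a"
  using gen_binomial_complex[of "- z" a] assms
  by (simp add: power_minus[of z] mult_ac)

text \<open>Phrased with the entire function \<open>rGamma\<close>: for a natural number
  \<open>b\<close> the binomial series terminates and the limit is 0, so integer and half-integer
  exponents are treated alike.\<close>

lemma binomial_coeff_asymptotic:
  "(\<lambda>n. (- 1) ^ n * (complex_of_real b gchoose n) * of_real (real n powr (b + 1)))
     \<longlonglongrightarrow> rGamma (- of_real b)"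
proof -
  have "eventually (\<lambda>n. (complex_of_real b gchoose n) / ((- 1) ^ n / exp ((complex_of_real b + 1) * of_real (ln (real n))))
     = (- 1) ^ n * (complex_of_real b gchoose n) * of_real (real n powr (b + 1))) sequentially"
    using eventually_gt_at_top[of 0]
  proof eventually_elim
    case (elim n)
    have "exp ((complex_of_real b + 1) * of_real (ln (real n))) = of_real (real n powr (b + 1))"
      using elim by (simp add: powr_def exp_of_real[symmetric])
    then show ?case by (simp add: field_simps power_one_over[symmetric])
  qed
  from Lim_transform_eventually[OF gbinomial_asymptotic[of "complex_of_real b"] this]
  show ?thesis by (simp add: rGamma_inverse_Gamma)
qed

lemma csqrt_power_int:
  assumes "w \<noteq> 0"
  shows "csqrt w powi k = w powr (of_int k / 2)"
proof -
  have "csqrt w powi k = exp (Ln w / 2) powi k" using assms by (simp add: csqrt_exp_Ln)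
  also have "\<dots> = exp (of_int k * (Ln w / 2))" by (simp add: exp_power_int)
  finally show ?thesis using assms by (simp add: powr_def)
qed

text \<open>Each derivative lowers the power of \<open>csqrt (1 - z)\<close> by two, so a fourth
  power is just enough for two derivatives. What is left is a holomorphic function of
  \<open>csqrt (1 - z)\<close>, bounded on the closed ball of half the radius.\<close>

lemma bounded_deriv2_csqrt:
  assumes k: "k holomorphic_on ball 0 d" and d: "d > 0"
    and g: "\<And>z. cmod z < 1 \<Longrightarrow> cmod (1 - z) < d ^ 2 \<Longrightarrow> g z = csqrt (1 - z) ^ 4 * k (csqrt (1 - z))"
  obtains M where "\<And>z. cmod z < 1 \<Longrightarrow> cmod (1 - z) \<le> (d / 2) ^ 2 \<Longrightarrow> cmod ((deriv ^^ 2) g z) \<le> M"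
proof -
  obtain k1 where k1: "k1 holomorphic_on ball 0 d"
    "\<And>z. Re z < 1 \<Longrightarrow> cmod (1 - z) < d ^ 2 \<Longrightarrow>
      ((\<lambda>z. csqrt (1 - z) ^ (2 + 2) * k (csqrt (1 - z))) has_field_derivative
         csqrt (1 - z) ^ 2 * k1 (csqrt (1 - z))) (at z)"
    using deriv_csqrt_power[OF k d, of 2] by blast
  obtain k2 where k2: "k2 holomorphic_on ball 0 d"
    "\<And>z. Re z < 1 \<Longrightarrow> cmod (1 - z) < d ^ 2 \<Longrightarrow>
      ((\<lambda>z. csqrt (1 - z) ^ (0 + 2) * k1 (csqrt (1 - z))) has_field_derivative
         csqrt (1 - z) ^ 0 * k2 (csqrt (1 - z))) (at z)"
    using deriv_csqrt_power[OF k1(1) d, of 0] by blast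
  define W where "W = ball (0::complex) 1 \<inter> ball 1 (d ^ 2)"
  have W: "open W" by (auto simp: W_def)
  have WD: "cmod z < 1" "Re z < 1" "cmod (1 - z) < d ^ 2" if "z \<in> W" for z
    using that complex_Re_le_cmod[of z] by (auto simp: W_def dist_norm)
  have dg: "deriv g z = csqrt (1 - z) ^ 2 * k1 (csqrt (1 - z))" if "z \<in> W" for z
  proof (rule DERIV_imp_deriv)
    have "((\<lambda>z. csqrt (1 - z) ^ (2 + 2) * k (csqrt (1 - z))) has_field_derivative
         csqrt (1 - z) ^ 2 * k1 (csqrt (1 - z))) (at z)"
      using k1(2) WD that by blast
    then show "(g has_field_derivative csqrt (1 - z) ^ 2 * k1 (csqrt (1 - z))) (at z)"
      by (rule has_field_derivative_transform_within_open[OF _ W that]) (use g WD in auto)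
  qed
  have ddg: "(deriv ^^ 2) g z = k2 (csqrt (1 - z))" if "z \<in> W" for z
  proof -
    have "((\<lambda>z. csqrt (1 - z) ^ (0 + 2) * k1 (csqrt (1 - z))) has_field_derivative
         csqrt (1 - z) ^ 0 * k2 (csqrt (1 - z))) (at z)"
      using k2(2) WD that by blast
    then have "(deriv g has_field_derivative csqrt (1 - z) ^ 0 * k2 (csqrt (1 - z))) (at z)"
      by (rule has_field_derivative_transform_within_open[OF _ W that]) (simp only: dg add_0)
    then show ?thesis by (simp add: numeral_2_eq_2 DERIV_imp_deriv)
  qed
  have "continuous_on (cball 0 (d / 2)) k2"
    by (rule continuous_on_subset[OF holomorphic_on_imp_continuous_on[OF k2(1)]]) (use d in auto)
  then have "bounded (k2 ` cball 0 (d / 2))"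
    by (intro compact_imp_bounded compact_continuous_image) auto
  then obtain M where M: "\<And>u. u \<in> cball 0 (d / 2) \<Longrightarrow> cmod (k2 u) \<le> M"
    unfolding bounded_iff by blast
  show ?thesis
  proof (rule that)
    fix z :: complex assume z: "cmod z < 1" "cmod (1 - z) \<le> (d / 2) ^ 2"
    have "cmod (csqrt (1 - z)) ^ 2 \<le> (d / 2) ^ 2" using z(2) by (simp only: norm_csqrt_sq)
    then have "cmod (csqrt (1 - z)) \<le> d / 2" by (rule power2_le_imp_le) (use d in simp)
    moreover have "z \<in> W"
    proof -
      have "(d / 2) ^ 2 < d ^ 2" using d by (simp add: power2_eq_square)
      then show ?thesis using z by (auto simp: W_def dist_norm)
    qed
    ultimately show "cmod ((deriv ^^ 2) g z) \<le> M" using M by (simp add: ddg)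
  qed
qed

text \<open>Darboux's method. Removing the terms with exponents e, ..., e + 5 in
  \<open>csqrt (1 - z)\<close> leaves an exponent e + 6 \<ge> 4, hence a bounded second derivative
  and coefficients of order n^(-2). Since e \<le> 1, these vanish against a factor of order at most
  n^(3/2). The constant \<open>c0\<close> enters only the coefficient with index 0; it allows
  \<open>F\<close> a nonzero limit at 1 when \<open>e = 1\<close>.\<close>

theorem darboux_transfer:
  fixes a :: "nat \<Rightarrow> complex" and e :: int
  assumes sums: "\<And>z. cmod z < 1 \<Longrightarrow> (\<lambda>n. a n * z ^ n) sums F z"
    and S: "open S" "cball 0 1 - {1} \<subseteq> S" "F holomorphic_on S"
    and G: "G holomorphic_on ball 0 d" "d > 0"
    and near: "\<And>z. cmod z < 1 \<Longrightarrow> cmod (1 - z) < d ^ 2 \<Longrightarrow>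
                 F z = c0 + csqrt (1 - z) powi e * G (csqrt (1 - z))"
    and e: "- 2 \<le> e" "e < 2"
  shows "(\<lambda>n. a n * of_real (real n powr (e / 2 + 1))) \<longlonglongrightarrow> G 0 * rGamma (- (of_int e / 2))"
proof -
  obtain c k where k: "k holomorphic_on ball 0 d" and c0: "c 0 = G 0"
     and Gk: "\<And>u. G u = (\<Sum>i<Suc 5. c i * u ^ i) + u ^ Suc 5 * k u"
    using holomorphic_taylor_remainder[OF G(1), of 5] by blast
  \<comment> \<open>\<open>e + 2\<close> is nonnegative, so \<open>k2\<close> absorbs the surplus
    over the fourth power as an ordinary power.\<close>
  define j where "j = nat (e + 2)"
  have j: "e + 6 = int (j + 4)" using e by (simp add: j_def)
  define k2 where "k2 = (\<lambda>u. u ^ j * k u)"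
  have k2: "k2 holomorphic_on ball 0 d" unfolding k2_def by (intro holomorphic_intros k)
  define g where "g = (\<lambda>z. F z - c0 - (\<Sum>i<6. c i * csqrt (1 - z) powi (e + int i)))"
  define B where "B = (\<lambda>i n. (- 1) ^ n * (complex_of_real ((e + int i) / 2) gchoose n))"
  define b where "b = (\<lambda>n. a n - (if n = 0 then c0 else 0) - (\<Sum>i<6. c i * B i n))"
  have g_near: "g z = csqrt (1 - z) ^ 4 * k2 (csqrt (1 - z))"
    if "cmod z < 1" "cmod (1 - z) < d ^ 2" for z
  proof -
    have nz: "csqrt (1 - z) \<noteq> 0" using that by auto
    define t where "t = csqrt (1 - z)"
    have t: "t \<noteq> 0" using nz t_def by simp
    have "t powi e * G t = (\<Sum>i<6. c i * t powi (e + int i)) + t powi (e + 6) * k t"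
    proof -
      have p: "t powi (e + int i) = t powi e * t ^ i" for i
        using power_int_add[of t e "int i"] t by (simp only: power_int_of_nat) simp
      have p6: "t powi (e + 6) = t powi e * t ^ 6" using p[of 6] by (simp only: of_nat_numeral)
      have "G t = (\<Sum>i<6. c i * t ^ i) + t ^ 6 * k t"
      proof -
        have "Suc 5 = (6::nat)" by simp
        then show ?thesis using Gk[of t] by (simp only:)
      qed
      then show ?thesis unfolding p p6 by (simp only: distrib_left sum_distrib_left mult.assoc mult.left_commute)
    qed
    then have "g z = t powi (e + 6) * k t" using near[OF that] by (simp add: g_def t_def)
    also have "t powi (e + 6) = t ^ (j + 4)" unfolding j by (rule power_int_of_nat)
    finally show ?thesis by (simp add: k2_def t_def power_add)
  qed
  have g_sums: "(\<lambda>n. b n * z ^ n) sums g z" if z: "cmod z < 1" for z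
  proof -
    have nz: "1 - z \<noteq> 0" using z by auto
    have 1: "(\<lambda>n. c i * (B i n * z ^ n)) sums (c i * csqrt (1 - z) powi (e + int i))" for i
    proof -
      have "csqrt (1 - z) powi (e + int i) = (1 - z) powr complex_of_real ((e + int i) / 2)"
        using csqrt_power_int[OF nz, of "e + int i"] by simp
      then show ?thesis
        using binomial_coeff_sums[OF z, of "complex_of_real ((e + int i) / 2)"]
        unfolding B_def by (intro sums_mult) simp
    qed
    have 2: "(\<lambda>n. (if n = 0 then c0 else 0) * z ^ n) sums c0"
    proof -
      have "(\<lambda>n. (if n = 0 then c0 else 0) * z ^ n) sums (\<Sum>n\<in>{0}. (if n = 0 then c0 else 0) * z ^ n)"
        by (rule sums_finite) auto
      then show ?thesis by simp
    qed
    have "(\<lambda>n. a n * z ^ n - (if n = 0 then c0 else 0) * z ^ n - (\<Sum>i<6. c i * (B i n * z ^ n))) sums g z"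
      unfolding g_def by (intro sums_diff sums_sum sums 1 2 z)
    then show ?thesis unfolding b_def by (simp add: algebra_simps sum_distrib_right sum_distrib_left)
  qed
  obtain M1 where M1: "\<And>z. cmod z < 1 \<Longrightarrow> cmod (1 - z) \<le> (d / 2) ^ 2 \<Longrightarrow> cmod ((deriv ^^ 2) g z) \<le> M1"
    using bounded_deriv2_csqrt[OF k2 G(2) g_near] by blast
  \<comment> \<open>Removing the cut from 1 to infinity makes the principal root holomorphic; the
    part of the closed disc away from 1 is compact and stays inside \<open>S'\<close>.\<close>
  define S' where "S' = S \<inter> {z. 1 - z \<notin> \<real>\<^sub>\<le>\<^sub>0}"
  have S': "open S'"
  proof -
    have "open ((\<lambda>z::complex. 1 - z) -` (- \<real>\<^sub>\<le>\<^sub>0))"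
      by (intro open_vimage continuous_intros) auto
    moreover have "(\<lambda>z::complex. 1 - z) -` (- \<real>\<^sub>\<le>\<^sub>0) = {z. 1 - z \<notin> \<real>\<^sub>\<le>\<^sub>0}" by auto
    ultimately show ?thesis using S(1) by (simp add: S'_def open_Int)
  qed
  have gS': "g holomorphic_on S'"
  proof -
    have "F holomorphic_on S'" by (rule holomorphic_on_subset[OF S(3)]) (auto simp: S'_def)
    moreover have "(\<lambda>z. csqrt (1 - z)) holomorphic_on S'"
      by (intro holomorphic_intros) (auto simp: S'_def)
    moreover have "csqrt (1 - z) \<noteq> 0" if "z \<in> S'" for z using that by (auto simp: S'_def)
    ultimately show ?thesis unfolding g_def by (intro holomorphic_intros) (auto simp: S'_def)
  qed
  define A where "A = cball (0::complex) 1 - ball 1 ((d / 2) ^ 2)"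
  have A: "compact A" unfolding A_def by (intro compact_diff) auto
  have AS: "A \<subseteq> S'"
  proof
    fix z assume z: "z \<in> A"
    have z1: "z \<noteq> 1" using z G(2) by (auto simp: A_def)
    have "1 - z \<notin> \<real>\<^sub>\<le>\<^sub>0"
    proof
      assume "1 - z \<in> \<real>\<^sub>\<le>\<^sub>0"
      then have *: "Re z \<ge> 1" "Im z = 0" by (auto simp: complex_nonpos_Reals_iff)
      moreover have "Re z \<le> 1" using complex_Re_le_cmod[of z] z by (auto simp: A_def)
      ultimately show False using z1 by (auto simp: complex_eq_iff)
    qed
    then show "z \<in> S'" using z z1 S(2) by (auto simp: S'_def A_def)
  qed
  have "continuous_on A ((deriv ^^ 2) g)"
    by (rule continuous_on_subset[OF holomorphic_on_imp_continuous_on[OF holomorphic_higher_deriv[OF gS' S']] AS])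
  then have "bounded ((deriv ^^ 2) g ` A)" using A by (intro compact_imp_bounded compact_continuous_image)
  then obtain M2 where M2: "\<And>z. z \<in> A \<Longrightarrow> cmod ((deriv ^^ 2) g z) \<le> M2"
    unfolding bounded_iff by blast
  define M where "M = max M1 M2"
  have M: "cmod ((deriv ^^ 2) g z) \<le> M" if "cmod z < 1" for z
    using M1[of z] M2[of z] that by (force simp: M_def A_def dist_norm)
  have coeff: "real ((n + 2) * (n + 1)) * cmod (b (n + 2)) \<le> M" for n
    by (rule norm_powser_coeff_le[OF g_sums M])
  have b0: "(\<lambda>n. b n * of_real (real n powr (e / 2 + 1))) \<longlonglongrightarrow> 0"
  proof (rule Lim_null_comparison)
    show "(\<lambda>n. M * real n powr (3 / 2) / (real n * (real n - 1))) \<longlonglongrightarrow> 0"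
      by real_asymp
    show "eventually (\<lambda>n. cmod (b n * of_real (real n powr (e / 2 + 1))) \<le> M * real n powr (3 / 2) / (real n * (real n - 1))) sequentially"
      using eventually_ge_at_top[of 2]
    proof eventually_elim
      case (elim n)
      have bn: "cmod (b n) \<le> M / (real n * (real n - 1))"
      proof -
        obtain k where "n = k + 2" using elim by (metis le_add_diff_inverse2)
        then have "real n * (real n - 1) * cmod (b n) \<le> M" "real n * (real n - 1) > 0"
          using coeff[of k] by (simp_all add: algebra_simps add_pos_nonneg)
        then show ?thesis by (simp add: pos_le_divide_eq mult.commute)
      qed
      have "e \<le> 1" using e by simp
      then have "real_of_int e / 2 + 1 \<le> 3 / 2" by simp
      then have "real n powr (e / 2 + 1) \<le> real n powr (3 / 2)" using elim by (intro powr_mono) auto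
      then have "cmod (b n) * real n powr (e / 2 + 1) \<le> M / (real n * (real n - 1)) * real n powr (3 / 2)"
        using bn by (intro mult_mono) (auto intro: order_trans[OF norm_ge_zero])
      then show ?case by (simp add: norm_mult)
    qed
  qed
  \<comment> \<open>Every further power of \<open>csqrt (1 - z)\<close> costs a factor n^(-1/2), so
    only index 0 survives.\<close>
  have Bi: "(\<lambda>n. B i n * of_real (real n powr (e / 2 + 1))) \<longlonglongrightarrow> (if i = 0 then rGamma (- (of_int e / 2)) else 0)" for i
  proof -
    have 1: "(\<lambda>n. B i n * of_real (real n powr ((e + int i) / 2 + 1))) \<longlonglongrightarrow> rGamma (- of_real ((e + int i) / 2))"
      unfolding B_def by (rule binomial_coeff_asymptotic)
    show ?thesis
    proof (cases "i = 0")
      case True then show ?thesis using 1 by simp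
    next
      case False
      have 2: "(\<lambda>n. complex_of_real (real n powr (- real i / 2))) \<longlonglongrightarrow> of_real 0"
        using False by (intro tendsto_of_real tendsto_neg_powr filterlim_real_sequentially) auto
      have "(\<lambda>n. (B i n * of_real (real n powr ((e + int i) / 2 + 1))) * complex_of_real (real n powr (- real i / 2))) \<longlonglongrightarrow> 0"
        using tendsto_mult[OF 1 2] by simp
      moreover have "(B i n * of_real (real n powr ((e + int i) / 2 + 1))) * complex_of_real (real n powr (- real i / 2))
         = B i n * of_real (real n powr (e / 2 + 1))" for n
      proof -
        have "real n powr ((e + int i) / 2 + 1) * real n powr (- real i / 2) = real n powr (e / 2 + 1)"
        proof -
          have "real_of_int (e + int i) / 2 + 1 + (- real i / 2) = real_of_int e / 2 + 1"
            by (simp add: add_divide_distrib)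
          then show ?thesis by (metis powr_add)
        qed
        then show ?thesis by (metis mult.assoc of_real_mult)
      qed
      ultimately have "(\<lambda>n. B i n * of_real (real n powr (e / 2 + 1))) \<longlonglongrightarrow> 0" by (simp only:)
      then show ?thesis using False by simp
    qed
  qed
  have "(\<lambda>n. b n * of_real (real n powr (e / 2 + 1)) + (if n = 0 then c0 else 0) * of_real (real n powr (e / 2 + 1))
       + (\<Sum>i<6. c i * (B i n * of_real (real n powr (e / 2 + 1)))))
       \<longlonglongrightarrow> 0 + 0 + (\<Sum>i<6. c i * (if i = 0 then rGamma (- (of_int e / 2)) else 0))"
  proof (intro tendsto_add b0 tendsto_sum tendsto_mult tendsto_const Bi)
    show "(\<lambda>n. (if n = 0 then c0 else 0) * complex_of_real (real n powr (e / 2 + 1))) \<longlonglongrightarrow> 0"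
      by (rule tendsto_eventually) (use eventually_gt_at_top[of 0] in eventually_elim, auto)
  qed
  moreover have "(\<Sum>i<6. c i * (if i = 0 then rGamma (- (of_int e / 2)) else 0)) = G 0 * rGamma (- (of_int e / 2))"
    by (simp add: c0 if_distrib cong: if_cong)
  moreover have "b n * of_real (real n powr (e / 2 + 1)) + (if n = 0 then c0 else 0) * of_real (real n powr (e / 2 + 1))
       + (\<Sum>i<6. c i * (B i n * of_real (real n powr (e / 2 + 1)))) = a n * of_real (real n powr (e / 2 + 1))" for n
    by (simp add: b_def algebra_simps sum_distrib_right sum_distrib_left)
  ultimately show ?thesis by simp
qed

section \<open>Principal square roots, local factorisations, limits of shifted sequences\<close>

lemma Re_pos_notin: "Re z > 0 \<Longrightarrow> z \<notin> \<real>\<^sub>\<le>\<^sub>0"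
  by (auto simp: complex_nonpos_Reals_iff)

lemma Re_csqrt_pos: "Re z > 0 \<Longrightarrow> Re (csqrt z) > 0"
proof (rule ccontr)
  assume z: "Re z > 0" "\<not> Re (csqrt z) > 0"
  then have "Re (csqrt z) = 0" using csqrt_principal[of z] by auto
  then have "Re ((csqrt z)\<^sup>2) \<le> 0" by (simp add: power2_eq_square)
  then show False using z by simp
qed

lemma Im_csqrt_less:
  assumes "Re z > 0"
  shows "\<bar>Im (csqrt z)\<bar> < Re (csqrt z)"
proof -
  have "Re ((csqrt z)\<^sup>2) > 0" using assms by simp
  then have "(Im (csqrt z))\<^sup>2 < (Re (csqrt z))\<^sup>2" unfolding power2_eq_square by simp
  then show ?thesis
    using power2_less_imp_less[of "\<bar>Im (csqrt z)\<bar>" "Re (csqrt z)"] Re_csqrt_pos[OF assms] by (metis abs_of_nonneg power2_abs less_imp_le)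
qed

text \<open>Both square roots have arguments strictly between -pi/4 and pi/4, so their product keeps
  a positive real part and is itself a principal value.\<close>

lemma csqrt_mult_Re_pos:
  assumes "Re u > 0" "Re v > 0"
  shows "csqrt (u * v) = csqrt u * csqrt v"
proof (rule csqrt_unique)
  show "(csqrt u * csqrt v)\<^sup>2 = u * v" unfolding power_mult_distrib by simp
  have "\<bar>Im (csqrt u)\<bar> * \<bar>Im (csqrt v)\<bar> < Re (csqrt u) * Re (csqrt v)"
    by (intro mult_strict_mono Im_csqrt_less assms Re_csqrt_pos) auto
  moreover have "Im (csqrt u) * Im (csqrt v) \<le> \<bar>Im (csqrt u)\<bar> * \<bar>Im (csqrt v)\<bar>"
    by (metis abs_ge_self abs_mult)
  ultimately show "0 < Re (csqrt u * csqrt v) \<or> Re (csqrt u * csqrt v) = 0 \<and> 0 \<le> Im (csqrt u * csqrt v)"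
    by (simp only: times_complex.sel) linarith
qed

lemma holomorphic_factor_deriv:
  assumes "f holomorphic_on ball 0 d" "d > 0" "(f has_field_derivative D) (at 0)"
  obtains k where "k holomorphic_on ball 0 d" "\<And>u. f u = f 0 + u * k u" "k 0 = D"
proof -
  obtain k where k: "k holomorphic_on ball 0 d" "\<And>u. f u - f 0 = u * k u"
    using holomorphic_factor_linear[OF assms(1)] by blast
  have dk: "(k has_field_derivative deriv k 0) (at 0)"
    by (rule holomorphic_derivI[OF k(1)]) (use assms in auto)
  have "((\<lambda>u. f 0 + u * k u) has_field_derivative (0 + (1 * k 0 + deriv k 0 * 0))) (at 0)"
    by (intro DERIV_add DERIV_const DERIV_mult DERIV_ident dk)
  moreover have fk: "f u = f 0 + u * k u" for u using k(2)[of u] by (simp add: algebra_simps)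
  then have "(\<lambda>u. f 0 + u * k u) = f" by (intro ext) (rule sym)
  ultimately have "(f has_field_derivative k 0) (at 0)" by simp
  then have "k 0 = D" using assms(3) DERIV_unique by blast
  then show thesis using that k(1) fk by blast
qed

lemma eventually_Re_pos:
  assumes "isCont f a" "Re (f a) > 0"
  shows "eventually (\<lambda>t. Re (f t) > 0) (nhds a)"
proof -
  have "isCont (\<lambda>t. Re (f t)) a" using assms(1) by (rule continuous_Re)
  then have "filterlim (\<lambda>t. Re (f t)) (nhds (Re (f a))) (nhds a)"
    using tendsto_at_iff_tendsto_nhds[of "\<lambda>t. Re (f t)" a] by (simp add: isCont_def)
  then show ?thesis using assms(2) by (rule order_tendstoD)
qed

lemma eventually_ne:
  fixes f :: "'a :: t2_space \<Rightarrow> 'b :: t1_space"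
  assumes "isCont f a" "f a \<noteq> c"
  shows "eventually (\<lambda>t. f t \<noteq> c) (nhds a)"
proof -
  have "filterlim f (nhds (f a)) (nhds a)"
    using assms(1) by (simp add: isCont_def tendsto_at_iff_tendsto_nhds)
  then show ?thesis using assms(2) by (auto intro: tendsto_imp_eventually_ne)
qed

lemma rGamma_half: "rGamma (1 / 2 :: complex) = of_real (1 / sqrt pi)"
  unfolding rGamma_inverse_Gamma Gamma_one_half_complex by (simp only: inverse_eq_divide of_real_divide of_real_1)

lemma rGamma_minus_half: "rGamma (- (1 / 2) :: complex) = of_real (- 1 / (2 * sqrt pi))"
  using rGamma_plus1[of "- (1 / 2) :: complex"] rGamma_half by simp

lemma tendsto_of_real_limitD:
  assumes "(\<lambda>m. complex_of_real (f m)) \<longlonglongrightarrow> c" "c = of_real r"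
  shows "f \<longlonglongrightarrow> r"
  using assms by (simp add: tendsto_of_real_iff)

lemma tendsto_shift:
  fixes g :: "nat \<Rightarrow> real"
  assumes "(\<lambda>m. g m * r ^ m * real m powr a) \<longlonglongrightarrow> c" "r > 0"
  shows "(\<lambda>m. g (Suc m) * r ^ m * real m powr a) \<longlonglongrightarrow> c / r"
    "(\<lambda>m. g (m - 1) * r ^ m * real m powr a) \<longlonglongrightarrow> c * r"
proof -
  have s: "(\<lambda>m. g (Suc m) * r ^ Suc m * real (Suc m) powr a) \<longlonglongrightarrow> c"
    using LIMSEQ_Suc[OF assms(1)] .
  have 1: "(\<lambda>m. (real m / real (Suc m)) powr a) \<longlonglongrightarrow> 1" by real_asymp
  have "(\<lambda>m. (g (Suc m) * r ^ Suc m * real (Suc m) powr a) * (real m / real (Suc m)) powr a / r) \<longlonglongrightarrow> c * 1 / r"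
    by (intro tendsto_intros s 1) (use assms in auto)
  moreover have "(g (Suc m) * r ^ Suc m * real (Suc m) powr a) * (real m / real (Suc m)) powr a / r = g (Suc m) * r ^ m * real m powr a" for m
    using assms(2) by (simp add: powr_divide)
  ultimately show "(\<lambda>m. g (Suc m) * r ^ m * real m powr a) \<longlonglongrightarrow> c / r" by simp
  have 2: "(\<lambda>m. (real (Suc m) / real m) powr a) \<longlonglongrightarrow> 1" by real_asymp
  have l: "(\<lambda>m. (g m * r ^ m * real m powr a) * (real (Suc m) / real m) powr a * r) \<longlonglongrightarrow> c * 1 * r"
    by (intro tendsto_intros assms 2)
  have "eventually (\<lambda>m. (g m * r ^ m * real m powr a) * (real (Suc m) / real m) powr a * r = g m * r ^ Suc m * real (Suc m) powr a) sequentially"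
    using eventually_gt_at_top[of 0] by eventually_elim (simp add: powr_divide)
  from Lim_transform_eventually[OF l this] have "(\<lambda>m. g (Suc m - 1) * r ^ Suc m * real (Suc m) powr a) \<longlonglongrightarrow> c * r" by simp
  then show "(\<lambda>m. g (m - 1) * r ^ m * real m powr a) \<longlonglongrightarrow> c * r" by (rule LIMSEQ_imp_Suc)
qed

lemma tendsto_unshift:
  fixes g :: "nat \<Rightarrow> real"
  assumes "(\<lambda>m. g (Suc m) * r ^ m * real m powr a) \<longlonglongrightarrow> c" "r > 0"
  shows "(\<lambda>m. g m * r ^ m * real m powr a) \<longlonglongrightarrow> c * r"
proof -
  have "(\<lambda>m. g (Suc (m - 1)) * r ^ m * real m powr a) \<longlonglongrightarrow> c * r"
    by (rule tendsto_shift(2)[where g = "\<lambda>m. g (Suc m)"]) fact+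
  moreover have "eventually (\<lambda>m. g (Suc (m - 1)) * r ^ m * real m powr a = g m * r ^ m * real m powr a) sequentially"
    using eventually_gt_at_top[of 0] by eventually_elim simp
  ultimately show ?thesis by (rule Lim_transform_eventually)
qed

section \<open>Stationary measures of the nearest neighbour walk\<close>

text \<open>\<open>p m n\<close> is the stationary probability of the busy states: eliminating the idle states leaves a walk
  with up rates \<open>l1\<close>, \<open>l2\<close> and down rates \<open>m1\<close>, \<open>m2\<close>, which are \<open>m1 + r1 * m2\<close>, \<open>m2 + r2 * m1\<close>
  while the other orbit is empty.\<close>

locale orbit_walk =
  fixes l1 l2 m1 m2 r1 r2 :: real and p :: "nat \<Rightarrow> nat \<Rightarrow> real"
  assumes pos: "l1 > 0" "l2 > 0" "m1 > 0" "m2 > 0" "0 < r1" "r1 < 1" "0 < r2" "r2 < 1"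
    and l1_less_m1: "l1 < m1"
    and stable: "l1 + r1 * l2 < m1 + r1 * m2"
    and p_nonneg: "\<And>m n. 0 \<le> p m n"
    and p_pos: "0 < p 0 0"
    and p_summable: "(\<lambda>(m, n). p m n) summable_on UNIV"
    and balance: "\<And>m n. p m n * (l1 + l2 + (if m = 0 then 0 else if n = 0 then m1 + r1 * m2 else m1)
          + (if n = 0 then 0 else if m = 0 then m2 + r2 * m1 else m2))
       = (if m = 0 then 0 else l1 * p (m - 1) n) + (if n = 0 then 0 else l2 * p m (n - 1))
       + (if n = 0 then m1 + r1 * m2 else m1) * p (Suc m) n
       + (if m = 0 then m2 + r2 * m1 else m2) * p m (Suc n)"
begin

definition k1 :: real where "k1 = m1 + r1 * m2"
definition k2 :: real where "k2 = m2 + r2 * m1"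

definition d1 :: "nat \<Rightarrow> real" where "d1 n = (if n = 0 then k1 else m1)"
definition d2 :: "nat \<Rightarrow> real" where "d2 m = (if m = 0 then k2 else m2)"

lemma k_pos: "k1 > 0" "k2 > 0" "k1 > m1" "k2 > m2"
  using pos by (auto simp: k1_def k2_def add_pos_pos)

definition gsum :: "real \<Rightarrow> real \<Rightarrow> bool" where
  "gsum x y \<longleftrightarrow> (\<lambda>(m, n). p m n * x ^ m * y ^ n) summable_on UNIV"

text \<open>The generator of the walk acting on \<open>F\<close>, polymorphic because real test
  functions yield the drift criterion and complex monomials the functional equation.\<close>

definition gen :: "(nat \<Rightarrow> nat \<Rightarrow> 'a) \<Rightarrow> nat \<Rightarrow> nat \<Rightarrow> 'a :: {real_normed_field, banach}" where
  "gen F m n = of_real l1 * (F (Suc m) n - F m n) + of_real l2 * (F m (Suc n) - F m n)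
     + (if m = 0 then 0 else of_real (d1 n) * (F (m - 1) n - F m n))
     + (if n = 0 then 0 else of_real (d2 m) * (F m (n - 1) - F m n))"

lemma gsum_mono:
  assumes "gsum x y" "0 \<le> x'" "x' \<le> x" "0 \<le> y'" "y' \<le> y"
  shows "gsum x' y'"
  unfolding gsum_def
proof (rule summable_on_comparison_test[OF assms(1)[unfolded gsum_def]])
  fix s :: "nat \<times> nat"
  obtain m n where s: "s = (m, n)" by force
  have "p m n * x' ^ m * y' ^ n \<le> p m n * x ^ m * y ^ n"
    using assms p_nonneg by (intro mult_mono power_mono mult_nonneg_nonneg) auto
  then show "(case s of (m, n) \<Rightarrow> p m n * x' ^ m * y' ^ n) \<le> (case s of (m, n) \<Rightarrow> p m n * x ^ m * y ^ n)"
    by (simp add: s)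
  show "0 \<le> (case s of (m, n) \<Rightarrow> p m n * x' ^ m * y' ^ n)"
    using p_nonneg assms by (simp add: s)
qed

text \<open>Stationarity in weak form. Domination by a summable monomial makes all sums below
  converge absolutely, so the shifts may be moved from \<open>F\<close> to \<open>p\<close>; after
  that the coefficient of each \<open>F m n\<close> vanishes by \<open>balance\<close>.\<close>

lemma test_function:
  fixes F :: "nat \<Rightarrow> nat \<Rightarrow> 'a :: {real_normed_field, banach}"
  assumes x: "x > 0" and y: "y > 0" and sm: "gsum x y" and bd: "\<And>m n. norm (F m n) \<le> C * x ^ m * y ^ n"
  shows "((\<lambda>(m, n). of_real (p m n) * gen F m n) has_sum 0) UNIV"
proof -
  have C: "0 \<le> C" using order_trans[OF norm_ge_zero bd[of 0 0]] by simp
  have wsum: "(\<lambda>(m, n). K * (p m n * x ^ m * y ^ n)) summable_on UNIV" for K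
    using summable_on_cmult_right[OF sm[unfolded gsum_def], of K] by (simp add: case_prod_unfold)
  have sF: "(\<lambda>(m, n). of_real (p m n) * H m n) summable_on UNIV"
    if "\<And>m n. norm (H m n) \<le> K * x ^ m * y ^ n" for H :: "nat \<Rightarrow> nat \<Rightarrow> 'a" and K
  proof (rule abs_summable_summable)
    show "(\<lambda>s. norm (case s of (m, n) \<Rightarrow> of_real (p m n) * H m n)) summable_on UNIV"
    proof (rule summable_on_comparison_test[OF wsum[of K]])
      fix s :: "nat \<times> nat"
      obtain m n where s: "s = (m, n)" by force
      have "p m n * norm (H m n) \<le> p m n * (K * x ^ m * y ^ n)"
        by (intro mult_left_mono that p_nonneg)
      then show "norm (case s of (m, n) \<Rightarrow> of_real (p m n) * H m n) \<le> (case s of (m, n) \<Rightarrow> K * (p m n * x ^ m * y ^ n))"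
        using p_nonneg by (simp add: s norm_mult mult_ac)
    qed auto
  qed
  have b1: "norm (F (Suc m) n) \<le> (C * x) * x ^ m * y ^ n" for m n
    using bd[of "Suc m" n] by (simp add: mult_ac)
  have b2: "norm (F m (Suc n)) \<le> (C * y) * x ^ m * y ^ n" for m n
    using bd[of m "Suc n"] by (simp add: mult_ac)
  have b3: "norm (if m = 0 then 0 else of_real (d1 n) * F (m - 1) n) \<le> (C * (k1 + m1) / x) * x ^ m * y ^ n" for m n
  proof (cases m)
    case (Suc i)
    have "\<bar>d1 n\<bar> * norm (F i n) \<le> (k1 + m1) * (C * x ^ i * y ^ n)"
      using k_pos pos C x y by (intro mult_mono bd) (auto simp: d1_def)
    then show ?thesis using x by (simp add: Suc norm_mult mult_ac)
  qed (use C x y k_pos pos in auto)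
  have b4: "norm (if n = 0 then 0 else of_real (d2 m) * F m (n - 1)) \<le> (C * (k2 + m2) / y) * x ^ m * y ^ n" for m n
  proof (cases n)
    case (Suc i)
    have "\<bar>d2 m\<bar> * norm (F m i) \<le> (k2 + m2) * (C * x ^ m * y ^ i)"
      using k_pos pos C x y by (intro mult_mono bd) (auto simp: d2_def)
    then show ?thesis using y by (simp add: Suc norm_mult mult_ac)
  qed (use C x y k_pos pos in auto)
  define D where "D = (\<lambda>m n. l1 + l2 + (if m = 0 then 0 else d1 n) + (if n = 0 then 0 else d2 m))"
  have Db: "\<bar>D m n\<bar> \<le> l1 + l2 + k1 + m1 + k2 + m2" for m n
    using pos k_pos by (auto simp: D_def d1_def d2_def)
  have b5: "norm (of_real (D m n) * F m n) \<le> ((l1 + l2 + k1 + m1 + k2 + m2) * C) * x ^ m * y ^ n" for m n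
    using mult_mono[OF Db[of m n] bd[of m n]] pos k_pos C x y by (simp add: norm_mult mult_ac)
  obtain S1 where S1: "((\<lambda>(m, n). of_real (p m n) * F (Suc m) n) has_sum S1) UNIV"
    using sF[OF b1] by (auto simp: summable_on_def)
  obtain S2 where S2: "((\<lambda>(m, n). of_real (p m n) * F m (Suc n)) has_sum S2) UNIV"
    using sF[OF b2] by (auto simp: summable_on_def)
  obtain S3 where S3: "((\<lambda>(m, n). of_real (p m n) * (if m = 0 then 0 else of_real (d1 n) * F (m - 1) n)) has_sum S3) UNIV"
    using sF[OF b3] by (auto simp: summable_on_def)
  obtain S4 where S4: "((\<lambda>(m, n). of_real (p m n) * (if n = 0 then 0 else of_real (d2 m) * F m (n - 1))) has_sum S4) UNIV"
    using sF[OF b4] by (auto simp: summable_on_def)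
  obtain S5 where S5: "((\<lambda>(m, n). of_real (p m n) * (of_real (D m n) * F m n)) has_sum S5) UNIV"
    using sF[OF b5] by (auto simp: summable_on_def)
  have lhs: "((\<lambda>(m, n). of_real (p m n) * gen F m n) has_sum (of_real l1 * S1 + of_real l2 * S2 + S3 + S4 - S5)) UNIV"
  proof -
    have "((\<lambda>s. of_real l1 * (case s of (m, n) \<Rightarrow> of_real (p m n) * F (Suc m) n)
       + of_real l2 * (case s of (m, n) \<Rightarrow> of_real (p m n) * F m (Suc n))
       + (case s of (m, n) \<Rightarrow> of_real (p m n) * (if m = 0 then 0 else of_real (d1 n) * F (m - 1) n))
       + (case s of (m, n) \<Rightarrow> of_real (p m n) * (if n = 0 then 0 else of_real (d2 m) * F m (n - 1)))
       - (case s of (m, n) \<Rightarrow> of_real (p m n) * (of_real (D m n) * F m n))) has_sum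
        (of_real l1 * S1 + of_real l2 * S2 + S3 + S4 - S5)) UNIV"
      unfolding diff_conv_add_uminus
      by (intro has_sum_add has_sum_uminusI has_sum_cmult_right S1 S2 S3 S4 S5)
    then show ?thesis
      by (rule has_sum_cong[THEN iffD1, rotated]) (auto simp: gen_def D_def algebra_simps)
  qed
  \<comment> \<open>Reindexing turns a shifted argument of \<open>F\<close> into a shifted argument
    of \<open>p\<close>; states outside the range of the shift contribute the default value
    0.\<close>
  have R1: "((\<lambda>(m, n). (if m = 0 then 0 else of_real (p (m - 1) n) * F m n)) has_sum S1) UNIV"
  proof -
    have "((\<lambda>(m, n). (if m = 0 then 0 else of_real (p (m - 1) n) * F m n)) has_sum S1) ((\<lambda>(m, n). (Suc m, n)) ` UNIV)"
      by (subst has_sum_reindex) (use S1 in \<open>auto simp: inj_on_def o_def case_prod_unfold\<close>)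
    then show ?thesis
    proof (rule has_sum_cong_neutral[THEN iffD1, rotated -1])
      fix s :: "nat \<times> nat" assume "s \<in> UNIV - (\<lambda>(m, n). (Suc m, n)) ` UNIV"
      then show "(case s of (m, n) \<Rightarrow> if m = 0 then 0 else of_real (p (m - 1) n) * F m n) = 0"
        by (cases s; cases "fst s") (auto simp: image_iff)
    qed auto
  qed
  have R2: "((\<lambda>(m, n). (if n = 0 then 0 else of_real (p m (n - 1)) * F m n)) has_sum S2) UNIV"
  proof -
    have "((\<lambda>(m, n). (if n = 0 then 0 else of_real (p m (n - 1)) * F m n)) has_sum S2) ((\<lambda>(m, n). (m, Suc n)) ` UNIV)"
      by (subst has_sum_reindex) (use S2 in \<open>auto simp: inj_on_def o_def case_prod_unfold\<close>)
    then show ?thesis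
    proof (rule has_sum_cong_neutral[THEN iffD1, rotated -1])
      fix s :: "nat \<times> nat" assume "s \<in> UNIV - (\<lambda>(m, n). (m, Suc n)) ` UNIV"
      then show "(case s of (m, n) \<Rightarrow> if n = 0 then 0 else of_real (p m (n - 1)) * F m n) = 0"
        by (cases s; cases "snd s") (auto simp: image_iff)
    qed auto
  qed
  have R3: "((\<lambda>(m, n). of_real (p (Suc m) n) * (of_real (d1 n) * F m n)) has_sum S3) UNIV"
  proof -
    have "((\<lambda>(m, n). of_real (p m n) * (if m = 0 then 0 else of_real (d1 n) * F (m - 1) n)) has_sum S3) ((\<lambda>(m, n). (Suc m, n)) ` UNIV)"
      using S3
    proof (rule has_sum_cong_neutral[THEN iffD1, rotated -1])
      fix s :: "nat \<times> nat" assume "s \<in> UNIV - (\<lambda>(m, n). (Suc m, n)) ` UNIV"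
      then show "(case s of (m, n) \<Rightarrow> of_real (p m n) * (if m = 0 then 0 else of_real (d1 n) * F (m - 1) n)) = 0"
        by (cases s; cases "fst s") (auto simp: image_iff)
    qed auto
    then show ?thesis
      by (subst (asm) has_sum_reindex) (auto simp: inj_on_def o_def case_prod_unfold)
  qed
  have R4: "((\<lambda>(m, n). of_real (p m (Suc n)) * (of_real (d2 m) * F m n)) has_sum S4) UNIV"
  proof -
    have "((\<lambda>(m, n). of_real (p m n) * (if n = 0 then 0 else of_real (d2 m) * F m (n - 1))) has_sum S4) ((\<lambda>(m, n). (m, Suc n)) ` UNIV)"
      using S4
    proof (rule has_sum_cong_neutral[THEN iffD1, rotated -1])
      fix s :: "nat \<times> nat" assume "s \<in> UNIV - (\<lambda>(m, n). (m, Suc n)) ` UNIV"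
      then show "(case s of (m, n) \<Rightarrow> of_real (p m n) * (if n = 0 then 0 else of_real (d2 m) * F m (n - 1))) = 0"
        by (cases s; cases "snd s") (auto simp: image_iff)
    qed auto
    then show ?thesis
      by (subst (asm) has_sum_reindex) (auto simp: inj_on_def o_def case_prod_unfold)
  qed
  have rhs: "((\<lambda>s. of_real l1 * (case s of (m, n) \<Rightarrow> if m = 0 then 0 else of_real (p (m - 1) n) * F m n)
       + of_real l2 * (case s of (m, n) \<Rightarrow> if n = 0 then 0 else of_real (p m (n - 1)) * F m n)
       + (case s of (m, n) \<Rightarrow> of_real (p (Suc m) n) * (of_real (d1 n) * F m n))
       + (case s of (m, n) \<Rightarrow> of_real (p m (Suc n)) * (of_real (d2 m) * F m n))
       - (case s of (m, n) \<Rightarrow> of_real (p m n) * (of_real (D m n) * F m n))) has_sum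
        (of_real l1 * S1 + of_real l2 * S2 + S3 + S4 - S5)) UNIV"
    unfolding diff_conv_add_uminus
    by (intro has_sum_add has_sum_uminusI has_sum_cmult_right R1 R2 R3 R4 S5)
  have zero: "of_real l1 * (if m = 0 then 0 else of_real (p (m - 1) n) * F m n)
       + of_real l2 * (if n = 0 then 0 else of_real (p m (n - 1)) * F m n)
       + of_real (p (Suc m) n) * (of_real (d1 n) * F m n)
       + of_real (p m (Suc n)) * (of_real (d2 m) * F m n)
       - of_real (p m n) * (of_real (D m n) * F m n) = 0" for m n
  proof -
    have b: "p m n * D m n = l1 * (if m = 0 then 0 else p (m - 1) n) + l2 * (if n = 0 then 0 else p m (n - 1))
       + d1 n * p (Suc m) n + d2 m * p m (Suc n)"
    proof -
      have "D m n = l1 + l2 + (if m = 0 then 0 else if n = 0 then m1 + r1 * m2 else m1)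
          + (if n = 0 then 0 else if m = 0 then m2 + r2 * m1 else m2)"
        by (simp add: D_def d1_def d2_def k1_def k2_def)
      then have "p m n * D m n = (if m = 0 then 0 else l1 * p (m - 1) n) + (if n = 0 then 0 else l2 * p m (n - 1))
          + d1 n * p (Suc m) n + d2 m * p m (Suc n)"
        using balance[of m n] by (simp only: d1_def d2_def k1_def k2_def)
      then show ?thesis by (cases "m = 0"; cases "n = 0") simp_all
    qed
    have "of_real l1 * (if m = 0 then 0 else of_real (p (m - 1) n) * F m n)
       + of_real l2 * (if n = 0 then 0 else of_real (p m (n - 1)) * F m n)
       + of_real (p (Suc m) n) * (of_real (d1 n) * F m n)
       + of_real (p m (Suc n)) * (of_real (d2 m) * F m n)
       = of_real (l1 * (if m = 0 then 0 else p (m - 1) n) + l2 * (if n = 0 then 0 else p m (n - 1))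
       + d1 n * p (Suc m) n + d2 m * p m (Suc n)) * F m n"
      by (simp add: algebra_simps)
    then show ?thesis unfolding b[symmetric] by simp
  qed
  have "of_real l1 * S1 + of_real l2 * S2 + S3 + S4 - S5 = 0"
  proof -
    have "((\<lambda>s::nat \<times> nat. 0::'a) has_sum (of_real l1 * S1 + of_real l2 * S2 + S3 + S4 - S5)) UNIV"
      using rhs by (rule has_sum_cong[THEN iffD1, rotated]) (auto simp only: zero split: prod.split)
    then show ?thesis using has_sum_unique has_sum_0_simp by blast
  qed
  then show ?thesis using lhs by simp
qed

text \<open>The factor by which the generator multiplies the monomial \<open>x ^ m * y ^ n\<close>.
  It depends on \<open>m\<close> and \<open>n\<close> only through whether they vanish, so it takes
  at most four values.\<close>

definition drift :: "'a \<Rightarrow> 'a \<Rightarrow> nat \<Rightarrow> nat \<Rightarrow> 'a :: real_normed_field" where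
  "drift x y m n = of_real l1 * (x - 1) + of_real l2 * (y - 1)
     + (if m = 0 then 0 else of_real (d1 n) * (1 / x - 1))
     + (if n = 0 then 0 else of_real (d2 m) * (1 / y - 1))"

lemma gen_monomial:
  fixes x y :: "'a :: {real_normed_field, banach}"
  assumes "x \<noteq> 0" "y \<noteq> 0"
  shows "gen (\<lambda>m n. x ^ m * y ^ n) m n = drift x y m n * (x ^ m * y ^ n)"
  using assms by (cases m; cases n) (auto simp: gen_def drift_def field_simps)

section \<open>A Lyapunov criterion for geometric moments\<close>

lemma gsum_1: "gsum 1 1"
  using p_summable by (simp add: gsum_def)

lemma drift_bounded:
  fixes x y :: real
  obtains C where "0 \<le> C" "\<And>m n. \<bar>drift x y m n\<bar> \<le> C"
proof (rule that)
  let ?C = "\<bar>l1 * (x - 1)\<bar> + \<bar>l2 * (y - 1)\<bar> + \<bar>k1 * (1 / x - 1)\<bar> + \<bar>m1 * (1 / x - 1)\<bar>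
     + \<bar>k2 * (1 / y - 1)\<bar> + \<bar>m2 * (1 / y - 1)\<bar>"
  show "0 \<le> ?C" by (simp add: add_nonneg_nonneg)
  show "\<bar>drift x y m n\<bar> \<le> ?C" for m n
  proof -
    have "\<bar>drift x y m n\<bar> \<le> \<bar>l1 * (x - 1)\<bar> + \<bar>l2 * (y - 1)\<bar>
        + \<bar>if m = 0 then 0 else d1 n * (1 / x - 1)\<bar> + \<bar>if n = 0 then 0 else d2 m * (1 / y - 1)\<bar>"
      unfolding drift_def of_real_eq_id id_apply by (intro order_trans[OF abs_triangle_ineq] add_mono order.refl)
    moreover have "\<bar>if m = 0 then 0 else d1 n * (1 / x - 1)\<bar> \<le> \<bar>k1 * (1 / x - 1)\<bar> + \<bar>m1 * (1 / x - 1)\<bar>"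
      by (simp add: d1_def)
    moreover have "\<bar>if n = 0 then 0 else d2 m * (1 / y - 1)\<bar> \<le> \<bar>k2 * (1 / y - 1)\<bar> + \<bar>m2 * (1 / y - 1)\<bar>"
      by (simp add: d2_def)
    ultimately show ?thesis by linarith
  qed
qed

text \<open>The monomial itself is not yet an admissible test function, since its summability is the
  claim. It is cut off at a level \<open>K\<close>, which makes it bounded and hence admissible by
  \<open>gsum_1\<close>, and the resulting estimate does not depend on \<open>K\<close>. The set
  \<open>B\<close> collects the states where the drift may fail to be negative; they are paid for by
  the summability assumed there.\<close>

lemma lyapunov:
  fixes x y \<epsilon> :: real
  assumes x: "x > 0" and y: "y > 0" and \<epsilon>: "\<epsilon> > 0"
    and neg: "\<And>m n. (m, n) \<notin> B \<Longrightarrow> drift x y m n \<le> - \<epsilon>"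
    and SB: "(\<lambda>(m, n). p m n * x ^ m * y ^ n) summable_on B"
  shows "gsum x y"
proof -
  define f where "f = (\<lambda>s. case s of (m, n) \<Rightarrow> p m n * x ^ m * y ^ n)"
  obtain C where C: "0 \<le> C" "\<And>m n. \<bar>drift x y m n\<bar> \<le> C" using drift_bounded by blast
  have f0: "0 \<le> f s" for s using x y p_nonneg by (auto simp: f_def split: prod.split)
  have fB: "(\<lambda>s. if s \<in> B then f s else 0) summable_on UNIV"
    using SB unfolding f_def[symmetric]
    by (rule summable_on_cong_neutral[THEN iffD1, rotated -1]) auto
  define T where "T = infsum (\<lambda>s. if s \<in> B then f s else 0) UNIV"
  have trunc: "\<epsilon> * infsum (\<lambda>s. if x ^ fst s * y ^ snd s \<le> K then f s else 0) UNIV \<le> (C + \<epsilon>) * T"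
    "(\<lambda>s. if x ^ fst s * y ^ snd s \<le> K then f s else 0) summable_on UNIV" if K: "0 \<le> K" for K
  proof -
    define FK where "FK = (\<lambda>m n. min (x ^ m * y ^ n) K)"
    define g where "g = (\<lambda>s. if x ^ fst s * y ^ snd s \<le> K then f s else 0)"
    have sK: "g summable_on UNIV"
    proof (rule summable_on_comparison_test)
      show "(\<lambda>s. K * (case s of (m, n) \<Rightarrow> p m n)) summable_on UNIV"
        using p_summable by (rule summable_on_cmult_right)
      fix s :: "nat \<times> nat"
      obtain m n where s: "s = (m, n)" by force
      have "x ^ m * y ^ n \<le> K \<Longrightarrow> p m n * (x ^ m * y ^ n) \<le> p m n * K"
        using p_nonneg by (intro mult_left_mono)
      then show "g s \<le> K * (case s of (m, n) \<Rightarrow> p m n)"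
        using K p_nonneg by (auto simp: g_def f_def s mult_ac)
      show "0 \<le> g s" using f0 by (simp add: g_def)
    qed
    have z: "((\<lambda>(m, n). of_real (p m n) * gen FK m n) has_sum 0) UNIV"
      by (rule test_function[OF _ _ gsum_1, where C = K]) (use x y K in \<open>auto simp: FK_def\<close>)
    \<comment> \<open>Below the level \<open>K\<close> the cutoff only lowers values at neighbours,
      so the generator can only decrease; above it the cutoff function is at its maximum and the
      generator is nonpositive.\<close>
    have pt: "of_real (p m n) * gen FK m n \<le> (C + \<epsilon>) * (if (m, n) \<in> B then f (m, n) else 0) + (- \<epsilon>) * g (m, n)" for m n
    proof (cases "x ^ m * y ^ n \<le> K")
      case True
      have "gen FK m n \<le> gen (\<lambda>m n. x ^ m * y ^ n) m n"
        using True pos k_pos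
        by (auto simp: gen_def FK_def d1_def d2_def intro!: add_mono mult_left_mono)
      also have "\<dots> = drift x y m n * (x ^ m * y ^ n)" using x y by (intro gen_monomial) auto
      finally have "p m n * gen FK m n \<le> drift x y m n * f (m, n)"
        using mult_left_mono[OF _ p_nonneg[of m n]] by (fastforce simp: f_def mult_ac)
      also have "\<dots> \<le> (C + \<epsilon>) * (if (m, n) \<in> B then f (m, n) else 0) + (- \<epsilon>) * f (m, n)"
      proof (cases "(m, n) \<in> B")
        case True
        have "drift x y m n * f (m, n) \<le> C * f (m, n)"
          using C(2)[of m n] by (intro mult_right_mono f0) auto
        then show ?thesis using True by (simp add: algebra_simps)
      next
        case False
        then show ?thesis using mult_right_mono[OF neg[OF False] f0[of "(m, n)"]] by simp
      qed
      finally show ?thesis using True by (simp add: g_def)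
    next
      case False
      have "gen FK m n \<le> 0"
        using False pos k_pos unfolding gen_def
        by (intro add_nonpos_nonpos) (auto simp: FK_def d1_def d2_def mult_le_0_iff)
      then have "p m n * gen FK m n \<le> 0" using p_nonneg by (simp add: mult_nonneg_nonpos)
      also have "0 \<le> (C + \<epsilon>) * (if (m, n) \<in> B then f (m, n) else 0) + (- \<epsilon>) * g (m, n)"
        using False C \<epsilon> f0 by (simp add: g_def)
      finally show ?thesis by simp
    qed
    have "((\<lambda>s. (C + \<epsilon>) * (if s \<in> B then f s else 0) + (- \<epsilon>) * g s) has_sum ((C + \<epsilon>) * T + (- \<epsilon>) * infsum g UNIV)) UNIV"
      unfolding T_def by (intro has_sum_add has_sum_cmult_right has_sum_infsum fB sK)
    from has_sum_mono[OF z this] have "0 \<le> (C + \<epsilon>) * T + (- \<epsilon>) * infsum g UNIV"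
      using pt by auto
    then show "\<epsilon> * infsum (\<lambda>s. if x ^ fst s * y ^ snd s \<le> K then f s else 0) UNIV \<le> (C + \<epsilon>) * T"
      by (simp add: g_def)
    show "(\<lambda>s. if x ^ fst s * y ^ snd s \<le> K then f s else 0) summable_on UNIV"
      using sK by (simp add: g_def)
  qed
  have "f summable_on UNIV"
  proof (rule nonneg_bounded_partial_sums_imp_summable_on)
    show "eventually (\<lambda>A. sum f A \<le> (C + \<epsilon>) * T / \<epsilon>) (finite_subsets_at_top UNIV)"
    proof (rule eventually_finite_subsets_at_top_weakI)
      fix A :: "(nat \<times> nat) set" assume A: "finite A"
      \<comment> \<open>With this \<open>K\<close> the cutoff is inactive on the finite set
        \<open>A\<close>.\<close>
      define K where "K = (\<Sum>s\<in>A. x ^ fst s * y ^ snd s)"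
      have K0: "0 \<le> K" unfolding K_def using x y by (intro sum_nonneg) auto
      have le: "x ^ fst s * y ^ snd s \<le> K" if "s \<in> A" for s
        unfolding K_def by (rule member_le_sum[where f = "\<lambda>s. x ^ fst s * y ^ snd s"]) (use that x y A in auto)
      have "sum f A = sum (\<lambda>s. if x ^ fst s * y ^ snd s \<le> K then f s else 0) A"
        using le by (intro sum.cong) auto
      also have "\<dots> \<le> infsum (\<lambda>s. if x ^ fst s * y ^ snd s \<le> K then f s else 0) UNIV"
        by (rule finite_sum_le_infsum[OF trunc(2)[OF K0] A]) (use f0 in auto)
      finally show "sum f A \<le> (C + \<epsilon>) * T / \<epsilon>" using trunc(1)[OF K0] \<epsilon> by (simp add: pos_le_divide_eq mult.commute order_trans[OF mult_left_mono])
    qed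
  qed (use f0 in auto)
  then show ?thesis by (simp add: gsum_def f_def)
qed

section \<open>Boundary generating functions and the functional equation\<close>

lemma gsum_row:
  assumes "gsum x y"
  shows "(\<lambda>m. p m 0 * x ^ m) summable_on UNIV"
proof -
  have "(\<lambda>(m, n). p m n * x ^ m * y ^ n) summable_on range (\<lambda>m. (m, 0))"
    using assms unfolding gsum_def by (rule summable_on_subset_banach) auto
  then show ?thesis by (subst (asm) summable_on_reindex) (auto simp: inj_on_def o_def)
qed

lemma gsum_col:
  assumes "gsum x y"
  shows "(\<lambda>n. p 0 n * y ^ n) summable_on UNIV"
proof -
  have "(\<lambda>(m, n). p m n * x ^ m * y ^ n) summable_on range (\<lambda>n. (0, n))"
    using assms unfolding gsum_def by (rule summable_on_subset_banach) auto
  then show ?thesis by (subst (asm) summable_on_reindex) (auto simp: inj_on_def o_def)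
qed

lemma shifted_powser_summable:
  fixes a :: "nat \<Rightarrow> real" and z :: complex
  assumes "(\<lambda>m. a m * x ^ m) summable_on UNIV" "x > 0" "norm z \<le> x" "\<And>m. 0 \<le> a m"
  shows "summable (\<lambda>m. of_real (a (Suc m)) * z ^ m)"
proof (rule summable_comparison_test)
  have "summable (\<lambda>m. a (Suc m) * x ^ Suc m)"
    using summable_on_imp_summable[OF assms(1)] by (subst summable_Suc_iff)
  then show "summable (\<lambda>m. a (Suc m) * x ^ m)"
    using summable_mult[of "\<lambda>m. a (Suc m) * x ^ Suc m" "1 / x"] assms(2) by (simp add: field_simps)
  have "norm (of_real (a (Suc m)) * z ^ m) \<le> a (Suc m) * x ^ m" for m
    using assms by (auto simp: norm_mult norm_power intro!: mult_left_mono power_mono)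
  then show "\<exists>N. \<forall>m\<ge>N. norm (of_real (a (Suc m)) * z ^ m) \<le> a (Suc m) * x ^ m" by blast
qed

definition P1 :: "complex \<Rightarrow> complex" where "P1 x = (\<Sum>m. of_real (p (Suc m) 0) * x ^ m)"
definition P2 :: "complex \<Rightarrow> complex" where "P2 y = (\<Sum>n. of_real (p 0 (Suc n)) * y ^ n)"

text \<open>Interior drift of a monomial. For the queue it is the kernel polynomial divided by
  \<open>alpha Q * x * y\<close>; the functions \<open>eta1\<close>, \<open>eta2\<close> and
  \<open>eta0\<close> below are the drifts on the axes and at the corner, equal to h_1 / x, h_2 / y
  and h_0.\<close>

definition ker :: "'a \<Rightarrow> 'a \<Rightarrow> 'a :: real_normed_field" where
  "ker x y = of_real l1 * (x - 1) + of_real l2 * (y - 1) + of_real m1 * (1 / x - 1) + of_real m2 * (1 / y - 1)"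

definition eta1 :: "'a \<Rightarrow> 'a \<Rightarrow> 'a :: real_normed_field" where
  "eta1 x y = of_real l1 * (x - 1) + of_real l2 * (y - 1) + of_real k1 * (1 / x - 1)"

definition eta2 :: "'a \<Rightarrow> 'a \<Rightarrow> 'a :: real_normed_field" where
  "eta2 x y = of_real l1 * (x - 1) + of_real l2 * (y - 1) + of_real k2 * (1 / y - 1)"

definition eta0 :: "'a \<Rightarrow> 'a \<Rightarrow> 'a :: real_normed_field" where
  "eta0 x y = of_real l1 * (x - 1) + of_real l2 * (y - 1)"

lemma drift_eq:
  "drift x y (Suc m) (Suc n) = ker x y" "drift x y (Suc m) 0 = eta1 x y"
  "drift x y 0 (Suc n) = eta2 x y" "drift x y 0 0 = eta0 x y"
  by (auto simp: drift_def ker_def eta1_def eta2_def eta0_def d1_def d2_def)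

definition numer :: "complex \<Rightarrow> complex \<Rightarrow> complex" where
  "numer x y = eta2 x y * y * P2 y + eta0 x y * of_real (p 0 0)"

text \<open>The pair \<open>(X, Y)\<close> lies in the polydisc of absolute convergence, so its
  monomial is an admissible test function; as the interior drift \<open>ker X Y\<close> is 0, only
  the two axes and the corner contribute.\<close>

lemma functional_equation:
  assumes xy: "x > 0" "y > 0" "gsum x y" and X: "norm X \<le> x" "X \<noteq> 0" and Y: "norm Y \<le> y" "Y \<noteq> 0"
    and k0: "ker X Y = 0"
  shows "eta1 X Y * X * P1 X + numer X Y = 0"
proof -
  define f where "f = (\<lambda>s. case s of (m, n) \<Rightarrow> of_real (p m n) * (drift X Y m n * (X ^ m * Y ^ n)))"
  have "((\<lambda>(m, n). of_real (p m n) * gen (\<lambda>m n. X ^ m * Y ^ n) m n) has_sum 0) UNIV"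
  proof (rule test_function[OF xy, where C = 1])
    show "norm (X ^ m * Y ^ n) \<le> 1 * x ^ m * y ^ n" for m n
      using X Y xy by (auto simp: norm_mult norm_power intro!: mult_mono power_mono)
  qed
  then have f: "(f has_sum 0) UNIV" using X Y by (simp add: gen_monomial f_def)
  let ?A0 = "{(0::nat, 0::nat)}" and ?A1 = "range (\<lambda>m. (Suc m, 0::nat))" and ?A2 = "range (\<lambda>n. (0::nat, Suc n))"
  have z: "f s = 0" if sA: "s \<notin> ?A0 \<union> ?A1 \<union> ?A2" for s
  proof -
    obtain m n where s: "s = (m, n)" by force
    obtain i j where "m = Suc i" "n = Suc j" using sA unfolding s by (cases m; cases n) auto
    then show ?thesis by (simp add: f_def s drift_eq k0)
  qed
  have f': "(f has_sum 0) (?A0 \<union> (?A1 \<union> ?A2))"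
    using f by (rule has_sum_cong_neutral[THEN iffD1, rotated -1]) (use z in auto)
  have fs: "f summable_on UNIV" using f by (auto simp: summable_on_def)
  obtain S1 where S1: "(f has_sum S1) ?A1" using summable_on_subset_banach[OF fs] by (auto simp: summable_on_def)
  obtain S2 where S2: "(f has_sum S2) ?A2" using summable_on_subset_banach[OF fs] by (auto simp: summable_on_def)
  have S0: "(f has_sum f (0, 0)) ?A0" by (intro has_sum_finiteI) auto
  have "(f has_sum (f (0, 0) + (S1 + S2))) (?A0 \<union> (?A1 \<union> ?A2))"
    by (intro has_sum_Un_disjoint S0 S1 S2) auto
  then have tot: "f (0, 0) + (S1 + S2) = 0" using f' has_sum_unique by blast
  have s1: "S1 = eta1 X Y * X * P1 X"
  proof -
    have "((\<lambda>m. eta1 X Y * X * (of_real (p (Suc m) 0) * X ^ m)) has_sum S1) UNIV"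
      using S1 by (subst (asm) has_sum_reindex) (auto simp: inj_on_def o_def f_def drift_eq mult_ac)
    then have "(\<lambda>m. eta1 X Y * X * (of_real (p (Suc m) 0) * X ^ m)) sums S1" by (rule has_sum_imp_sums)
    moreover have "(\<lambda>m. eta1 X Y * X * (of_real (p (Suc m) 0) * X ^ m)) sums (eta1 X Y * X * P1 X)"
      unfolding P1_def
      by (intro sums_mult summable_sums shifted_powser_summable[OF gsum_row[OF xy(3)]]) (use xy X p_nonneg in auto)
    ultimately show ?thesis by (rule sums_unique2)
  qed
  have s2: "S2 = eta2 X Y * Y * P2 Y"
  proof -
    have "((\<lambda>n. eta2 X Y * Y * (of_real (p 0 (Suc n)) * Y ^ n)) has_sum S2) UNIV"
      using S2 by (subst (asm) has_sum_reindex) (auto simp: inj_on_def o_def f_def drift_eq mult_ac)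
    then have "(\<lambda>n. eta2 X Y * Y * (of_real (p 0 (Suc n)) * Y ^ n)) sums S2" by (rule has_sum_imp_sums)
    moreover have "(\<lambda>n. eta2 X Y * Y * (of_real (p 0 (Suc n)) * Y ^ n)) sums (eta2 X Y * Y * P2 Y)"
      unfolding P2_def
      by (intro sums_mult summable_sums shifted_powser_summable[OF gsum_col[OF xy(3)]]) (use xy Y p_nonneg in auto)
    ultimately show ?thesis by (rule sums_unique2)
  qed
  show ?thesis using tot unfolding s1 s2 numer_def
    by (simp add: f_def drift_eq algebra_simps)
qed

section \<open>Geometry of the kernel\<close>

text \<open>The sum of the two kernel roots times \<open>l2\<close>: the kernel equation reads l2
  y^2 - w(x) y + m2 = 0. For the queue, w(x) = -b^(x) / (alpha x).\<close>

definition w :: "'a \<Rightarrow> 'a :: real_normed_field" where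
  "w x = of_real (l1 + l2 + m1 + m2) - of_real l1 * x - of_real m1 / x"

text \<open>The discriminant of the kernel in \<open>y\<close> is the product of
  \<open>w x - 2 * sg\<close> and \<open>w x + 2 * sg\<close>. The zeros \<open>xl\<close> and
  \<open>xr\<close> of the first factor are the branch points x_2 and x_3, and \<open>Yt\<close> is
  the double root at \<open>xr\<close>.\<close>

definition sg :: real where "sg = sqrt (l2 * m2)"
definition Yt :: real where "Yt = sqrt (m2 / l2)"
definition xS :: real where "xS = l1 + m1 + (l2 + m2 - 2 * sg)"
definition xl :: real where "xl = (xS - sqrt (xS\<^sup>2 - 4 * l1 * m1)) / (2 * l1)"
definition xr :: real where "xr = (xS + sqrt (xS\<^sup>2 - 4 * l1 * m1)) / (2 * l1)"

lemma sg_Yt: "sg > 0" "Yt > 0" "Yt\<^sup>2 = m2 / l2" "sg = l2 * Yt" "sg\<^sup>2 = l2 * m2"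
proof -
  show "sg > 0" "Yt > 0" "Yt\<^sup>2 = m2 / l2" "sg\<^sup>2 = l2 * m2"
    using pos by (auto simp: sg_def Yt_def)
  have "(l2 * Yt)\<^sup>2 = l2\<^sup>2 * (m2 / l2)" unfolding power_mult_distrib Yt_def using pos by simp
  then have "(l2 * Yt)\<^sup>2 = l2 * m2" using pos by (simp add: power2_eq_square)
  then show "sg = l2 * Yt" unfolding sg_def by (rule real_sqrt_unique) (use pos in \<open>simp add: Yt_def\<close>)
qed

lemma xS_ge: "xS \<ge> l1 + m1"
proof -
  have "l2 + m2 - 2 * sg = (sqrt l2 - sqrt m2)\<^sup>2"
    using pos by (simp add: power2_diff sg_def real_sqrt_mult)
  then show ?thesis by (simp add: xS_def)
qed

text \<open>The bound \<open>xS_ge\<close> is an equality when \<open>l2 = m2\<close>, so strictness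
  comes from \<open>l1 < m1\<close>.\<close>

lemma xdisc_pos: "xS\<^sup>2 - 4 * l1 * m1 > 0"
proof -
  have "(l1 + m1)\<^sup>2 \<le> xS\<^sup>2" using xS_ge pos by (intro power_mono) auto
  moreover have "(l1 + m1)\<^sup>2 - 4 * l1 * m1 = (m1 - l1)\<^sup>2" by (simp add: power2_eq_square algebra_simps)
  moreover have "(m1 - l1)\<^sup>2 > 0" using l1_less_m1 by simp
  ultimately show ?thesis by linarith
qed

lemma xlr_sum_prod: "xl + xr = xS / l1" "xl * xr = m1 / l1"
proof -
  show "xl + xr = xS / l1" using pos by (simp add: xl_def xr_def field_simps)
  have "(xS - sqrt (xS\<^sup>2 - 4 * l1 * m1)) * (xS + sqrt (xS\<^sup>2 - 4 * l1 * m1)) = xS\<^sup>2 - (sqrt (xS\<^sup>2 - 4 * l1 * m1))\<^sup>2"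
    by (simp add: power2_eq_square algebra_simps)
  also have "\<dots> = 4 * l1 * m1" using xdisc_pos by simp
  finally show "xl * xr = m1 / l1" using pos by (simp add: xl_def xr_def field_simps)
qed

lemma w_minus_sg:
  fixes x :: "'a :: real_normed_field"
  assumes "x \<noteq> 0"
  shows "w x - of_real (2 * sg) = of_real l1 * (of_real xr - x) * (x - of_real xl) / x"
proof -
  have "of_real l1 * (of_real xr - x) * (x - of_real xl)
     = of_real (l1 * (xl + xr)) * x - of_real l1 * x\<^sup>2 - of_real (l1 * (xl * xr))"
    by (simp add: algebra_simps power2_eq_square)
  also have "\<dots> = of_real xS * x - of_real l1 * x\<^sup>2 - of_real m1"
    using pos by (simp add: xlr_sum_prod)
  also have "of_real xS = (of_real (l1 + m1 + l2 + m2 - 2 * sg) :: 'a)"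
    by (simp add: xS_def)
  finally have "of_real l1 * (of_real xr - x) * (x - of_real xl) = of_real (l1 + m1 + l2 + m2 - 2 * sg) * x - of_real l1 * x\<^sup>2 - of_real m1" .
  then show ?thesis unfolding w_def using assms by (simp add: field_simps power2_eq_square)
qed

lemma xl_xr: "0 < xl" "xl \<le> 1" "1 < xr" "xl < xr"
proof -
  show lr: "xl < xr" using xdisc_pos pos by (simp add: xl_def xr_def divide_strict_right_mono)
  have p1: "xl * xr > 1" using pos l1_less_m1 by (simp add: xlr_sum_prod)
  have "xl + xr > 0" using xlr_sum_prod xS_ge pos by simp
  then have "xr > 0" using lr by linarith
  then show l0: "xl > 0" using p1 by (smt (verit) mult_le_0_iff)
  show r1: "1 < xr"
  proof (rule ccontr)
    assume "\<not> 1 < xr"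
    then have "xl * xr \<le> 1" using l0 lr by (intro mult_le_one) auto
    then show False using p1 by simp
  qed
  \<comment> \<open>The right-hand side is the square of sqrt(l2) - sqrt(m2); hence
    \<open>xl = 1\<close> exactly when \<open>l2 = m2\<close>.\<close>
  have "l1 * (xr - 1) * (1 - xl) = xS - l1 - m1"
  proof -
    have "l1 * (xr - 1) * (1 - xl) = l1 * (xl + xr) - l1 - l1 * (xl * xr)" by (simp add: algebra_simps)
    then show ?thesis using pos by (simp add: xlr_sum_prod)
  qed
  then have "l1 * (xr - 1) * (1 - xl) \<ge> 0" using xS_ge by simp
  moreover have "l1 * (xr - 1) > 0" using r1 pos by simp
  ultimately show "xl \<le> 1" by (simp add: zero_le_mult_iff)
qed

lemma ker_w:
  fixes x y :: "'a :: real_normed_field"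
  assumes "y \<noteq> 0"
  shows "ker x y = (of_real l2 * y\<^sup>2 - w x * y + of_real m2) / y"
  using assms by (simp add: ker_def w_def field_simps power2_eq_square)

definition y0 :: "real \<Rightarrow> real" where "y0 x = (w x - sqrt ((w x)\<^sup>2 - 4 * l2 * m2)) / (2 * l2)"
definition y1 :: "real \<Rightarrow> real" where "y1 x = (w x + sqrt ((w x)\<^sup>2 - 4 * l2 * m2)) / (2 * l2)"

lemma w_ge:
  assumes "xl \<le> x" "x \<le> xr"
  shows "w x \<ge> 2 * sg"
proof -
  have "x > 0" using assms xl_xr by linarith
  then have "w x - 2 * sg = l1 * (xr - x) * (x - xl) / x" using w_minus_sg[of x] by simp
  moreover have "\<dots> \<ge> 0" using assms pos \<open>x > 0\<close> by simp
  ultimately show ?thesis by linarith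
qed

lemma w_gt:
  assumes "xl < x" "x < xr"
  shows "w x > 2 * sg"
proof -
  have "x > 0" using assms xl_xr by linarith
  then have "w x - 2 * sg = l1 * (xr - x) * (x - xl) / x" using w_minus_sg[of x] by simp
  moreover have "\<dots> > 0" using assms pos \<open>x > 0\<close> by simp
  ultimately show ?thesis by linarith
qed

lemma w_xr: "w xr = 2 * sg"
  using w_minus_sg[of xr] xl_xr by simp

lemma w_disc: "w x \<ge> 2 * sg \<Longrightarrow> (w x)\<^sup>2 - 4 * l2 * m2 \<ge> (0::real)"
  using power_mono[of "2 * sg" "w x" 2] sg_Yt by (simp add: power_mult_distrib)

lemma y01_sum_prod:
  assumes "w x \<ge> 2 * sg"
  shows "y0 x + y1 x = w x / l2" "y0 x * y1 x = m2 / l2" "y0 x > 0" "y0 x \<le> Yt" "Yt \<le> y1 x"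
proof -
  show s: "y0 x + y1 x = w x / l2" using pos by (simp add: y0_def y1_def field_simps)
  define D where "D = (w x)\<^sup>2 - 4 * l2 * m2"
  have D: "D \<ge> 0" using w_disc[OF assms] by (simp add: D_def)
  have "(w x - sqrt D) * (w x + sqrt D) = (w x)\<^sup>2 - (sqrt D)\<^sup>2" by (simp add: power2_eq_square algebra_simps)
  also have "\<dots> = 4 * l2 * m2" using D by (simp add: D_def)
  finally show pr: "y0 x * y1 x = m2 / l2" using pos by (simp add: y0_def y1_def D_def field_simps)
  have "y1 x > 0" using assms sg_Yt(1) D pos unfolding y1_def D_def[symmetric]
    by (intro divide_pos_pos add_pos_nonneg) auto
  moreover have "y0 x * y1 x > 0" using pr pos by simp
  ultimately show y0: "y0 x > 0" by (simp add: zero_less_mult_iff)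
  have le: "y0 x \<le> y1 x" using D pos by (simp add: y0_def y1_def D_def divide_right_mono)
  have Y2: "y0 x * y1 x = Yt\<^sup>2" using pr sg_Yt by simp
  show "y0 x \<le> Yt"
  proof (rule ccontr)
    assume "\<not> y0 x \<le> Yt"
    then have "Yt * Yt < y0 x * y1 x" using le sg_Yt by (intro mult_strict_mono) auto
    then show False using Y2 by (simp add: power2_eq_square)
  qed
  show "Yt \<le> y1 x"
  proof (rule ccontr)
    assume "\<not> Yt \<le> y1 x"
    then have "y0 x * y1 x < Yt * Yt" using le y0 by (intro mult_strict_mono) auto
    then show False using Y2 by (simp add: power2_eq_square)
  qed
qed

lemma y0_less_Yt:
  assumes "w x > 2 * sg"
  shows "y0 x < Yt"
proof -
  have "y0 x \<noteq> Yt"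
  proof
    assume "y0 x = Yt"
    then have "Yt * y1 x = Yt * Yt" using y01_sum_prod(2)[of x] assms sg_Yt by (simp add: power2_eq_square)
    then have "y1 x = Yt" using sg_Yt by simp
    then have "2 * Yt = w x / l2" using y01_sum_prod(1)[of x] assms \<open>y0 x = Yt\<close> by simp
    then show False using assms sg_Yt pos by (simp add: field_simps)
  qed
  then show ?thesis using y01_sum_prod(4)[of x] assms by simp
qed

lemma y0_xr: "y0 xr = Yt" "y1 xr = Yt"
  using w_xr sg_Yt pos by (auto simp: y0_def y1_def power_mult_distrib)

lemma ker_factor:
  assumes "w x \<ge> 2 * sg" "y > 0"
  shows "ker x y = l2 * (y - y0 x) * (y - y1 x) / y"
proof -
  have "l2 * (y - y0 x) * (y - y1 x) = l2 * y\<^sup>2 - l2 * (y0 x + y1 x) * y + l2 * (y0 x * y1 x)"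
    by (simp add: algebra_simps power2_eq_square)
  also have "\<dots> = l2 * y\<^sup>2 - w x * y + m2" using pos by (simp only: y01_sum_prod[OF assms(1)]) simp
  finally show ?thesis using ker_w[of y x] assms by simp
qed

lemma ker_y0: "w x \<ge> 2 * sg \<Longrightarrow> ker x (y0 x) = 0"
  using ker_factor[of x "y0 x"] y01_sum_prod(3)[of x] by simp

text \<open>Since \<open>k1 = m1 + r1 * m2\<close>, the two drifts differ by an affine expression in
  1/x and 1/y. Sign and zeros of \<open>eta1\<close> on the kernel curve are thereby read off from
  the position of the point relative to a hyperbola.\<close>

lemma eta1_ker:
  fixes x y :: "'a :: real_normed_field"
  shows "eta1 x y = ker x y + of_real m2 * ((1 - 1 / y) - of_real r1 * (1 - 1 / x))"
  by (simp add: eta1_def ker_def k1_def algebra_simps)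

lemma eta2_ker:
  fixes x y :: "'a :: real_normed_field"
  shows "eta2 x y = ker x y + of_real m1 * ((1 - 1 / x) - of_real r2 * (1 - 1 / y))"
  by (simp add: eta2_def ker_def k2_def algebra_simps)

text \<open>\<open>yc\<close> parametrises the curve \<open>1 - 1 / y = r1 * (1 - 1 / x)\<close>, on which \<open>eta1\<close> and \<open>ker\<close> agree;
  it meets the kernel curve where \<open>gq\<close> vanishes.\<close>

definition yc :: "'a \<Rightarrow> 'a :: real_normed_field" where
  "yc x = x / (of_real (1 - r1) * x + of_real r1)"

definition gq :: "'a \<Rightarrow> 'a :: real_normed_field" where
  "gq x = of_real (l1 * (1 - r1)) * x\<^sup>2 + of_real (r1 * (l1 + l2) - (1 - r1) * k1) * x - of_real (r1 * k1)"

text \<open>The factor \<open>x - 1\<close> belongs to the trivial common point (1, 1) of the two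
  curves; the quadratic \<open>gq\<close> carries the other intersections.\<close>

lemma ker_yc:
  fixes x :: "'a :: real_normed_field"
  assumes "x \<noteq> 0" "of_real (1 - r1) * x + of_real r1 \<noteq> 0"
  shows "ker x (yc x) = (x - 1) * gq x / (x * (of_real (1 - r1) * x + of_real r1))"
proof -
  define q where "q = of_real (1 - r1) * x + of_real r1"
  have q: "q \<noteq> 0" using assms by (simp add: q_def)
  have 1: "1 / yc x = q / x" using assms by (simp add: yc_def q_def)
  have 2: "ker x (yc x) = eta1 x (yc x)"
    unfolding eta1_ker 1 using assms by (simp add: q_def field_simps)
  have 3: "yc x - 1 = of_real r1 * (x - 1) / q"
    using q by (simp add: yc_def q_def field_simps)
  have "eta1 x (yc x) = of_real l1 * (x - 1) + of_real l2 * (of_real r1 * (x - 1) / q) + of_real k1 * (1 / x - 1)"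
    by (simp only: eta1_def 3)
  also have "\<dots> * (x * q) = (x - 1) * (of_real l1 * x * q + of_real l2 * of_real r1 * x - of_real k1 * q)"
    using q assms(1) by (simp add: field_simps)
  also have "of_real l1 * x * q + of_real l2 * of_real r1 * x - of_real k1 * q = gq x"
    by (simp add: gq_def q_def algebra_simps power2_eq_square)
  finally have fin: "eta1 x (yc x) * (x * q) = (x - 1) * gq x" .
  have "x * q \<noteq> 0" using q assms(1) by simp
  from iffD2[OF nonzero_eq_divide_eq[OF this] fin] show ?thesis unfolding 2 q_def .
qed

text \<open>The discriminant of \<open>gq\<close>, with zeros \<open>xp\<close> and
  \<open>xm\<close>. For the queue \<open>gq\<close> is \<open>g_poly\<close> divided by the square
  of \<open>lam Q + mu1 Q\<close>, so these zeros are x_+ and x_-.\<close>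

definition gdisc :: real where
  "gdisc = (r1 * (l1 + l2) - (1 - r1) * k1)\<^sup>2 + 4 * (l1 * (1 - r1)) * (r1 * k1)"
definition xp :: real where "xp = (- (r1 * (l1 + l2) - (1 - r1) * k1) + sqrt gdisc) / (2 * (l1 * (1 - r1)))"
definition xm :: real where "xm = (- (r1 * (l1 + l2) - (1 - r1) * k1) - sqrt gdisc) / (2 * (l1 * (1 - r1)))"

lemma gdisc_pos: "gdisc > 0"
  using pos k_pos by (simp add: gdisc_def add_nonneg_pos)

lemma xpm_sum_prod:
  "l1 * (1 - r1) * (xp + xm) = - (r1 * (l1 + l2) - (1 - r1) * k1)"
  "l1 * (1 - r1) * (xp * xm) = - (r1 * k1)"
proof -
  define A where "A = l1 * (1 - r1)"
  define Bq where "Bq = r1 * (l1 + l2) - (1 - r1) * k1"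
  have A: "A > 0" using pos by (simp add: A_def)
  show "l1 * (1 - r1) * (xp + xm) = - (r1 * (l1 + l2) - (1 - r1) * k1)"
    unfolding xp_def xm_def A_def[symmetric] Bq_def[symmetric] using A by (simp add: field_simps)
  have "(- Bq + sqrt gdisc) * (- Bq - sqrt gdisc) = Bq\<^sup>2 - (sqrt gdisc)\<^sup>2"
    by (simp add: power2_eq_square algebra_simps)
  also have "\<dots> = - 4 * A * (r1 * k1)" using gdisc_pos by (simp add: gdisc_def A_def Bq_def)
  finally have "(- Bq + sqrt gdisc) * (- Bq - sqrt gdisc) = - 4 * A * (r1 * k1)" .
  then show "l1 * (1 - r1) * (xp * xm) = - (r1 * k1)"
    unfolding xp_def xm_def A_def[symmetric] Bq_def[symmetric] using A
    by (simp add: divide_simps)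
qed

lemma gq_factor:
  fixes x :: "'a :: real_normed_field"
  shows "gq x = of_real (l1 * (1 - r1)) * (x - of_real xp) * (x - of_real xm)"
proof -
  have "of_real (l1 * (1 - r1)) * (x - of_real xp) * (x - of_real xm)
     = of_real (l1 * (1 - r1)) * x\<^sup>2 - of_real (l1 * (1 - r1) * (xp + xm)) * x + of_real (l1 * (1 - r1) * (xp * xm))"
    by (simp add: algebra_simps power2_eq_square)
  then show ?thesis by (simp only: xpm_sum_prod gq_def) (simp add: algebra_simps)
qed

lemma xm_less_xp: "xm < xp"
  using gdisc_pos pos by (simp add: xm_def xp_def divide_strict_right_mono)

lemma gq_neg_imp:
  assumes "gq x < (0::real)"
  shows "xm < x" "x < xp"
proof -
  have "l1 * (1 - r1) * ((x - xp) * (x - xm)) < 0"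
    using assms by (simp add: gq_factor mult.assoc)
  moreover have "l1 * (1 - r1) > 0" using pos by simp
  ultimately have "(x - xp) * (x - xm) < 0"
    by (meson mult_nonneg_nonneg not_less order_less_imp_le)
  then show "xm < x" "x < xp" using xm_less_xp by (auto simp: mult_less_0_iff)
qed

text \<open>\<open>gq 1\<close> equals \<open>l1 + r1 * l2 - k1\<close>, which is negative by
  \<open>stable\<close>.\<close>

lemma xp_gt_1: "1 < xp"
proof -
  have "gq (1::real) < 0" using stable by (simp add: gq_def k1_def algebra_simps)
  then show ?thesis using gq_neg_imp by blast
qed

text \<open>The point \<open>- r1 / (1 - r1)\<close> is the pole of \<open>yc\<close>. Lying to the
  left of it, \<open>xm\<close> is mapped by \<open>yc\<close> to a value above 1, which later rules
  it out as a zero of \<open>eta1\<close>.\<close>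

lemma xm_less: "xm < - r1 / (1 - r1)" "xm < 0"
proof -
  have "gq (- r1 / (1 - r1)) = - (l2 * r1\<^sup>2 / (1 - r1))"
  proof -
    define q where "q = 1 - r1"
    have q: "q > 0" "r1 = 1 - q" using pos by (auto simp: q_def)
    have "gq (- r1 / q) = l1 * q * (r1 / q)\<^sup>2 - (r1 * (l1 + l2) - q * k1) * (r1 / q) - r1 * k1"
      by (simp add: gq_def q_def)
    also have "\<dots> = - (l2 * r1\<^sup>2 / q)"
      using q(1) by (simp add: field_simps power2_eq_square)
    finally show ?thesis by (simp add: q_def)
  qed
  also have "\<dots> < 0" using pos by simp
  finally show 1: "xm < - r1 / (1 - r1)" using gq_neg_imp by blast
  have "- r1 / (1 - r1) < 0" using pos by simp
  then show "xm < 0" using 1 by linarith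
qed

lemma yc_pos: "x > 0 \<Longrightarrow> yc x > (0::real)"
  using pos by (simp add: yc_def divide_pos_pos add_pos_pos)

lemma yc_gt_1: "x > 1 \<Longrightarrow> yc x > (1::real)"
proof -
  assume x: "x > 1"
  have "(1 - r1) * x + r1 > 0" using pos x by (simp add: add_pos_pos)
  moreover have "r1 * (x - 1) > 0" using pos x by simp
  ultimately show ?thesis by (simp add: yc_def) (simp add: algebra_simps)
qed

lemma yc_mono: "0 < x \<Longrightarrow> x \<le> x' \<Longrightarrow> yc x \<le> (yc x' :: real)"
proof -
  assume x: "0 < x" "x \<le> x'"
  have p: "(1 - r1) * x + r1 > 0" "(1 - r1) * x' + r1 > 0" using pos x by (auto intro!: add_pos_pos)
  have "r1 * x \<le> r1 * x'" using pos x by simp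
  then show ?thesis using p by (simp add: yc_def divide_le_eq le_divide_eq) (simp add: algebra_simps)
qed

definition yp :: real where "yp = yc xp"

lemma ker_yc_real:
  assumes "x > 0"
  shows "ker x (yc x) = (x - 1) * gq x / (x * ((1 - r1) * x + r1))" "x * ((1 - r1) * x + r1) > 0"
proof -
  show "x * ((1 - r1) * x + r1) > 0" using pos assms by (simp add: add_pos_pos)
  then show "ker x (yc x) = (x - 1) * gq x / (x * ((1 - r1) * x + r1))"
  proof -
    have "x \<noteq> 0" "(1 - r1) * x + r1 \<noteq> 0" using \<open>x * ((1 - r1) * x + r1) > 0\<close> by auto
    then show ?thesis using ker_yc[of x] by simp
  qed
qed

lemma ker_xp_yp: "ker xp yp = 0"
  using ker_yc_real[of xp] xp_gt_1 by (simp add: yp_def gq_factor)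

lemma yp_gt_1: "yp > 1"
  using yc_gt_1[OF xp_gt_1] by (simp add: yp_def)

lemma gq_neg: "1 < x \<Longrightarrow> x < xp \<Longrightarrow> gq x < (0::real)"
  using xm_less(2) pos by (simp add: gq_factor mult_neg_pos mult_pos_neg mult_less_0_iff)

lemma ker_yc_neg: "1 < x \<Longrightarrow> x < xp \<Longrightarrow> ker x (yc x) < 0"
  using ker_yc_real[of x] gq_neg[of x] by (simp add: divide_neg_pos mult_pos_neg)

text \<open>At \<open>xr\<close> the kernel has a double root in \<open>y\<close> and is nonnegative
  for \<open>y > 0\<close>, whereas \<open>ker_yc_neg\<close> would make it negative on the curve if
  \<open>xr\<close> were below \<open>xp\<close>.\<close>

lemma xp_le_xr: "xp \<le> xr"
proof (rule ccontr)
  assume "\<not> xp \<le> xr"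
  then have "ker xr (yc xr) < 0" using xl_xr by (intro ker_yc_neg) auto
  moreover have "ker xr (yc xr) \<ge> 0"
    using ker_factor[of xr "yc xr"] w_xr yc_pos[of xr] xl_xr pos
    by (simp add: y0_xr mult.assoc)
  ultimately show False by simp
qed

text \<open>The point \<open>(xp, yp)\<close> lies on the kernel curve. At \<open>xr\<close> the
  only root is \<open>Yt\<close>; conversely the root \<open>Yt\<close> forces
  \<open>w xp = 2 * sg\<close>, which beyond 1 happens only at \<open>xr\<close>.\<close>

lemma yp_Yt_iff: "yp = Yt \<longleftrightarrow> xp = xr"
proof
  assume "xp = xr"
  then have "l2 * (yp - Yt) * (yp - Yt) / yp = 0"
    using ker_factor[of xr yp] ker_xp_yp w_xr yp_gt_1 by (simp add: y0_xr)
  then show "yp = Yt" using pos yp_gt_1 by simp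
next
  assume *: "yp = Yt"
  have "l2 * Yt\<^sup>2 - w xp * Yt + m2 = 0" using ker_w[of Yt xp] ker_xp_yp sg_Yt(2) by (simp add: *)
  moreover have "l2 * Yt\<^sup>2 = sg * Yt" by (simp add: sg_Yt(4) power2_eq_square)
  moreover have "l2 * Yt\<^sup>2 = m2" unfolding sg_Yt(3) using pos by simp
  ultimately have "(2 * sg - w xp) * Yt = 0" unfolding left_diff_distrib by linarith
  then have "w xp = 2 * sg" using sg_Yt(2) by simp
  then have "l1 * (xr - xp) * (xp - xl) / xp = 0" using w_minus_sg[of xp] xp_gt_1 by simp
  then show "xp = xr" using pos xl_xr xp_gt_1 by simp
qed

text \<open>The modulus of the singularity. If \<open>yp < Yt\<close>, the point
  \<open>(xp, yp)\<close> lies on the lower branch and \<open>xp\<close> is a pole; if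
  \<open>yp > Yt\<close>, it lies on the upper branch, not seen by \<open>y0\<close>, and the branch
  point is met first. If \<open>yp = Yt\<close>, both candidates coincide.\<close>

definition R :: real where "R = (if yp < Yt then xp else xr)"

lemma R_bounds: "1 < R" "R \<le> xr"
  using xp_gt_1 xl_xr xp_le_xr by (auto simp: R_def)

text \<open>Before \<open>xp\<close> the kernel is negative at \<open>yc x\<close>, so
  \<open>yc x\<close> lies strictly between the roots; from \<open>xp\<close> on, monotonicity gives
  yc x \<ge> yp > Yt \<ge> y0 x.\<close>

lemma y0_less_yc:
  assumes x: "1 < x" "x \<le> xr" and "x < xp \<or> Yt < yp"
  shows "y0 x < yc x"
proof (cases "x < xp")
  case True
  have wx: "w x \<ge> 2 * sg" using x xl_xr by (intro w_ge) auto
  have yc: "yc x > 0" using yc_pos x by simp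
  have "l2 * (yc x - y0 x) * (yc x - y1 x) / yc x < 0"
    using ker_yc_neg[OF x(1) True] ker_factor[OF wx yc] by simp
  then have "l2 * ((yc x - y0 x) * (yc x - y1 x)) < 0" using yc by (simp add: divide_less_0_iff mult.assoc)
  then have "(yc x - y0 x) * (yc x - y1 x) < 0" using pos by (simp add: mult_less_0_iff)
  then show ?thesis using y01_sum_prod(4,5)[OF wx] by (auto simp: mult_less_0_iff)
next
  case False
  then have "Yt < yp" "yp \<le> yc x" using assms yc_mono[of xp x] xp_gt_1 by (auto simp: yp_def)
  moreover have "y0 x \<le> Yt" using x xl_xr by (intro y01_sum_prod(4) w_ge) auto
  ultimately show ?thesis by linarith
qed

lemma y0_less_yc_R: "1 < x \<Longrightarrow> x < R \<Longrightarrow> y0 x < yc x"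
proof -
  assume x: "1 < x" "x < R"
  show ?thesis
  proof (rule y0_less_yc)
    show "x \<le> xr" using x R_bounds by simp
    show "x < xp \<or> Yt < yp" using x yp_Yt_iff by (auto simp: R_def split: if_splits)
  qed fact
qed

lemma eta1_yc: "x > 0 \<Longrightarrow> eta1 x y = ker x y + m2 * (1 / yc x - 1 / y)"
  for x y :: real
  using pos by (simp add: eta1_ker yc_def field_simps)

section \<open>Convergence of the double series up to \<open>R\<close>\<close>

lemma summable_on_col:
  assumes "gsum x' y"
  shows "(\<lambda>(m, n). p m n * x ^ m * y ^ n) summable_on {s. fst s = 0}"
proof -
  have "{s. fst s = 0} = range (\<lambda>n. (0::nat, n::nat))" by (auto simp: image_iff)
  then show ?thesis using gsum_col[OF assms]
    by (simp add: summable_on_reindex inj_on_def o_def)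
qed

lemma summable_on_row:
  assumes "gsum x y'"
  shows "(\<lambda>(m, n). p m n * x ^ m * y ^ n) summable_on {s. snd s = 0}"
proof -
  have "{s. snd s = 0} = range (\<lambda>m. (m::nat, 0::nat))" by (auto simp: image_iff)
  then show ?thesis using gsum_row[OF assms]
    by (simp add: summable_on_reindex inj_on_def o_def)
qed

text \<open>Analyticity of \<open>P2\<close> at the double root \<open>Yt\<close> needs a geometric
  moment strictly beyond \<open>Yt\<close>. For \<open>m2 < l2\<close> total mass suffices, as
  \<open>Yt < 1\<close>; for \<open>m2 > l2\<close> a monomial in \<open>y\<close> has negative
  drift up to m2 / l2, the square of \<open>Yt\<close>. In the critical case \<open>m2 = l2\<close>
  the vertical drift in the interior is positive of second order in \<open>y - 1\<close>. It is
  compensated by a horizontal tilt of the same order; on the column \<open>m = 0\<close>, where that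
  tilt does harm, the excess rate \<open>k2 - m2\<close> yields a gain of first order.\<close>

lemma col_radius: obtains \<rho> where "\<rho> > Yt" "gsum 1 \<rho>"
proof -
  consider "m2 < l2" | "m2 > l2" | "m2 = l2" by linarith
  then show thesis
  proof cases
    case 1
    then have "Yt < 1" using pos by (simp add: Yt_def)
    then show thesis using that gsum_1 by blast
  next
    case 2
    define q where "q = m2 / l2"
    have q: "q > 1" "Yt = sqrt q" using 2 pos by (auto simp: q_def Yt_def)
    have Yt1: "Yt > 1" using q by simp
    have Ytq: "Yt < q"
    proof -
      have "Yt * 1 < Yt * Yt" using Yt1 by (intro mult_strict_left_mono) auto
      then show ?thesis using sg_Yt(3) by (simp add: q_def power2_eq_square)
    qed
    define y where "y = (Yt + q) / 2"
    have y: "Yt < y" "y < q" "y > 1" using Ytq Yt1 by (auto simp: y_def)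
    have ly: "l2 * y < m2" using y(2) pos by (simp add: q_def field_simps)
    have "gsum 1 y"
    proof (rule lyapunov[where B = "{s. snd s = 0}"])
      show "(y - 1) * (m2 - l2 * y) / y > 0" using y ly by simp
      fix m n :: nat assume "(m, n) \<notin> {s. snd s = 0}"
      then obtain j where n: "n = Suc j" by (cases n) auto
      have d2: "d2 m \<ge> m2" using k_pos by (simp add: d2_def)
      have "drift 1 y m n = (y - 1) * (l2 - d2 m / y)"
        using y by (simp add: drift_def n field_simps)
      also have "\<dots> \<le> (y - 1) * (l2 - m2 / y)"
        using y d2 by (intro mult_left_mono) (auto simp: divide_right_mono)
      also have "\<dots> = - ((y - 1) * (m2 - l2 * y) / y)" using y by (simp add: field_simps)
      finally show "drift 1 y m n \<le> - ((y - 1) * (m2 - l2 * y) / y)" .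
    qed (use y summable_on_row[OF gsum_1] in auto)
    then show thesis using that y by blast
  next
    case 3
    have "m2 / l2 = 1" using 3 pos(2) by simp
    then have Yt1: "Yt = 1" unfolding Yt_def by simp
    \<comment> \<open>The midpoint of 1 and \<open>m1 / l1\<close>. Finiteness of the moment at
      \<open>x0\<close> controls the bottom row in the second application of
      \<open>lyapunov\<close>.\<close>
    define x0 where "x0 = (l1 + m1) / (2 * l1)"
    have x0: "x0 > 1" "l1 * x0 < m1" using l1_less_m1 pos by (auto simp: x0_def field_simps)
    have g0: "gsum x0 1"
    proof (rule lyapunov[where B = "{s. fst s = 0}"])
      show "(x0 - 1) * (m1 - l1 * x0) / x0 > 0" using x0 by simp
      fix m n :: nat assume "(m, n) \<notin> {s. fst s = 0}"
      then obtain j where m: "m = Suc j" by (cases m) auto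
      have d1: "d1 n \<ge> m1" using k_pos by (simp add: d1_def)
      have "drift x0 1 m n = (x0 - 1) * (l1 - d1 n / x0)"
        using x0 by (simp add: drift_def m field_simps)
      also have "\<dots> \<le> (x0 - 1) * (l1 - m1 / x0)"
        using x0 d1 by (intro mult_left_mono) (auto simp: divide_right_mono)
      also have "\<dots> = - ((x0 - 1) * (m1 - l1 * x0) / x0)" using x0 by (simp add: field_simps)
      finally show "drift x0 1 m n \<le> - ((x0 - 1) * (m1 - l1 * x0) / x0)" .
    qed (use x0 summable_on_col[OF gsum_1] in auto)
    \<comment> \<open>\<open>c\<close> is the value of \<open>m1 / x0 - l1\<close> and
      \<open>e\<close> the excess \<open>k2 - m2\<close>; the choice of \<open>K\<close> makes the
      horizontal gain twice the vertical loss \<open>l2 * d\<^sup>2\<close>.\<close>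
    define c where "c = l1 * (m1 - l1) / (l1 + m1)"
    define e where "e = r2 * m1"
    define K where "K = 2 * l2 / c"
    have c: "c > 0" and e: "e > 0" and K: "K > 0" using pos l1_less_m1 by (auto simp: c_def e_def K_def)
    \<comment> \<open>Beyond d \<le> 1, these bounds give in turn l2 d \<le> e / 2, l1 s \<le> d e /
      8 and 1 + s \<le> x0.\<close>
    define d where "d = Min {1, e / (2 * l2), e / (8 * l1 * K), (x0 - 1) / K}"
    have d: "d > 0" "d \<le> 1" "d \<le> e / (2 * l2)" "d \<le> e / (8 * l1 * K)" "d \<le> (x0 - 1) / K"
      using e K x0 pos by (auto simp: d_def)
    define s where "s = K * d\<^sup>2"
    have s: "s > 0" "s \<le> x0 - 1"
    proof -
      show "s > 0" using K d by (simp add: s_def)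
      have "d * d \<le> d * 1" using d by (intro mult_left_mono) auto
      then have "K * d\<^sup>2 \<le> K * d" using K by (simp add: power2_eq_square)
      also have "K * d \<le> x0 - 1" using d(5) K by (simp add: field_simps)
      finally show "s \<le> x0 - 1" by (simp add: s_def)
    qed
    have "gsum (1 + s) (1 + d)"
    proof (rule lyapunov[where B = "{s. snd s = 0}"])
      show "min (l2 * d\<^sup>2) (d * e / 8) > 0" using d e pos by simp
      fix m n :: nat assume "(m, n) \<notin> {s. snd s = 0}"
      then obtain j where n: "n = Suc j" by (cases n) auto
      have dd: "l2 * (d - d / (1 + d)) \<le> l2 * d\<^sup>2"
        using d pos by (intro mult_left_mono) (auto simp: field_simps power2_eq_square)
      show "drift (1 + s) (1 + d) m n \<le> - min (l2 * d\<^sup>2) (d * e / 8)"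
      proof (cases m)
        case 0
        have k2: "k2 = l2 + e" unfolding k2_def e_def using 3 by simp
        have "drift (1 + s) (1 + d) m n = l1 * s + d * (l2 * d - e) / (1 + d)"
          using d by (simp add: 0 n drift_eq eta2_def k2 field_simps)
        also have "d * (l2 * d - e) / (1 + d) \<le> - (d * e / 4)"
        proof -
          have "l2 * d - e \<le> - e / 2" using d(3) pos by (simp add: field_simps)
          then have "d * (l2 * d - e) \<le> d * (- e / 2)" using d by (intro mult_left_mono) auto
          also have "\<dots> \<le> - (d * e / 4) * (1 + d)"
          proof -
            have "d * e * d \<le> d * e * 1" using d e by (intro mult_left_mono) auto
            then show ?thesis by (simp add: algebra_simps)
          qed
          finally show ?thesis using d by (simp add: pos_divide_le_eq)
        qed
        also have "l1 * s \<le> d * e / 8"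
        proof -
          have "l1 * K * d \<le> e / 8" using d(4) K pos by (simp add: field_simps)
          then have "l1 * K * d * d \<le> e / 8 * d" using d by (intro mult_right_mono) auto
          then show ?thesis by (simp add: s_def power2_eq_square mult_ac)
        qed
        finally show ?thesis by simp
      next
        case (Suc i)
        have "m1 / (1 + s) \<ge> m1 / x0" using s pos by (intro divide_left_mono) auto
        moreover have "l1 - m1 / x0 = - c" using pos by (simp add: x0_def c_def field_simps)
        ultimately have "l1 - m1 / (1 + s) \<le> - c" by linarith
        then have "s * (l1 - m1 / (1 + s)) \<le> s * (- c)" using s by (intro mult_left_mono) auto
        also have "s * (- c) = - 2 * l2 * d\<^sup>2" using c by (simp add: s_def K_def)
        finally have a: "s * (l1 - m1 / (1 + s)) \<le> - 2 * l2 * d\<^sup>2" .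
        have "drift (1 + s) (1 + d) m n = s * (l1 - m1 / (1 + s)) + l2 * (d - d / (1 + d))"
          unfolding Suc n drift_eq ker_def using d s 3 by (simp add: field_simps)
        also have "\<dots> \<le> - (l2 * d\<^sup>2)" using a dd by linarith
        finally show ?thesis by linarith
      qed
    next
      show "(\<lambda>(m, n). p m n * (1 + s) ^ m * (1 + d) ^ n) summable_on {s. snd s = 0}"
        using s gsum_mono[OF g0, of "1 + s" 1] by (intro summable_on_row[of _ 1]) auto
    qed (use s d in auto)
    then have "gsum 1 (1 + d)" by (rule gsum_mono) (use s d in auto)
    then show thesis using that[of "1 + d"] Yt1 d by simp
  qed
qed

text \<open>Strictly between \<open>y0 x\<close> and \<open>min Yt (yc x)\<close> both the interior
  drift and the bottom-row drift are negative. Only the column \<open>m = 0\<close> is excepted, and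
  there \<open>y < Yt\<close> lies within the radius from \<open>col_radius\<close>.\<close>

lemma interior_gsum:
  assumes x: "1 < x" "x < R"
  obtains y where "y0 x < y" "gsum x y"
proof -
  obtain \<rho> where \<rho>: "\<rho> > Yt" "gsum 1 \<rho>" using col_radius by blast
  have xr: "x < xr" "xl < x" using x R_bounds xl_xr by auto
  have wx: "w x > 2 * sg" using xr by (intro w_gt) auto
  have y0: "y0 x > 0" "Yt \<le> y1 x" using y01_sum_prod[of x] wx by auto
  have lt: "y0 x < min Yt (yc x)" using y0_less_Yt[OF wx] y0_less_yc_R[OF x] by simp
  then obtain y where y: "y0 x < y" "y < min Yt (yc x)" using dense by blast
  have yp: "y > 0" using y y0 by simp
  have "l2 * ((y - y0 x) * (y - y1 x)) < 0"
    using y y0 pos by (intro mult_pos_neg) auto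
  then have kn: "ker x y < 0"
    using ker_factor[of x y] wx yp by (simp add: divide_neg_pos mult.assoc)
  have "1 / yc x < 1 / y" using y yp by (intro divide_strict_left_mono) auto
  then have "m2 * (1 / yc x - 1 / y) < 0" using pos by (intro mult_pos_neg) auto
  then have en: "eta1 x y < 0" using eta1_yc[of x y] kn x by linarith
  have "gsum x y"
  proof (rule lyapunov[where B = "{s. fst s = 0}"])
    show "min (- ker x y) (- eta1 x y) > 0" using kn en by simp
    fix m n :: nat assume "(m, n) \<notin> {s. fst s = 0}"
    then obtain j where m: "m = Suc j" by (cases m) auto
    show "drift x y m n \<le> - min (- ker x y) (- eta1 x y)"
      by (cases n) (auto simp: m drift_eq)
  next
    show "(\<lambda>(m, n). p m n * x ^ m * y ^ n) summable_on {s. fst s = 0}"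
      using gsum_mono[OF \<rho>(2), of 1 y] y yp \<rho> by (intro summable_on_col[of 1]) auto
  qed (use x yp in auto)
  then show thesis using that y by blast
qed

section \<open>The complex branch of the kernel\<close>

text \<open>On this set both \<open>w x - 2 * sg\<close> and \<open>w x + 2 * sg\<close> have
  positive real part, so no branch cut is met. It contains the open annulus between
  \<open>xl\<close> and \<open>xr\<close> and its outer circle except for the point
  \<open>xr\<close>.\<close>

definition Dom :: "complex set" where "Dom = {x. x \<noteq> 0 \<and> Re (w x) > 2 * sg}"

text \<open>The root of the discriminant is taken factor by factor: the argument bounds of the two
  factors give \<open>Yc_bound\<close>, and only the second factor vanishes at
  \<open>xr\<close>.\<close>

definition Yc :: "complex \<Rightarrow> complex" where
  "Yc x = (w x - csqrt (w x + of_real (2 * sg)) * csqrt (w x - of_real (2 * sg))) / of_real (2 * l2)"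
definition Yd :: "complex \<Rightarrow> complex" where
  "Yd x = (w x + csqrt (w x + of_real (2 * sg)) * csqrt (w x - of_real (2 * sg))) / of_real (2 * l2)"

lemma w_holomorphic: "0 \<notin> A \<Longrightarrow> w holomorphic_on A"
  unfolding w_def by (intro holomorphic_intros) auto

lemma open_Dom: "open Dom"
proof -
  have "continuous_on (- {0}) (w :: complex \<Rightarrow> complex)"
    by (intro holomorphic_on_imp_continuous_on w_holomorphic) auto
  then have "open (- {0} \<inter> w -` {z. Re z > 2 * sg})"
    by (rule continuous_open_preimage) (auto simp: open_halfspace_Re_gt)
  moreover have "- {0} \<inter> w -` {z. Re z > 2 * sg} = Dom" by (auto simp: Dom_def)
  ultimately show ?thesis by simp
qed

lemma Dom_Re: "x \<in> Dom \<Longrightarrow> Re (w x + of_real (2 * sg)) > 0" "x \<in> Dom \<Longrightarrow> Re (w x - of_real (2 * sg)) > 0"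
  using sg_Yt by (auto simp: Dom_def)

lemma Yc_holomorphic: "Yc holomorphic_on Dom" and Yd_holomorphic: "Yd holomorphic_on Dom"
proof -
  have "w holomorphic_on Dom" by (rule w_holomorphic) (auto simp: Dom_def)
  moreover have "w x + of_real (2 * sg) \<notin> \<real>\<^sub>\<le>\<^sub>0" "w x - of_real (2 * sg) \<notin> \<real>\<^sub>\<le>\<^sub>0" if "x \<in> Dom" for x
    using Re_pos_notin Dom_Re that by blast+
  ultimately show "Yc holomorphic_on Dom" "Yd holomorphic_on Dom"
    unfolding Yc_def Yd_def using pos by (intro holomorphic_intros; simp)+
qed

lemma Yc_Yd: "Yc x + Yd x = w x / of_real l2" "Yc x * Yd x = of_real (m2 / l2)"
proof -
  show "Yc x + Yd x = w x / of_real l2" using pos by (simp add: Yc_def Yd_def field_simps)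
  define a where "a = csqrt (w x + of_real (2 * sg))"
  define b where "b = csqrt (w x - of_real (2 * sg))"
  have a2: "a\<^sup>2 = w x + of_real (2 * sg)" and b2: "b\<^sup>2 = w x - of_real (2 * sg)"
    by (simp_all add: a_def b_def)
  have "(w x - a * b) * (w x + a * b) = (w x)\<^sup>2 - a\<^sup>2 * b\<^sup>2" by (simp add: power2_eq_square algebra_simps)
  also have "\<dots> = of_real (4 * sg\<^sup>2)" unfolding a2 b2 by (simp add: power2_eq_square algebra_simps)
  also have "\<dots> = of_real (4 * l2 * m2)" using sg_Yt by simp
  finally have "(w x - a * b) * (w x + a * b) = of_real (4 * l2 * m2)" .
  then have "Yc x * Yd x = of_real (4 * l2 * m2) / (of_real (2 * l2) * of_real (2 * l2))"
    unfolding Yc_def Yd_def a_def[symmetric] b_def[symmetric] by simp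
  also have "\<dots> = of_real ((4 * l2 * m2) / ((2 * l2) * (2 * l2)))" by (simp only: of_real_mult of_real_divide)
  also have "(4 * l2 * m2) / ((2 * l2) * (2 * l2)) = m2 / l2" using pos by (simp add: field_simps)
  finally show "Yc x * Yd x = of_real (m2 / l2)" .
qed

lemma Yc_nz: "Yc x \<noteq> 0" "Yd x \<noteq> 0"
  using Yc_Yd(2)[of x] pos by auto

lemma Yc_ker_eq: "of_real l2 * (y - Yc x) * (y - Yd x) = of_real l2 * y\<^sup>2 - w x * y + of_real m2"
proof -
  have "of_real l2 * (y - Yc x) * (y - Yd x) = of_real l2 * y\<^sup>2 - of_real l2 * (Yc x + Yd x) * y + of_real l2 * (Yc x * Yd x)"
    by (simp add: algebra_simps power2_eq_square)
  then show ?thesis unfolding Yc_Yd using pos by simp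
qed

lemma ker_Yc: "ker x (Yc x) = 0" "ker x (Yd x) = 0"
  using Yc_ker_eq[of "Yc x" x] Yc_ker_eq[of "Yd x" x] ker_w[OF Yc_nz(1), of x x] ker_w[OF Yc_nz(2), of x x] by auto

text \<open>With \<open>a\<close> and \<open>b\<close> the two square roots, the kernel roots are (a
  - b)^2 / (4 l2) and (a + b)^2 / (4 l2). The arguments of \<open>a\<close> and \<open>b\<close> are
  below pi/4 in absolute value, so a - b has smaller modulus than a + b, while the moduli of the two
  kernel roots multiply to \<open>Yt\<^sup>2\<close>.\<close>

lemma Yc_bound:
  assumes "x \<in> Dom"
  shows "cmod (Yc x) < Yt"
proof -
  define a where "a = csqrt (w x + of_real (2 * sg))"
  define b where "b = csqrt (w x - of_real (2 * sg))"
  have a2: "a\<^sup>2 = w x + of_real (2 * sg)" and b2: "b\<^sup>2 = w x - of_real (2 * sg)"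
    by (simp_all add: a_def b_def)
  have ra: "Re a > 0" "Re b > 0"
    unfolding a_def b_def by (intro Re_csqrt_pos Dom_Re assms)+
  have "\<bar>Im a\<bar> < Re a" "\<bar>Im b\<bar> < Re b"
    unfolding a_def b_def by (intro Im_csqrt_less Dom_Re assms)+
  then have "\<bar>Im a\<bar> * \<bar>Im b\<bar> < Re a * Re b" using ra by (intro mult_strict_mono) auto
  then have rab: "Re a * Re b + Im a * Im b > 0" by (simp add: abs_mult[symmetric] abs_less_iff) 
  have "(cmod (a - b))\<^sup>2 < (cmod (a + b))\<^sup>2"
    unfolding cmod_power2 using rab by (simp add: power2_eq_square algebra_simps)
  moreover have yc: "of_real (4 * l2) * Yc x = (a - b)\<^sup>2" "of_real (4 * l2) * Yd x = (a + b)\<^sup>2"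
  proof -
    have "(a - b)\<^sup>2 = a\<^sup>2 + b\<^sup>2 - 2 * (a * b)" "(a + b)\<^sup>2 = a\<^sup>2 + b\<^sup>2 + 2 * (a * b)"
      by (simp_all add: power2_eq_square algebra_simps)
    then have "(a - b)\<^sup>2 = 2 * (w x - a * b)" "(a + b)\<^sup>2 = 2 * (w x + a * b)" unfolding a2 b2 by simp_all
    then show "of_real (4 * l2) * Yc x = (a - b)\<^sup>2" "of_real (4 * l2) * Yd x = (a + b)\<^sup>2"
      using pos by (simp_all add: Yc_def Yd_def a_def b_def)
  qed
  then have "4 * l2 * cmod (Yc x) = (cmod (a - b))\<^sup>2" "4 * l2 * cmod (Yd x) = (cmod (a + b))\<^sup>2"
    using pos by (metis norm_mult norm_of_real norm_power abs_of_pos mult_pos_pos zero_less_numeral)+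
  ultimately have "4 * l2 * cmod (Yc x) < 4 * l2 * cmod (Yd x)" by simp
  then have lt: "cmod (Yc x) < cmod (Yd x)" using pos by simp
  have pr: "cmod (Yc x) * cmod (Yd x) = Yt\<^sup>2"
    using Yc_Yd(2)[of x] pos sg_Yt by (metis norm_mult norm_of_real abs_of_pos divide_pos_pos)
  show ?thesis
  proof (rule ccontr)
    assume "\<not> ?thesis"
    then have "Yt * Yt < cmod (Yc x) * cmod (Yd x)"
      using lt sg_Yt by (intro mult_le_less_imp_less) auto
    then show False using pr by (simp add: power2_eq_square)
  qed
qed

lemma Re_w:
  assumes "x \<noteq> 0"
  shows "Re (w x) = l1 + l2 + m1 + m2 - (l1 + m1 / (cmod x)\<^sup>2) * Re x"
  by (simp add: w_def Re_divide cmod_power2 distrib_right)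

text \<open>On a circle around 0, \<open>Re (w x)\<close> is a decreasing affine function of
  \<open>Re x\<close>, hence smallest at the positive real point and only there.\<close>

lemma Re_w_ge:
  assumes "x \<noteq> 0"
  shows "Re (w x) \<ge> w (cmod x)" and "x \<noteq> of_real (cmod x) \<Longrightarrow> Re (w x) > w (cmod x)"
proof -
  have c: "l1 + m1 / (cmod x)\<^sup>2 > 0" using pos assms by (simp add: add_pos_pos)
  have wr: "w (cmod x) = l1 + l2 + m1 + m2 - (l1 + m1 / (cmod x)\<^sup>2) * cmod x"
    using assms by (simp add: w_def field_simps power2_eq_square)
  show "Re (w x) \<ge> w (cmod x)"
    unfolding Re_w[OF assms] wr using c complex_Re_le_cmod[of x] by (simp add: mult_left_mono)
  assume n: "x \<noteq> of_real (cmod x)"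
  have "Re x \<noteq> cmod x"
  proof
    assume "Re x = cmod x"
    then have "Im x = 0" using cmod_power2[of x] by simp
    then show False using n \<open>Re x = cmod x\<close> by (simp add: complex_eq_iff)
  qed
  then have "Re x < cmod x" using complex_Re_le_cmod[of x] by simp
  then show "Re (w x) > w (cmod x)"
    unfolding Re_w[OF assms] wr using c by simp
qed

lemma in_Dom:
  assumes "xl < cmod x" "cmod x < xr"
  shows "x \<in> Dom"
proof -
  have nz: "x \<noteq> 0" using assms xl_xr by auto
  have "w (cmod x) > 2 * sg" using w_gt assms by simp
  then show ?thesis using Re_w_ge(1)[OF nz] nz by (simp add: Dom_def)
qed

lemma in_Dom_xr:
  assumes "cmod x = xr" "x \<noteq> of_real xr"
  shows "x \<in> Dom"
proof -
  have nz: "x \<noteq> 0" using assms xl_xr by auto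
  show ?thesis using Re_w_ge(2)[OF nz] nz assms w_xr by (simp add: Dom_def)
qed

text \<open>By the kernel equation and the triangle inequality the real kernel at
  \<open>(cmod x, cmod (Yc x))\<close> is nonnegative, so this modulus is not strictly between
  \<open>y0\<close> and \<open>y1\<close>; by \<open>Yc_bound\<close> it is below \<open>Yt\<close>,
  hence below \<open>y1\<close>.\<close>

lemma cmod_Yc_le:
  assumes "xl < cmod x" "cmod x < xr"
  shows "cmod (Yc x) \<le> y0 (cmod x)"
proof -
  have D: "x \<in> Dom" using in_Dom[OF assms] .
  have nz: "x \<noteq> 0" using D by (simp add: Dom_def)
  define t where "t = cmod (Yc x)"
  have t: "0 < t" "t < Yt" using Yc_bound[OF D] Yc_nz by (auto simp: t_def)
  have wr: "w (cmod x) > 2 * sg" using w_gt assms by simp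
  have "w x * Yc x = of_real l2 * (Yc x)\<^sup>2 + of_real m2" using Yc_ker_eq[of "Yc x" x] by (simp add: diff_add_eq)
  then have "cmod (w x) * t = cmod (of_real l2 * (Yc x)\<^sup>2 + of_real m2)" by (metis norm_mult t_def)
  also have "\<dots> \<le> l2 * t\<^sup>2 + m2"
    using norm_triangle_ineq[of "of_real l2 * (Yc x)\<^sup>2" "of_real m2"] pos by (simp add: norm_mult norm_power t_def)
  finally have 1: "cmod (w x) * t \<le> l2 * t\<^sup>2 + m2" .
  have "w (cmod x) \<le> cmod (w x)" using Re_w_ge(1)[OF nz] complex_Re_le_cmod[of "w x"] by linarith
  then have "w (cmod x) * t \<le> cmod (w x) * t" using t by (intro mult_right_mono) auto
  then have "l2 * t\<^sup>2 - w (cmod x) * t + m2 \<ge> 0" using 1 by linarith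
  then have "ker (cmod x) t \<ge> 0" using ker_w[of t "cmod x"] t by simp
  then have "l2 * ((t - y0 (cmod x)) * (t - y1 (cmod x))) / t \<ge> 0"
    using ker_factor[of "cmod x" t] wr t by (simp add: mult.assoc)
  then have "(t - y0 (cmod x)) * (t - y1 (cmod x)) \<ge> 0" using t pos by (simp add: zero_le_divide_iff zero_le_mult_iff)
  moreover have "t - y1 (cmod x) < 0" using y01_sum_prod(5)[of "cmod x"] wr t by linarith
  ultimately show ?thesis by (simp add: zero_le_mult_iff t_def)
qed

text \<open>On the kernel a zero of \<open>eta1\<close> lies on the curve of \<open>yc\<close>, so
  \<open>gq x = 0\<close>, and \<open>xm\<close> can be excluded. Since \<open>Yc\<close> stays
  below \<open>Yt\<close> in modulus, such a zero exists only when \<open>yp < Yt\<close>.\<close>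

lemma eta1_zero:
  assumes x: "x \<in> Dom" "x \<noteq> 1" and e: "eta1 x (Yc x) = 0"
  shows "x = of_real xp" "Yc x = of_real yp" "yp < Yt"
proof -
  have x0: "x \<noteq> 0" using x by (simp add: Dom_def)
  define q where "q = of_real (1 - r1) * x + of_real r1"
  have "of_real m2 * ((1 - 1 / Yc x) - of_real r1 * (1 - 1 / x)) = 0"
    using e unfolding eta1_ker ker_Yc by simp
  then have "(1 - 1 / Yc x) = of_real r1 * (1 - 1 / x)" using pos by simp
  then have "1 / Yc x = 1 - of_real r1 * (1 - 1 / x)" by (simp add: algebra_simps)
  also have "\<dots> = q / x" using x0 by (simp add: q_def field_simps)
  finally have yq: "1 / Yc x = q / x" .
  then have q: "q \<noteq> 0" using Yc_nz[of x] by auto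
  then have "Yc x = x / q" using yq x0 Yc_nz[of x] by (simp add: field_simps)
  then have Y: "Yc x = yc x" by (simp add: yc_def q_def)
  have "(x - 1) * gq x / (x * q) = 0" using ker_yc[of x] x0 q ker_Yc(1)[of x] Y by (simp add: q_def)
  then have "gq x = 0" using x(2) x0 q by simp
  then have "(x - of_real xp) * (x - of_real xm) = 0" using pos by (simp add: gq_factor)
  \<comment> \<open>At \<open>xm\<close> the root \<open>y = yc xm\<close> would satisfy
    \<open>1 < y\<close> and \<open>y < Yt\<close>, hence \<open>l2 * y < m2\<close>; then the
    \<open>y\<close> part and both \<open>x\<close> terms of \<open>ker xm y\<close> are negative
    and cannot cancel.\<close>
  moreover have "x \<noteq> of_real xm"
  proof
    assume xm: "x = of_real xm"
    define y where "y = yc xm"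
    have Yr: "Yc x = of_real y" unfolding Y y_def unfolding xm by (simp add: yc_def)
    have qm: "(1 - r1) * xm + r1 < 0" using xm_less(1) pos by (simp add: field_simps)
    have "xm < 1 * ((1 - r1) * xm + r1)"
    proof -
      have "r1 * (1 - xm) > 0" using xm_less pos by simp
      then show ?thesis by (simp add: algebra_simps)
    qed
    then have y1: "y > 1" unfolding y_def yc_def using qm by (simp add: neg_less_divide_eq)
    have yt: "y < Yt" using Yc_bound[OF x(1)] y1 by (simp add: Yr)
    have "y * y < Yt * Yt" using yt y1 by (intro mult_strict_mono) auto
    then have "l2 * (y * y) < l2 * (Yt * Yt)" using pos by (intro mult_strict_left_mono) auto
    moreover have "l2 * (Yt * Yt) = m2" using sg_Yt(3) pos by (simp add: power2_eq_square)
    ultimately have "l2 * (y * y) < m2" by simp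
    moreover have "l2 * y * 1 \<le> l2 * y * y" using y1 pos by (intro mult_left_mono) auto
    ultimately have "l2 * y < m2" by simp
    then have a: "l2 * (y - 1) + m2 * (1 / y - 1) < 0"
    proof -
      have "l2 * (y - 1) + m2 * (1 / y - 1) = (y - 1) * (l2 * y - m2) / y" using y1 by (simp add: field_simps)
      then show ?thesis using y1 \<open>l2 * y < m2\<close> by (simp add: divide_neg_pos mult_pos_neg)
    qed
    have b: "l1 * (xm - 1) < 0" "m1 * (1 / xm - 1) < 0"
      using xm_less(2) pos by (auto intro!: mult_pos_neg simp: field_simps)
    have "ker xm y = 0"
    proof -
      have "complex_of_real (ker xm y) = ker x (Yc x)" unfolding Yr unfolding xm by (simp add: ker_def)
      then show ?thesis using ker_Yc(1)[of x] by simp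
    qed
    then show False using a b by (simp add: ker_def)
  qed
  ultimately show xx: "x = of_real xp" by simp
  show Yy: "Yc x = of_real yp" unfolding Y yp_def unfolding xx by (simp add: yc_def)
  show "yp < Yt" using Yc_bound[OF x(1)] yp_gt_1 by (simp add: Yy)
qed

section \<open>Continuation of the row series across its circle of convergence\<close>

definition ext :: "complex \<Rightarrow> complex" where
  "ext x = - (numer x (Yc x) / (eta1 x (Yc x) * x))"

lemma P2_sums:
  assumes "gsum 1 \<rho>" "\<rho> > 0" "cmod y \<le> \<rho>"
  shows "(\<lambda>n. of_real (p 0 (Suc n)) * y ^ n) sums P2 y"
  unfolding P2_def by (intro summable_sums shifted_powser_summable[OF gsum_col[OF assms(1)]]) (use assms p_nonneg in auto)

lemma P2_holomorphic:
  obtains \<rho> where "\<rho> > Yt" "P2 holomorphic_on ball 0 \<rho>"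
    "\<And>y. cmod y < \<rho> \<Longrightarrow> (\<lambda>n. of_real (p 0 (Suc n)) * y ^ n) sums P2 y"
proof -
  obtain \<rho> where r: "\<rho> > Yt" "gsum 1 \<rho>" using col_radius by blast
  have s: "(\<lambda>n. of_real (p 0 (Suc n)) * y ^ n) sums P2 y" if "cmod y < \<rho>" for y
    using P2_sums[OF r(2)] r sg_Yt that by simp
  have "P2 holomorphic_on ball 0 \<rho>"
    by (rule power_series_holomorphic[where a = "\<lambda>n. of_real (p 0 (Suc n))"]) (use s in auto)
  then show thesis using that r s by blast
qed

lemma P1_sums:
  assumes "cmod x < R"
  shows "(\<lambda>m. of_real (p (Suc m) 0) * x ^ m) sums P1 x"
proof -
  obtain r where r: "max 1 (cmod x) < r" "r < R" using dense[of "max 1 (cmod x)" R] assms R_bounds by auto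
  obtain y where y: "gsum r y" using interior_gsum[of r] r by auto
  show ?thesis unfolding P1_def
    by (intro summable_sums shifted_powser_summable[OF gsum_row[OF y]]) (use r p_nonneg in auto)
qed

lemma P1_holomorphic: "P1 holomorphic_on ball 0 R"
  by (rule power_series_holomorphic[where a = "\<lambda>n. of_real (p (Suc n) 0)"]) (use P1_sums in auto)

lemma annulus_Dom:
  assumes "1 < cmod x" "cmod x < R"
  shows "x \<in> Dom" "eta1 x (Yc x) \<noteq> 0"
proof -
  show D: "x \<in> Dom" by (rule in_Dom) (use assms xl_xr R_bounds in auto)
  have x1: "x \<noteq> 1" using assms by auto
  show "eta1 x (Yc x) \<noteq> 0"
  proof
    assume "eta1 x (Yc x) = 0"
    from eta1_zero[OF D x1 this] assms xp_gt_1 show False by (simp add: R_def)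
  qed
qed

lemma circle_Dom:
  assumes "cmod x = R" "x \<noteq> of_real R"
  shows "x \<in> Dom" "eta1 x (Yc x) \<noteq> 0"
proof -
  show D: "x \<in> Dom"
  proof (cases "R = xr")
    case True then show ?thesis using assms in_Dom_xr by simp
  next
    case False
    show ?thesis by (rule in_Dom) (use False assms xl_xr R_bounds in auto)
  qed
  have x1: "x \<noteq> 1" using assms R_bounds by auto
  show "eta1 x (Yc x) \<noteq> 0"
  proof
    assume "eta1 x (Yc x) = 0"
    from eta1_zero[OF D x1 this] assms xp_gt_1 show False by (simp add: R_def)
  qed
qed

text \<open>\<open>cmod_Yc_le\<close> places \<open>Yc x\<close> inside the radius \<open>y\<close>
  of \<open>interior_gsum\<close>, so the functional equation applies, and
  \<open>annulus_Dom\<close> allows division by \<open>eta1\<close>.\<close>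

lemma P1_ext:
  assumes "1 < cmod x" "cmod x < R"
  shows "P1 x = ext x"
proof -
  obtain y where y: "y0 (cmod x) < y" "gsum (cmod x) y" using interior_gsum assms by blast
  have le: "cmod (Yc x) \<le> y0 (cmod x)" by (rule cmod_Yc_le) (use assms xl_xr R_bounds in auto)
  have "cmod (Yc x) > 0" using Yc_nz by simp
  then have yp: "y > 0" using le y by linarith
  have nz: "x \<noteq> 0" using assms by auto
  have "eta1 x (Yc x) * x * P1 x + numer x (Yc x) = 0"
    by (rule functional_equation[OF _ yp y(2)]) (use assms nz le y Yc_nz ker_Yc in auto)
  then have "eta1 x (Yc x) * x * P1 x = - numer x (Yc x)" by (simp add: add_eq_0_iff)
  then show ?thesis using annulus_Dom[OF assms] nz by (simp add: ext_def field_simps)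
qed

lemma eta_holomorphic [holomorphic_intros]:
  assumes "f holomorphic_on A" "g holomorphic_on A" "\<And>x. x \<in> A \<Longrightarrow> f x \<noteq> 0" "\<And>x. x \<in> A \<Longrightarrow> g x \<noteq> 0"
  shows "(\<lambda>x. eta1 (f x) (g x)) holomorphic_on A" "(\<lambda>x. eta2 (f x) (g x)) holomorphic_on A"
    "(\<lambda>x. eta0 (f x) (g x)) holomorphic_on A"
  unfolding eta1_def eta2_def eta0_def using assms by (auto intro!: holomorphic_intros)

lemma numer_holomorphic:
  assumes "f holomorphic_on A" "g holomorphic_on A" "\<And>x. x \<in> A \<Longrightarrow> f x \<noteq> 0" "\<And>x. x \<in> A \<Longrightarrow> g x \<noteq> 0"
    and P2: "P2 holomorphic_on ball 0 \<rho>" "\<And>x. x \<in> A \<Longrightarrow> cmod (g x) < \<rho>"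
  shows "(\<lambda>x. numer (f x) (g x)) holomorphic_on A"
proof -
  have "(P2 \<circ> g) holomorphic_on A"
    by (rule holomorphic_on_compose_gen[OF assms(2) P2(1)]) (use P2(2) in auto)
  then have "(\<lambda>x. P2 (g x)) holomorphic_on A" by (simp add: o_def)
  then show ?thesis unfolding numer_def by (intro holomorphic_intros assms)
qed

lemma ext_holomorphic:
  assumes "A \<subseteq> Dom" "\<And>x. x \<in> A \<Longrightarrow> eta1 x (Yc x) \<noteq> 0"
  shows "ext holomorphic_on A"
proof -
  obtain \<rho> where r: "\<rho> > Yt" "P2 holomorphic_on ball 0 \<rho>" using P2_holomorphic by blast
  have x0: "x \<noteq> 0" if "x \<in> A" for x using that assms by (auto simp: Dom_def)
  have Y: "Yc holomorphic_on A" using Yc_holomorphic assms(1) holomorphic_on_subset by blast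
  have b: "cmod (Yc x) < \<rho>" if "x \<in> A" for x using Yc_bound[of x] r that assms by force
  have "(\<lambda>x. numer x (Yc x)) holomorphic_on A"
    by (rule numer_holomorphic[OF _ Y _ _ r(2) b]) (use x0 Yc_nz in auto)
  then show ?thesis unfolding ext_def
    by (intro holomorphic_intros Y) (use x0 Yc_nz assms(2) in auto)
qed

text \<open>After rescaling by \<open>R\<close>, the functions \<open>P1\<close> and
  \<open>ext\<close> agree on an annulus and glue to one holomorphic function on an open set
  containing the closed unit disc without 1, as \<open>darboux_transfer\<close> requires. Only the
  local form of \<open>ext\<close> at \<open>R\<close> is left to the three cases.\<close>

theorem row_asymptotics:
  fixes e :: int
  assumes G: "G holomorphic_on ball 0 d" "d > 0"
    and near: "\<And>z. cmod z < 1 \<Longrightarrow> cmod (1 - z) < d ^ 2 \<Longrightarrow> 1 < cmod (of_real R * z) \<Longrightarrow>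
                 ext (of_real R * z) = c0 + csqrt (1 - z) powi e * G (csqrt (1 - z))"
    and e: "- 2 \<le> e" "e < 2"
  shows "(\<lambda>m. complex_of_real (p (Suc m) 0 * R ^ m * real m powr (e / 2 + 1))) \<longlonglongrightarrow> G 0 * rGamma (- (of_int e / 2))"
proof -
  have R0: "R > 0" using R_bounds by simp
  define E where "E = {x \<in> Dom. 1 < cmod x \<and> eta1 x (Yc x) \<noteq> 0}"
  have oE: "open E"
  proof -
    have c: "continuous_on Dom (\<lambda>x. eta1 x (Yc x))"
      by (intro holomorphic_on_imp_continuous_on holomorphic_intros Yc_holomorphic) (auto simp: Dom_def Yc_nz)
    have "open (Dom \<inter> (\<lambda>x. eta1 x (Yc x)) -` (- {0}))"
      by (rule continuous_open_preimage[OF c open_Dom]) auto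
    moreover have "open {x::complex. 1 < cmod x}"
      by (intro open_Collect_less continuous_intros)
    moreover have "E = (Dom \<inter> (\<lambda>x. eta1 x (Yc x)) -` (- {0})) \<inter> {x. 1 < cmod x}" by (auto simp: E_def)
    ultimately show ?thesis by auto
  qed
  define E' where "E' = (\<lambda>z. of_real R * z) -` E"
  have oE': "open E'" unfolding E'_def by (intro open_vimage oE continuous_intros)
  define F where "F = (\<lambda>z. if cmod z < 1 then P1 (of_real R * z) else ext (of_real R * z))"
  have FE: "F z = ext (of_real R * z)" if "z \<in> E'" for z
    using that R0 P1_ext[of "of_real R * z"] by (auto simp: F_def E'_def E_def norm_mult)
  have hB: "F holomorphic_on ball 0 1"
  proof -
    have "(P1 \<circ> (\<lambda>z. of_real R * z)) holomorphic_on ball 0 1"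
      by (rule holomorphic_on_compose_gen[OF _ P1_holomorphic]) (use R0 in \<open>auto intro!: holomorphic_intros simp: norm_mult\<close>)
    then show ?thesis by (rule holomorphic_transform) (auto simp: F_def)
  qed
  have hE: "F holomorphic_on E'"
  proof -
    have "(ext \<circ> (\<lambda>z. of_real R * z)) holomorphic_on E'"
      by (rule holomorphic_on_compose_gen[OF _ ext_holomorphic[of E]])
         (auto intro!: holomorphic_intros simp: E'_def E_def)
    then show ?thesis by (rule holomorphic_transform) (use FE in auto)
  qed
  \<comment> \<open>The bound \<open>sqrt (1 - 1 / R)\<close> keeps the points near 1 in the annulus
    where \<open>ext\<close> represents \<open>P1\<close>.\<close>
  define d' where "d' = min d (sqrt (1 - 1 / R))"
  have d': "d' > 0" "d' \<le> d" using G(2) R_bounds by (auto simp: d'_def)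
  have d'2: "d' ^ 2 \<le> d ^ 2" "d' ^ 2 \<le> 1 - 1 / R"
  proof -
    show "d' ^ 2 \<le> d ^ 2" using d' by (intro power_mono) auto
    have "d' ^ 2 \<le> sqrt (1 - 1 / R) ^ 2" using d' by (intro power_mono) (auto simp: d'_def)
    then show "d' ^ 2 \<le> 1 - 1 / R" using R_bounds by simp
  qed
  define a where "a = (\<lambda>m. complex_of_real (p (Suc m) 0 * R ^ m))"
  have "(\<lambda>n. a n * of_real (real n powr (e / 2 + 1))) \<longlonglongrightarrow> G 0 * rGamma (- (of_int e / 2))"
  proof (rule darboux_transfer)
    show "(\<lambda>n. a n * z ^ n) sums F z" if "cmod z < 1" for z
      using P1_sums[of "of_real R * z"] that R0 by (simp add: F_def a_def norm_mult power_mult_distrib mult_ac)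
    show "open (ball 0 1 \<union> E')" using oE' by auto
    show "cball 0 1 - {1} \<subseteq> ball 0 1 \<union> E'"
    proof
      fix z :: complex assume z: "z \<in> cball 0 1 - {1}"
      show "z \<in> ball 0 1 \<union> E'"
      proof (cases "cmod z < 1")
        case False
        then have "cmod (of_real R * z) = R" "of_real R * z \<noteq> of_real R" using z R0 by (auto simp: norm_mult)
        from circle_Dom[OF this] this(1) R_bounds show ?thesis by (auto simp: E'_def E_def)
      qed auto
    qed
    show "F holomorphic_on ball 0 1 \<union> E'" using hB hE oE' by (intro holomorphic_on_Un) auto
    show "G holomorphic_on ball 0 d'" by (rule holomorphic_on_subset[OF G(1)]) (use d' in auto)
    show "F z = c0 + csqrt (1 - z) powi e * G (csqrt (1 - z))" if z: "cmod z < 1" "cmod (1 - z) < d' ^ 2" for z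
    proof -
      have "1 - cmod z \<le> cmod (1 - z)" using norm_triangle_ineq2[of 1 z] by simp
      then have "1 / R < cmod z" using z d'2 by linarith
      then have g: "1 < cmod (of_real R * z)" using R0 by (simp add: norm_mult field_simps)
      have "cmod (of_real R * z) < R" using z R0 by (simp add: norm_mult)
      then have "F z = ext (of_real R * z)" using z g P1_ext by (simp add: F_def)
      then show ?thesis using near[OF z(1) _ g] z d'2 by simp
    qed
  qed (use e d' in auto)
  then show ?thesis by (simp add: a_def)
qed

section \<open>Asymptotics along the first row\<close>

definition P2r :: "real \<Rightarrow> real" where "P2r y = (\<Sum>n. p 0 (Suc n) * y ^ n)"
definition dP2r :: "real \<Rightarrow> real" where "dP2r y = (\<Sum>n. diffs (\<lambda>n. p 0 (Suc n)) n * y ^ n)"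
definition NR :: "real \<Rightarrow> real \<Rightarrow> real" where "NR x y = eta2 x y * y * P2r y + eta0 x y * p 0 0"

lemma P2r_summable:
  assumes "gsum 1 \<rho>" "\<rho> > 0"
  shows "summable (\<lambda>n. p 0 (Suc n) * \<rho> ^ n)"
proof -
  have "summable (\<lambda>n. complex_of_real (p 0 (Suc n)) * of_real \<rho> ^ n)"
    using P2_sums[OF assms, of "of_real \<rho>"] assms by (auto simp: sums_iff)
  then have "summable (\<lambda>n. complex_of_real (p 0 (Suc n) * \<rho> ^ n))" by simp
  then show ?thesis by (subst (asm) summable_of_real_iff)
qed

lemma P2r_facts:
  assumes r2: "gsum 1 \<rho>" and y: "0 < y" "y < \<rho>"
  shows "P2 (of_real y) = of_real (P2r y)" "0 \<le> P2r y" "0 \<le> dP2r y"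
    "(P2 has_field_derivative of_real (dP2r y)) (at (of_real y))"
    "(P2r has_field_derivative dP2r y) (at y)"
proof -
  have r0: "\<rho> > 0" "y < \<rho>" using y by auto
  have s\<rho>: "summable (\<lambda>n. p 0 (Suc n) * \<rho> ^ n)" by (rule P2r_summable) (use r2 r0 in auto)
  have s: "summable (\<lambda>n. p 0 (Suc n) * y ^ n)"
    by (rule powser_inside[OF s\<rho>]) (use r0 y in auto)
  have "(\<lambda>n. complex_of_real (p 0 (Suc n) * y ^ n)) sums of_real (P2r y)"
    unfolding P2r_def by (intro sums_of_real summable_sums s)
  then show "P2 (of_real y) = of_real (P2r y)"
    by (simp add: P2_def sums_iff)
  show "0 \<le> P2r y" unfolding P2r_def using p_nonneg y by (intro suminf_nonneg s) auto
  have sd: "summable (\<lambda>n. diffs (\<lambda>n. p 0 (Suc n)) n * y ^ n)"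
    by (rule termdiff_converges[where K = \<rho>]) (use r0 y powser_inside[OF s\<rho>] in auto)
  show "0 \<le> dP2r y" unfolding dP2r_def using p_nonneg y
    by (intro suminf_nonneg sd) (auto simp: diffs_def)
  show "(P2r has_field_derivative dP2r y) (at y)"
    unfolding P2r_def dP2r_def by (rule termdiffs_strong[OF s\<rho>]) (use r0 y in auto)
  have c\<rho>: "summable (\<lambda>n. complex_of_real (p 0 (Suc n)) * of_real \<rho> ^ n)"
    using P2_sums[OF r2 r0(1), of "of_real \<rho>"] r0 by (auto simp: sums_iff)
  have "(P2 has_field_derivative (\<Sum>n. diffs (\<lambda>n. complex_of_real (p 0 (Suc n))) n * of_real y ^ n)) (at (of_real y))"
    unfolding P2_def by (rule termdiffs_strong[OF c\<rho>]) (use r0 y in auto)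
  moreover have "(\<lambda>n. complex_of_real (diffs (\<lambda>n. p 0 (Suc n)) n * y ^ n)) sums of_real (dP2r y)"
    unfolding dP2r_def by (intro sums_of_real summable_sums sd)
  then have "(\<Sum>n. diffs (\<lambda>n. complex_of_real (p 0 (Suc n))) n * of_real y ^ n) = of_real (dP2r y)"
    by (simp add: sums_iff diffs_def)
  ultimately show "(P2 has_field_derivative of_real (dP2r y)) (at (of_real y))" by simp
qed

lemma eta_of_real:
  "eta1 (of_real x) (of_real y) = of_real (eta1 x y)"
  "eta2 (of_real x) (of_real y) = of_real (eta2 x y)"
  "eta0 (of_real x) (of_real y) = of_real (eta0 x y)"
  "w (of_real x) = of_real (w x)"
  by (simp_all add: eta1_def eta2_def eta0_def w_def)

lemma numer_of_real: "0 < y \<Longrightarrow> y \<le> Yt \<Longrightarrow> numer (of_real x) (of_real y) = of_real (NR x y)"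
proof -
  assume y: "0 < y" "y \<le> Yt"
  obtain \<rho> where r: "\<rho> > Yt" "gsum 1 \<rho>" using col_radius by blast
  have "P2 (of_real y) = of_real (P2r y)" by (rule P2r_facts(1)[OF r(2)]) (use y r in auto)
  then show ?thesis by (simp add: numer_def NR_def eta_of_real)
qed

lemma Yc_of_real:
  assumes "w x \<ge> 2 * sg"
  shows "Yc (of_real x) = of_real (y0 x)" "Yd (of_real x) = of_real (y1 x)"
proof -
  have "csqrt (of_real (w x) + of_real (2 * sg)) * csqrt (of_real (w x) - of_real (2 * sg))
    = of_real (sqrt (w x + 2 * sg) * sqrt (w x - 2 * sg))"
    using assms sg_Yt(1) by (simp flip: of_real_add of_real_diff add: csqrt_of_real_nonneg)
  also have "sqrt (w x + 2 * sg) * sqrt (w x - 2 * sg) = sqrt ((w x)\<^sup>2 - 4 * l2 * m2)"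
    unfolding real_sqrt_mult[symmetric] using sg_Yt(5) by (simp add: power2_eq_square algebra_simps)
  finally show "Yc (of_real x) = of_real (y0 x)" "Yd (of_real x) = of_real (y1 x)"
    by (simp_all add: Yc_def Yd_def y0_def y1_def eta_of_real)
qed

text \<open>The product of \<open>eta1\<close> over both kernel roots is symmetric in them and hence
  rational in \<open>x\<close>. It converts division by \<open>eta1 x (Yc x)\<close> into division
  by the explicit factors of \<open>(x - 1) * gq x\<close>.\<close>

lemma eta1_prod:
  assumes "x \<noteq> 0"
  shows "(eta1 x (Yc x) * x) * (eta1 x (Yd x) * x) = of_real m2 * (x - 1) * gq x"
proof -
  define c where "c = of_real l1 * (x - 1) - of_real l2 + of_real k1 * (1 / x - 1)"
  define q where "q = of_real (1 - r1) * x + of_real r1"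
  have e: "eta1 x y = of_real l2 * y + c" for y by (simp add: eta1_def c_def algebra_simps)
  have cx: "c * x = of_real l1 * x\<^sup>2 - of_real (l1 + l2 + k1) * x + of_real k1"
    using assms by (simp add: c_def field_simps power2_eq_square)
  have wx: "w x * x = of_real (l1 + l2 + m1 + m2) * x - of_real l1 * x\<^sup>2 - of_real m1"
    using assms by (simp add: w_def field_simps power2_eq_square)
  have cw: "(c + w x) * x = of_real m2 * q"
    unfolding distrib_right cx wx by (simp add: q_def k1_def algebra_simps)
  have "eta1 x (Yc x) * eta1 x (Yd x) = (of_real l2)\<^sup>2 * (Yc x * Yd x) + of_real l2 * c * (Yc x + Yd x) + c\<^sup>2"
    unfolding e by (simp add: power2_eq_square algebra_simps)
  also have "\<dots> = of_real (l2 * m2) + c * (c + w x)"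
    unfolding Yc_Yd using pos by (simp add: power2_eq_square field_simps)
  finally have "(eta1 x (Yc x) * x) * (eta1 x (Yd x) * x) = of_real (l2 * m2) * x\<^sup>2 + (c * x) * ((c + w x) * x)"
    by (simp add: power2_eq_square algebra_simps)
  also have "\<dots> = of_real m2 * (of_real l2 * x\<^sup>2 + (c * x) * q)" unfolding cw by (simp add: algebra_simps)
  also have "of_real l2 * x\<^sup>2 + (c * x) * q = (x - 1) * gq x"
    unfolding cx by (simp add: q_def gq_def power2_eq_square algebra_simps)
  finally show ?thesis by (simp add: mult.assoc)
qed

text \<open>Multiplying through by the factor of the other root, as in \<open>eta1_prod\<close>,
  leaves a simple pole at \<open>xp\<close> times a function \<open>H\<close> holomorphic there. The
  substitution \<open>X\<close> turns the pole into the power -2 of \<open>csqrt (1 - z)\<close>, so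
  the general transfer applies with \<open>e = - 2\<close>.\<close>

theorem row_limit_pole:
  assumes "yp < Yt"
  shows "(\<lambda>m. p (Suc m) 0 * xp ^ m) \<longlonglongrightarrow>
    NR xp yp * (l2 * (y1 xp - y0 xp)) / (m2 * (xp - 1) * (l1 * (1 - r1)) * (xp - xm))"
    and "y0 xp = yp" "w xp > 2 * sg"
proof -
  have R: "R = xp" using assms by (simp add: R_def)
  have lt: "xp < xr" using xp_le_xr yp_Yt_iff assms by fastforce
  show wx: "w xp > 2 * sg" using w_gt lt xp_gt_1 xl_xr by simp
  have yp0: "yp > 0" using yp_gt_1 by simp
  show y0p: "y0 xp = yp"
    using ker_factor[of xp yp] ker_xp_yp wx yp0 y01_sum_prod(5)[of xp] assms pos by auto
  define X where "X = (\<lambda>t::complex. of_real xp * (1 - t\<^sup>2))"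
  define H where "H = (\<lambda>x. numer x (Yc x) * x * eta1 x (Yd x) / (of_real (m2 * (l1 * (1 - r1)) * xp) * (x - 1) * (x - of_real xm)))"
  define U where "U = Dom - {1, of_real xm}"
  have oU: "open U" unfolding U_def using open_Dom by (intro open_Diff) auto
  have U0: "of_real xp \<in> U"
    using in_Dom[of "of_real xp"] lt xp_gt_1 xl_xr xm_less by (auto simp: U_def)
  have "open (X -` U)" unfolding X_def by (intro open_vimage oU continuous_intros)
  moreover have "0 \<in> X -` U" using U0 by (simp add: X_def)
  ultimately obtain d where d: "d > 0" "ball 0 d \<subseteq> X -` U" using open_contains_ball by blast
  obtain \<rho> where r: "\<rho> > Yt" "P2 holomorphic_on ball 0 \<rho>" using P2_holomorphic by blast
  have HU: "H holomorphic_on U"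
  proof -
    have D: "x \<in> Dom" "x \<noteq> 0" if "x \<in> U" for x using that by (auto simp: U_def Dom_def)
    have Y: "Yc holomorphic_on U" "Yd holomorphic_on U"
      using Yc_holomorphic Yd_holomorphic by (auto simp: U_def intro: holomorphic_on_subset)
    have b: "cmod (Yc x) < \<rho>" if "x \<in> U" for x using Yc_bound[OF D(1)[OF that]] r(1) by simp
    have 1: "(\<lambda>x. numer x (Yc x)) holomorphic_on U"
      by (rule numer_holomorphic[OF holomorphic_on_ident Y(1) D(2) Yc_nz(1) r(2) b])
    have 2: "(\<lambda>x. eta1 x (Yd x)) holomorphic_on U"
      by (rule eta_holomorphic(1)[OF holomorphic_on_ident Y(2) D(2) Yc_nz(2)])
    have "m2 * (l1 * (1 - r1)) * xp \<noteq> 0" using pos xp_gt_1 by simp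
    then have 3: "of_real (m2 * (l1 * (1 - r1)) * xp) * (x - 1) * (x - of_real xm) \<noteq> 0" if "x \<in> U" for x
      using that by (simp add: U_def)
    show ?thesis unfolding H_def
      by (intro holomorphic_on_divide holomorphic_on_mult 1 2 3 holomorphic_on_ident
          holomorphic_on_const holomorphic_on_diff)
  qed
  have XB: "X holomorphic_on ball 0 d" unfolding X_def by (intro holomorphic_intros)
  have "(H \<circ> X) holomorphic_on ball 0 d"
    by (rule holomorphic_on_compose_gen[OF XB HU]) (use d in auto)
  then have G: "(\<lambda>t. H (X t)) holomorphic_on ball 0 d" by (simp add: o_def)
  have near: "ext (of_real R * z) = 0 + csqrt (1 - z) powi (- 2) * H (X (csqrt (1 - z)))"
    if z: "cmod z < 1" "cmod (1 - z) < d ^ 2" "1 < cmod (of_real R * z)" for z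
  proof -
    define x where "x = of_real R * z"
    have Xx: "X (csqrt (1 - z)) = x" by (simp add: X_def x_def R)
    have xR: "cmod x < R" "1 < cmod x" using z R_bounds by (auto simp: x_def norm_mult)
    have nz: "x \<noteq> 0" "x \<noteq> 1" "1 - z \<noteq> 0" using xR z by auto
    have "cmod (csqrt (1 - z)) ^ 2 < d ^ 2" using z(2) by (simp only: norm_csqrt_sq)
    then have "cmod (csqrt (1 - z)) < d" by (rule power_less_imp_less_base) (use d in simp)
    then have "csqrt (1 - z) \<in> ball 0 d" by (simp only: mem_ball dist_0_norm)
    then have "X (csqrt (1 - z)) \<in> U" using d(2) by (metis subsetD vimageD)
    then have xm: "x - of_real xm \<noteq> 0" by (simp add: Xx U_def)
    define A where "A = complex_of_real (l1 * (1 - r1))"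
    define B where "B = complex_of_real m2"
    have AB: "A \<noteq> 0" "B \<noteq> 0" using pos by (auto simp: A_def B_def)
    have xp0: "complex_of_real xp \<noteq> 0" using xp_gt_1 by simp
    have "x - of_real xp = - of_real xp * (1 - z)" by (simp add: x_def R algebra_simps)
    then have pr: "(eta1 x (Yc x) * x) * (eta1 x (Yd x) * x) = - (B * (x - 1) * (A * (of_real xp * (1 - z)) * (x - of_real xm)))"
      using eta1_prod[OF nz(1)] by (simp add: gq_factor A_def B_def mult_ac)
    define u where "u = eta1 x (Yc x) * x"
    define v where "v = eta1 x (Yd x) * x"
    have u: "u \<noteq> 0" using annulus_Dom(2)[OF xR(2,1)] nz by (simp add: u_def)
    define W where "W = B * (x - 1) * (A * of_real xp) * (x - of_real xm)"
    have W: "W \<noteq> 0" using AB nz xm xp0 by (simp add: W_def)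
    have uv: "u * v = - (W * (1 - z))" using pr by (simp add: u_def v_def W_def mult_ac)
    have "- (1 / u) = v / (W * (1 - z))"
    proof -
      have "v = - (W * (1 - z)) / u" using uv u by (metis nonzero_mult_div_cancel_left)
      then show ?thesis using W nz(3) u by (simp add: divide_simps)
    qed
    then have "- (numer x (Yc x) / u) = numer x (Yc x) * v / W / (1 - z)"
      by (metis (no_types, opaque_lifting) divide_divide_eq_left minus_divide_left mult.right_neutral times_divide_eq_right mult_minus_right)
    moreover have "H x = numer x (Yc x) * v / W" by (simp add: H_def v_def W_def A_def B_def mult_ac)
    moreover have "csqrt (1 - z) powi (- 2) = 1 / (1 - z)"
      by (simp add: power_int_minus divide_inverse)
    ultimately show ?thesis unfolding Xx by (simp add: ext_def x_def[symmetric] u_def[symmetric])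
  qed
  have lim: "(\<lambda>m. complex_of_real (p (Suc m) 0 * R ^ m * real m powr (real_of_int (- 2) / 2 + 1)))
     \<longlonglongrightarrow> H (X 0) * rGamma (- (of_int (- 2) / 2))"
    by (rule row_asymptotics[OF G d(1) near]) auto
  have ep: "eta1 xp yp = 0" using eta1_yc[of xp yp] ker_xp_yp xp_gt_1 by (simp add: yp_def)
  have e1: "eta1 xp (y1 xp) = l2 * (y1 xp - y0 xp)"
    using ep y0p by (simp add: eta1_def algebra_simps)
  have wx': "w xp \<ge> 2 * sg" using wx by simp
  have "H (X 0) = of_real (NR xp yp * xp * (l2 * (y1 xp - y0 xp)) / (m2 * (l1 * (1 - r1)) * xp * (xp - 1) * (xp - xm)))"
    using numer_of_real[of yp xp] yp0 assms
    by (simp add: H_def X_def Yc_of_real[OF wx'] y0p[symmetric] eta_of_real e1)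
  also have "NR xp yp * xp * (l2 * (y1 xp - y0 xp)) / (m2 * (l1 * (1 - r1)) * xp * (xp - 1) * (xp - xm))
     = NR xp yp * (l2 * (y1 xp - y0 xp)) / (m2 * (xp - 1) * (l1 * (1 - r1)) * (xp - xm))"
    using xp_gt_1 by simp
  finally have HX: "H (X 0) = of_real (NR xp yp * (l2 * (y1 xp - y0 xp)) / (m2 * (xp - 1) * (l1 * (1 - r1)) * (xp - xm)))" .
  have "(\<lambda>m. p (Suc m) 0 * R ^ m * real m powr (real_of_int (- 2) / 2 + 1)) \<longlonglongrightarrow>
     NR xp yp * (l2 * (y1 xp - y0 xp)) / (m2 * (xp - 1) * (l1 * (1 - r1)) * (xp - xm))"
    by (rule tendsto_of_real_limitD[OF lim]) (simp add: HX rGamma_inverse_Gamma)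
  moreover have "eventually (\<lambda>m. p (Suc m) 0 * R ^ m * real m powr (real_of_int (- 2) / 2 + 1) = p (Suc m) 0 * xp ^ m) sequentially"
    using eventually_gt_at_top[of 0] by eventually_elim (simp add: R)
  ultimately show "(\<lambda>m. p (Suc m) 0 * xp ^ m) \<longlonglongrightarrow>
    NR xp yp * (l2 * (y1 xp - y0 xp)) / (m2 * (xp - 1) * (l1 * (1 - r1)) * (xp - xm))"
    by (rule Lim_transform_eventually)
qed

text \<open>Slope at the branch point: the lower root is Yt - kap t + O(t^2) with t = sqrt(1 - x /
  xr). For the queue \<open>kap\<close> is -q(x_3).\<close>

definition kap :: real where "kap = sqrt sg * sqrt (l1 * (xr - xl)) / l2"

lemma kap_pos: "kap > 0"
  using pos xl_xr sg_Yt by (simp add: kap_def)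

definition Xt :: "complex \<Rightarrow> complex" where "Xt t = of_real xr * (1 - t\<^sup>2)"

lemma Xt_facts: "Xt 0 = of_real xr" "(Xt has_field_derivative 0) (at 0)" "Xt holomorphic_on A" "isCont Xt t"
  by (auto simp: Xt_def[abs_def] intro!: derivative_eq_intros holomorphic_intros)

text \<open>Near the branch point \<open>xr\<close> the kernel root is analytic in \<open>t = sqrt (1 - x / xr)\<close>.\<close>

lemma branch_point_chart:
  assumes "\<rho> > Yt"
  obtains d Yh where "d > 0" "Yh holomorphic_on ball 0 d" "Yh 0 = of_real Yt"
    "(Yh has_field_derivative - of_real kap) (at 0)"
    "\<And>t. t \<in> ball 0 d \<Longrightarrow> Xt t \<noteq> 0" "\<And>t. t \<in> ball 0 d \<Longrightarrow> Yh t \<noteq> 0"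
    "\<And>t. t \<in> ball 0 d \<Longrightarrow> cmod (Yh t) < \<rho>"
    "\<And>z. cmod z < 1 \<Longrightarrow> cmod (1 - z) < d ^ 2 \<Longrightarrow> Yc (of_real xr * z) = Yh (csqrt (1 - z))"
proof -
  define u where "u = (\<lambda>t. w (Xt t) + of_real (2 * sg))"
  \<comment> \<open>\<open>w (Xt t) - of_real (2 * sg)\<close> equals \<open>t\<^sup>2 * v t\<close>
    with \<open>v 0\<close> positive. Its principal root is therefore \<open>t * csqrt (v t)\<close>
    for the relevant \<open>t\<close>, which removes the square root singularity.\<close>
  define v where "v = (\<lambda>t. of_real (l1 * xr) * (Xt t - of_real xl) / Xt t)"
  define Yh where "Yh = (\<lambda>t. (w (Xt t) - t * (csqrt (u t) * csqrt (v t))) / of_real (2 * l2))"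
  have xr0: "complex_of_real xr \<noteq> 0" using xl_xr by simp
  have u0: "u 0 = of_real (4 * sg)" by (simp add: u_def Xt_facts eta_of_real w_xr)
  have v0: "v 0 = of_real (l1 * (xr - xl))" using xl_xr by (simp add: v_def Xt_facts field_simps)
  have cX: "isCont Xt 0" by (rule Xt_facts)
  have cu: "isCont u 0" unfolding u_def w_def by (intro continuous_intros cX) (use xr0 in \<open>simp add: Xt_facts\<close>)
  have cv: "isCont v 0" unfolding v_def by (intro continuous_intros cX) (use xr0 in \<open>simp add: Xt_facts\<close>)
  have "eventually (\<lambda>t. Xt t \<noteq> 0 \<and> Re (u t) > 0 \<and> Re (v t) > 0) (nhds 0)"
    by (intro eventually_conj eventually_ne[OF cX] eventually_Re_pos[OF cu] eventually_Re_pos[OF cv])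
       (use xr0 u0 v0 sg_Yt pos xl_xr in \<open>auto simp: Xt_facts\<close>)
  then obtain d1 where d1: "d1 > 0" "\<And>t. dist t 0 < d1 \<Longrightarrow> Xt t \<noteq> 0 \<and> Re (u t) > 0 \<and> Re (v t) > 0"
    unfolding eventually_nhds_metric by blast
  have P: "Xt t \<noteq> 0" "Re (u t) > 0" "Re (v t) > 0" if "t \<in> ball 0 d1" for t
    using d1(2)[of t] that by (auto simp: dist_commute)
  have hwX: "(\<lambda>t. w (Xt t)) holomorphic_on ball 0 d1" unfolding w_def
    by (intro holomorphic_intros Xt_facts P)
  have hu: "u holomorphic_on ball 0 d1" unfolding u_def by (intro holomorphic_intros hwX)
  have hv: "v holomorphic_on ball 0 d1" unfolding v_def by (intro holomorphic_intros Xt_facts P)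
  have hp: "(\<lambda>t. csqrt (u t) * csqrt (v t)) holomorphic_on ball 0 d1"
    by (intro holomorphic_intros hu hv) (use P Re_pos_notin in blast)+
  have hY: "Yh holomorphic_on ball 0 d1" unfolding Yh_def
    by (intro holomorphic_intros hwX hp) (use pos in simp)
  have Y0: "Yh 0 = of_real Yt"
    using pos by (simp add: Yh_def Xt_facts eta_of_real w_xr sg_Yt(4))
  have dwX: "((\<lambda>t. w (Xt t)) has_field_derivative 0) (at 0)"
    unfolding w_def using xr0 by (auto intro!: derivative_eq_intros Xt_facts simp: Xt_facts(1))
  have dp: "((\<lambda>t. csqrt (u t) * csqrt (v t)) has_field_derivative deriv (\<lambda>t. csqrt (u t) * csqrt (v t)) 0) (at 0)"
    by (rule holomorphic_derivI[OF hp]) (use d1 in auto)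
  have "(Yh has_field_derivative (0 - (1 * (csqrt (u 0) * csqrt (v 0)) + deriv (\<lambda>t. csqrt (u t) * csqrt (v t)) 0 * 0)) / of_real (2 * l2)) (at 0)"
    unfolding Yh_def by (intro DERIV_cdivide DERIV_diff dwX DERIV_mult DERIV_ident dp)
  moreover have "(0 - (1 * (csqrt (u 0) * csqrt (v 0)) + deriv (\<lambda>t. csqrt (u t) * csqrt (v t)) 0 * 0)) / of_real (2 * l2) = - of_real kap"
  proof -
    have "csqrt (u 0) = of_real (2 * sqrt sg)" "csqrt (v 0) = of_real (sqrt (l1 * (xr - xl)))"
      unfolding u0 v0 using sg_Yt(1) pos xl_xr by (auto simp add: csqrt_of_real_nonneg real_sqrt_mult simp del: of_real_mult)
    then have "- (csqrt (u 0) * csqrt (v 0)) / of_real (2 * l2) = of_real (- (2 * sqrt sg * sqrt (l1 * (xr - xl))) / (2 * l2))"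
      by (simp only: of_real_mult of_real_divide of_real_minus)
    also have "- (2 * sqrt sg * sqrt (l1 * (xr - xl))) / (2 * l2) = - kap" using pos by (simp add: kap_def)
    finally show ?thesis by simp
  qed
  ultimately have dY: "(Yh has_field_derivative - of_real kap) (at 0)" by simp
  then have cY: "isCont Yh 0" by (rule DERIV_isCont)
  have "eventually (\<lambda>t. Yh t \<noteq> 0 \<and> Re (of_real \<rho> - of_real (cmod (Yh t))) > 0) (nhds 0)"
  proof (intro eventually_conj eventually_ne[OF cY])
    have "isCont (\<lambda>t. complex_of_real \<rho> - of_real (cmod (Yh t))) 0" by (intro continuous_intros cY)
    then show "eventually (\<lambda>t. Re (of_real \<rho> - of_real (cmod (Yh t))) > 0) (nhds 0)"
      by (rule eventually_Re_pos) (use assms sg_Yt in \<open>simp add: Y0\<close>)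
  qed (use sg_Yt in \<open>simp add: Y0\<close>)
  then obtain d2 where d2: "d2 > 0" "\<And>t. dist t 0 < d2 \<Longrightarrow> Yh t \<noteq> 0 \<and> Re (of_real \<rho> - of_real (cmod (Yh t))) > 0"
    unfolding eventually_nhds_metric by blast
  define d where "d = min d1 d2"
  have d: "d > 0" "d \<le> d1" "d \<le> d2" using d1 d2 by (auto simp: d_def)
  show thesis
  proof (rule that[of d Yh])
    show "Yh holomorphic_on ball 0 d" by (rule holomorphic_on_subset[OF hY]) (use d in auto)
    show "Xt t \<noteq> 0" if "t \<in> ball 0 d" for t using P(1) that d by auto
    show "Yh t \<noteq> 0" "cmod (Yh t) < \<rho>" if "t \<in> ball 0 d" for t
      using d2(2)[of t] that d by (auto simp: dist_commute)
    fix z :: complex assume z: "cmod z < 1" "cmod (1 - z) < d ^ 2"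
    define t where "t = csqrt (1 - z)"
    have "cmod t ^ 2 < d ^ 2" using z(2) unfolding t_def by (simp only: norm_csqrt_sq)
    then have "cmod t < d" by (rule power_less_imp_less_base) (use d in simp)
    then have tb: "t \<in> ball 0 d1" using d by simp
    have t2: "t\<^sup>2 = 1 - z" by (simp add: t_def)
    have X: "Xt t = of_real xr * z" by (simp add: Xt_def t2)
    have Re1: "Re (1 - z) > 0" using z(1) complex_Re_le_cmod[of z] by simp
    have "w (Xt t) - of_real (2 * sg) = (1 - z) * v t"
      unfolding w_minus_sg[OF P(1)[OF tb]] by (simp add: v_def X algebra_simps)
    then have "csqrt (w (Xt t) - of_real (2 * sg)) = t * csqrt (v t)"
      using csqrt_mult_Re_pos[OF Re1 P(3)[OF tb]] by (simp add: t_def)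
    then show "Yc (of_real xr * z) = Yh (csqrt (1 - z))"
      unfolding X[symmetric] t_def[symmetric] by (simp add: Yc_def Yh_def u_def mult_ac)
  qed (use d Y0 dY in auto)
qed

definition dNR :: real where
  "dNR = (l2 - k2 / Yt\<^sup>2) * Yt * P2r Yt + eta2 xr Yt * P2r Yt + eta2 xr Yt * Yt * dP2r Yt + l2 * p 0 0"

lemma NR_deriv: "((\<lambda>y. NR xr y) has_field_derivative dNR) (at Yt)"
proof -
  obtain \<rho> where r: "\<rho> > Yt" "gsum 1 \<rho>" using col_radius by blast
  note P = P2r_facts(5)[OF r(2) sg_Yt(2) r(1)]
  have e2: "((\<lambda>y. eta2 xr y) has_field_derivative (l2 - k2 / Yt\<^sup>2)) (at Yt)"
    unfolding eta2_def using sg_Yt(2)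
    by (auto intro!: derivative_eq_intros simp: field_simps power2_eq_square)
  have e0: "((\<lambda>y. eta0 xr y) has_field_derivative l2) (at Yt)"
    unfolding eta0_def by (auto intro!: derivative_eq_intros)
  have "((\<lambda>y. eta2 xr y * y * P2r y + eta0 xr y * p 0 0) has_field_derivative
     (((l2 - k2 / Yt\<^sup>2) * Yt + 1 * eta2 xr Yt) * P2r Yt + dP2r Yt * (eta2 xr Yt * Yt) + l2 * p 0 0)) (at Yt)"
    by (intro DERIV_add DERIV_mult DERIV_cmult_right e2 e0 P DERIV_ident)
  moreover have "(((l2 - k2 / Yt\<^sup>2) * Yt + 1 * eta2 xr Yt) * P2r Yt + dP2r Yt * (eta2 xr Yt * Yt) + l2 * p 0 0) = dNR"
    unfolding dNR_def by (simp only: algebra_simps mult_1)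
  ultimately show ?thesis unfolding NR_def by simp
qed

text \<open>\<open>Xt\<close> has derivative 0 at 0, so only the partial derivative in
  \<open>y\<close> contributes.\<close>

lemma numer_chart_deriv:
  assumes "(Yh has_field_derivative D) (at 0)" "Yh 0 = of_real Yt"
  shows "((\<lambda>t. numer (Xt t) (Yh t)) has_field_derivative of_real dNR * D) (at 0)"
    "((\<lambda>t. eta1 (Xt t) (Yh t)) has_field_derivative of_real l2 * D) (at 0)"
proof -
  obtain \<rho> where r: "\<rho> > Yt" "gsum 1 \<rho>" using col_radius by blast
  note P = P2r_facts(4)[OF r(2) sg_Yt(2) r(1)] and P1 = P2r_facts(1)[OF r(2) sg_Yt(2) r(1)]
  have xr0: "complex_of_real xr \<noteq> 0" using xl_xr by simp
  have Yt0: "complex_of_real Yt \<noteq> 0" using sg_Yt by simp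
  have dP: "((\<lambda>t. P2 (Yh t)) has_field_derivative of_real (dP2r Yt) * D) (at 0)"
    by (rule DERIV_chain2[OF _ assms(1)]) (use P in \<open>simp add: assms(2)\<close>)
  have e2: "((\<lambda>t. eta2 (Xt t) (Yh t)) has_field_derivative of_real (l2 - k2 / Yt\<^sup>2) * D) (at 0)"
    unfolding eta2_def using Yt0
    by (auto intro!: derivative_eq_intros Xt_facts assms(1) simp: assms(2) Xt_facts(1) field_simps power2_eq_square)
  have e0: "((\<lambda>t. eta0 (Xt t) (Yh t)) has_field_derivative of_real l2 * D) (at 0)"
    unfolding eta0_def
    by (auto intro!: derivative_eq_intros Xt_facts assms(1))
  show "((\<lambda>t. eta1 (Xt t) (Yh t)) has_field_derivative of_real l2 * D) (at 0)"
    unfolding eta1_def using xr0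
    by (auto intro!: derivative_eq_intros Xt_facts assms(1) simp: Xt_facts(1))
  have "((\<lambda>t. eta2 (Xt t) (Yh t) * Yh t * P2 (Yh t) + eta0 (Xt t) (Yh t) * of_real (p 0 0)) has_field_derivative
     ((of_real (l2 - k2 / Yt\<^sup>2) * D * Yh 0 + D * eta2 (Xt 0) (Yh 0)) * P2 (Yh 0) + of_real (dP2r Yt) * D * (eta2 (Xt 0) (Yh 0) * Yh 0)
      + of_real l2 * D * of_real (p 0 0))) (at 0)"
    by (intro DERIV_add DERIV_mult DERIV_cmult_right e2 e0 dP assms(1))
  moreover have "((of_real (l2 - k2 / Yt\<^sup>2) * D * Yh 0 + D * eta2 (Xt 0) (Yh 0)) * P2 (Yh 0) + of_real (dP2r Yt) * D * (eta2 (Xt 0) (Yh 0) * Yh 0)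
      + of_real l2 * D * of_real (p 0 0)) = of_real dNR * D"
    unfolding assms(2) Xt_facts(1) eta_of_real P1 dNR_def of_real_add of_real_mult by (simp only: algebra_simps)
  ultimately show "((\<lambda>t. numer (Xt t) (Yh t)) has_field_derivative of_real dNR * D) (at 0)"
    unfolding numer_def by simp
qed

text \<open>\<open>eta1\<close> vanishes at \<open>(xr, Yt)\<close>, but only to first order in
  \<open>t\<close>, since its derivative there is \<open>- l2 * kap\<close>. Hence
  \<open>ext\<close> behaves like the power -1 of \<open>csqrt (1 - z)\<close>, halfway between a
  simple pole and a bounded branch point.\<close>

theorem row_limit_branch_pole:
  assumes "yp = Yt"
  shows "(\<lambda>m. p (Suc m) 0 * xr ^ m * real m powr (1 / 2)) \<longlonglongrightarrow> NR xr Yt / (xr * l2 * kap) / sqrt pi"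
    and "xp = xr"
proof -
  show xpr: "xp = xr" using yp_Yt_iff assms by simp
  have R: "R = xr" using assms by (simp add: R_def)
  obtain \<rho> where r: "\<rho> > Yt" "P2 holomorphic_on ball 0 \<rho>" using P2_holomorphic by blast
  obtain d Yh where Y: "d > 0" "Yh holomorphic_on ball 0 d" "Yh 0 = of_real Yt"
    "(Yh has_field_derivative - of_real kap) (at 0)"
    "\<And>t. t \<in> ball 0 d \<Longrightarrow> Xt t \<noteq> 0" "\<And>t. t \<in> ball 0 d \<Longrightarrow> Yh t \<noteq> 0"
    "\<And>t. t \<in> ball 0 d \<Longrightarrow> cmod (Yh t) < \<rho>"
    "\<And>z. cmod z < 1 \<Longrightarrow> cmod (1 - z) < d ^ 2 \<Longrightarrow> Yc (of_real xr * z) = Yh (csqrt (1 - z))"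
    using branch_point_chart[OF r(1)] by blast
  have hE: "(\<lambda>t. eta1 (Xt t) (Yh t)) holomorphic_on ball 0 d"
    by (rule eta_holomorphic(1)[OF Xt_facts(3) Y(2) Y(5) Y(6)])
  obtain h where h: "h holomorphic_on ball 0 d" "\<And>t. eta1 (Xt t) (Yh t) = eta1 (Xt 0) (Yh 0) + t * h t"
      "h 0 = of_real l2 * (- of_real kap)"
    using holomorphic_factor_deriv[OF hE Y(1) numer_chart_deriv(2)[OF Y(4,3)]] by blast
  have "eta1 xr Yt = 0" using eta1_yc[of xr Yt] ker_xp_yp xl_xr assms xpr by (simp add: yp_def)
  then have e0: "eta1 (Xt 0) (Yh 0) = 0" by (simp add: Xt_facts Y(3) eta_of_real)
  have h0: "h 0 \<noteq> 0" using h(3) kap_pos pos by simp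
  have "isCont h 0"
    using h(1) Y(1) by (auto simp: continuous_on_eq_continuous_at dest!: holomorphic_on_imp_continuous_on)
  from eventually_ne[OF this h0] obtain d1 where d1: "d1 > 0" "\<And>t. dist t 0 < d1 \<Longrightarrow> h t \<noteq> 0"
    unfolding eventually_nhds_metric by blast
  define d' where "d' = min d d1"
  have d': "d' > 0" "d' \<le> d" using d1 Y(1) by (auto simp: d'_def)
  have sub: "ball (0::complex) d' \<subseteq> ball 0 d" using d' by auto
  have hn: "h t \<noteq> 0" if "t \<in> ball 0 d'" for t using d1(2)[of t] that by (auto simp: d'_def dist_commute)
  define G where "G = (\<lambda>t. - (numer (Xt t) (Yh t) / (h t * Xt t)))"
  have Yh': "Yh holomorphic_on ball 0 d'" using Y(2) sub by (rule holomorphic_on_subset)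
  have n': "(\<lambda>t. numer (Xt t) (Yh t)) holomorphic_on ball 0 d'"
    by (rule numer_holomorphic[OF Xt_facts(3) Yh' _ _ r(2)]) (use Y sub in blast)+
  have hG: "G holomorphic_on ball 0 d'"
    unfolding G_def
    by (intro holomorphic_on_minus holomorphic_on_divide holomorphic_on_mult n' Xt_facts(3)
        holomorphic_on_subset[OF h(1) sub]) (use hn Y(5) sub in \<open>auto simp: subset_iff\<close>)
  have near: "ext (of_real R * z) = 0 + csqrt (1 - z) powi (- 1) * G (csqrt (1 - z))"
    if z: "cmod z < 1" "cmod (1 - z) < d' ^ 2" "1 < cmod (of_real R * z)" for z
  proof -
    have "d' ^ 2 \<le> d ^ 2" using d' by (intro power_mono) auto
    then have Yz: "Yc (of_real xr * z) = Yh (csqrt (1 - z))" using Y(8) z by simp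
    have Xz: "Xt (csqrt (1 - z)) = of_real xr * z" by (simp add: Xt_def)
    have "eta1 (of_real xr * z) (Yh (csqrt (1 - z))) = csqrt (1 - z) * h (csqrt (1 - z))"
      using h(2)[of "csqrt (1 - z)"] e0 by (simp only: Xz) simp
    then show ?thesis unfolding ext_def R Yz G_def Xz
      by (simp add: power_int_minus divide_inverse inverse_mult_distrib mult_ac)
  qed
  have lim: "(\<lambda>m. complex_of_real (p (Suc m) 0 * R ^ m * real m powr (real_of_int (- 1) / 2 + 1)))
     \<longlonglongrightarrow> G 0 * rGamma (- (of_int (- 1) / 2))"
    by (rule row_asymptotics[OF hG d'(1) near]) auto
  have G0: "G 0 = of_real (NR xr Yt / (xr * l2 * kap))"
    using numer_of_real[of Yt xr] sg_Yt by (simp add: G_def Xt_facts(1) Y(3) h(3) mult_ac)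
  have "(\<lambda>m. p (Suc m) 0 * R ^ m * real m powr (real_of_int (- 1) / 2 + 1)) \<longlonglongrightarrow> NR xr Yt / (xr * l2 * kap) * (1 / sqrt pi)"
    by (rule tendsto_of_real_limitD[OF lim]) (simp add: G0 rGamma_half)
  then show "(\<lambda>m. p (Suc m) 0 * xr ^ m * real m powr (1 / 2)) \<longlonglongrightarrow> NR xr Yt / (xr * l2 * kap) / sqrt pi"
    by (simp add: R)
qed

text \<open>\<open>eta1\<close> does not vanish at \<open>(xr, Yt)\<close>, so \<open>ext\<close> is
  analytic in \<open>t\<close>. Its value at 0 is the constant discarded by the transfer; the first
  singular term is linear, with slope \<open>- kap\<close> times the \<open>y\<close> derivative of
  -N / h_1. The minus sign cancels against the negative value of \<open>rGamma\<close> at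
  -1/2.\<close>

theorem row_limit_branch:
  assumes "Yt < yp"
  shows "eta1 xr Yt < 0"
    and "((\<lambda>y. - (NR xr y / (xr * eta1 xr y))) has_field_derivative (- (dNR * eta1 xr Yt - NR xr Yt * l2) / (xr * (eta1 xr Yt)\<^sup>2))) (at Yt)"
    and "(\<lambda>m. p (Suc m) 0 * xr ^ m * real m powr (3 / 2)) \<longlonglongrightarrow>
      kap * (- (dNR * eta1 xr Yt - NR xr Yt * l2) / (xr * (eta1 xr Yt)\<^sup>2)) / (2 * sqrt pi)"
proof -
  have R: "R = xr" using assms by (simp add: R_def)
  define eta where "eta = eta1 xr Yt"
  have "yp \<le> yc xr" unfolding yp_def using xp_gt_1 xp_le_xr by (intro yc_mono) auto
  then have yc: "Yt < yc xr" using assms by simp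
  have "ker xr Yt = 0" using ker_y0[of xr] w_xr by (simp add: y0_xr)
  then have e: "eta = m2 * (1 / yc xr - 1 / Yt)" using eta1_yc[of xr Yt] xl_xr by (simp add: eta_def)
  have "1 / yc xr < 1 / Yt" using yc sg_Yt by (intro divide_strict_left_mono) auto
  then have eta: "eta < 0" unfolding e using pos by (intro mult_pos_neg) auto
  then show "eta1 xr Yt < 0" by (simp add: eta_def)
  define DD where "DD = - (dNR * eta - NR xr Yt * l2) / (xr * eta\<^sup>2)"
  have xr0: "xr > 0" using xl_xr by simp
  have "((\<lambda>y. xr * eta1 xr y) has_field_derivative (xr * l2)) (at Yt)"
    unfolding eta1_def by (auto intro!: derivative_eq_intros)
  then have "((\<lambda>y. - (NR xr y / (xr * eta1 xr y))) has_field_derivative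
     - ((dNR * (xr * eta) - NR xr Yt * (xr * l2)) / ((xr * eta) * (xr * eta)))) (at Yt)"
    unfolding eta_def using eta xr0 by (intro DERIV_minus DERIV_divide NR_deriv) (auto simp: eta_def)
  moreover have DDe: "- ((dNR * (xr * eta) - NR xr Yt * (xr * l2)) / ((xr * eta) * (xr * eta))) = DD"
    unfolding DD_def using eta xr0 by (simp add: divide_simps power2_eq_square) (simp add: algebra_simps)
  ultimately show "((\<lambda>y. - (NR xr y / (xr * eta1 xr y))) has_field_derivative (- (dNR * eta1 xr Yt - NR xr Yt * l2) / (xr * (eta1 xr Yt)\<^sup>2))) (at Yt)"
    unfolding DD_def eta_def by simp
  obtain \<rho> where r: "\<rho> > Yt" "P2 holomorphic_on ball 0 \<rho>" using P2_holomorphic by blast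
  obtain d Yh where Y: "d > 0" "Yh holomorphic_on ball 0 d" "Yh 0 = of_real Yt"
    "(Yh has_field_derivative - of_real kap) (at 0)"
    "\<And>t. t \<in> ball 0 d \<Longrightarrow> Xt t \<noteq> 0" "\<And>t. t \<in> ball 0 d \<Longrightarrow> Yh t \<noteq> 0"
    "\<And>t. t \<in> ball 0 d \<Longrightarrow> cmod (Yh t) < \<rho>"
    "\<And>z. cmod z < 1 \<Longrightarrow> cmod (1 - z) < d ^ 2 \<Longrightarrow> Yc (of_real xr * z) = Yh (csqrt (1 - z))"
    using branch_point_chart[OF r(1)] by blast
  have hE: "(\<lambda>t. eta1 (Xt t) (Yh t)) holomorphic_on ball 0 d"
    by (rule eta_holomorphic(1)[OF Xt_facts(3) Y(2) Y(5) Y(6)])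
  have e0: "eta1 (Xt 0) (Yh 0) = of_real eta" by (simp add: Xt_facts Y(3) eta_of_real eta_def)
  have "isCont (\<lambda>t. eta1 (Xt t) (Yh t)) 0"
    using DERIV_isCont[OF numer_chart_deriv(2)[OF Y(4,3)]] .
  from eventually_ne[OF this, of 0] e0 eta obtain d1 where d1: "d1 > 0" "\<And>t. dist t 0 < d1 \<Longrightarrow> eta1 (Xt t) (Yh t) \<noteq> 0"
    unfolding eventually_nhds_metric by auto
  define d' where "d' = min d d1"
  have d': "d' > 0" "d' \<le> d" using d1 Y(1) by (auto simp: d'_def)
  have sub: "ball (0::complex) d' \<subseteq> ball 0 d" using d' by auto
  have hn: "eta1 (Xt t) (Yh t) \<noteq> 0" if "t \<in> ball 0 d'" for t using d1(2)[of t] that by (auto simp: d'_def dist_commute)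
  define K where "K = (\<lambda>t. - (numer (Xt t) (Yh t) / (eta1 (Xt t) (Yh t) * Xt t)))"
  have Yh': "Yh holomorphic_on ball 0 d'" using Y(2) sub by (rule holomorphic_on_subset)
  have n': "(\<lambda>t. numer (Xt t) (Yh t)) holomorphic_on ball 0 d'"
    by (rule numer_holomorphic[OF Xt_facts(3) Yh' _ _ r(2)]) (use Y sub in blast)+
  have hK: "K holomorphic_on ball 0 d'"
    unfolding K_def
    by (intro holomorphic_on_minus holomorphic_on_divide holomorphic_on_mult n' Xt_facts(3)
        holomorphic_on_subset[OF hE sub]) (use hn Y(5) sub in \<open>auto simp: subset_iff\<close>)
  have NRc: "numer (Xt 0) (Yh 0) = of_real (NR xr Yt)"
    using numer_of_real[of Yt xr] sg_Yt by (simp add: Xt_facts(1) Y(3))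
  have "(K has_field_derivative - ((of_real dNR * (- of_real kap) * (eta1 (Xt 0) (Yh 0) * Xt 0)
      - numer (Xt 0) (Yh 0) * (of_real l2 * (- of_real kap) * Xt 0 + 0 * eta1 (Xt 0) (Yh 0)))
      / ((eta1 (Xt 0) (Yh 0) * Xt 0) * (eta1 (Xt 0) (Yh 0) * Xt 0)))) (at 0)"
    unfolding K_def using eta xr0
    by (intro DERIV_minus DERIV_divide DERIV_mult numer_chart_deriv[OF Y(4,3)] Xt_facts(2))
       (use e0 eta xr0 in \<open>auto simp: Xt_facts(1)\<close>)
  moreover have "- ((of_real dNR * (- of_real kap) * (eta1 (Xt 0) (Yh 0) * Xt 0)
      - numer (Xt 0) (Yh 0) * (of_real l2 * (- of_real kap) * Xt 0 + 0 * eta1 (Xt 0) (Yh 0)))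
      / ((eta1 (Xt 0) (Yh 0) * Xt 0) * (eta1 (Xt 0) (Yh 0) * Xt 0)))
     = of_real (- kap * - ((dNR * (xr * eta) - NR xr Yt * (xr * l2)) / ((xr * eta) * (xr * eta))))"
    unfolding Xt_facts(1) unfolding e0[unfolded Xt_facts(1)] NRc[unfolded Xt_facts(1)]
    by (simp add: algebra_simps flip: diff_divide_distrib)
  ultimately have dK: "(K has_field_derivative of_real (- kap * DD)) (at 0)" unfolding DDe by simp
  obtain k where k: "k holomorphic_on ball 0 d'" "\<And>t. K t = K 0 + t * k t" "k 0 = of_real (- kap * DD)"
    using holomorphic_factor_deriv[OF hK d'(1) dK] by blast
  have near: "ext (of_real R * z) = K 0 + csqrt (1 - z) powi 1 * k (csqrt (1 - z))"
    if z: "cmod z < 1" "cmod (1 - z) < d' ^ 2" "1 < cmod (of_real R * z)" for z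
  proof -
    have "d' ^ 2 \<le> d ^ 2" using d' by (intro power_mono) auto
    then have Yz: "Yc (of_real xr * z) = Yh (csqrt (1 - z))" using Y(8) z by simp
    have Xz: "Xt (csqrt (1 - z)) = of_real xr * z" by (simp add: Xt_def)
    have "ext (of_real R * z) = K (csqrt (1 - z))" unfolding ext_def R Yz K_def Xz ..
    then show ?thesis using k(2)[of "csqrt (1 - z)"] by simp
  qed
  have lim: "(\<lambda>m. complex_of_real (p (Suc m) 0 * R ^ m * real m powr (real_of_int 1 / 2 + 1)))
     \<longlonglongrightarrow> k 0 * rGamma (- (of_int 1 / 2))"
    by (rule row_asymptotics[OF k(1) d'(1) near]) auto
  have "(\<lambda>m. p (Suc m) 0 * R ^ m * real m powr (real_of_int 1 / 2 + 1)) \<longlonglongrightarrow> (- kap * DD) * (- 1 / (2 * sqrt pi))"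
  proof (rule tendsto_of_real_limitD[OF lim])
    have "rGamma (- (of_int 1 / 2) :: complex) = of_real (- 1 / (2 * sqrt pi))" using rGamma_minus_half by simp
    then show "k 0 * rGamma (- (of_int 1 / 2)) = of_real ((- kap * DD) * (- 1 / (2 * sqrt pi)))"
      unfolding k(3) by (simp only: of_real_mult)
  qed
  moreover have "(- kap * DD) * (- 1 / (2 * sqrt pi)) = kap * DD / (2 * sqrt pi)" by simp
  ultimately show "(\<lambda>m. p (Suc m) 0 * xr ^ m * real m powr (3 / 2)) \<longlonglongrightarrow>
      kap * (- (dNR * eta1 xr Yt - NR xr Yt * l2) / (xr * (eta1 xr Yt)\<^sup>2)) / (2 * sqrt pi)"
    by (simp add: R DD_def eta_def)
qed

section \<open>Nonvanishing of the constants and asymptotics along all rows\<close>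

text \<open>At a common zero of \<open>ker\<close> and \<open>eta1\<close> one has
  \<open>V = r1 * X\<close>, which makes \<open>eta2\<close> equal to
  \<open>m1 * (X * (1 - r1 * r2))\<close>. All contributions are then nonnegative, and that of the
  corner is positive.\<close>

lemma NR_pos:
  assumes "1 < x" "1 < y" "y \<le> Yt" "ker x y = 0" "eta1 x y = 0"
  shows "NR x y > 0"
proof -
  define X V where "X = 1 - 1 / x" and "V = 1 - 1 / y"
  have X: "X > 0" using assms by (simp add: X_def)
  have V: "V = r1 * X" using eta1_ker[of x y] assms pos by (simp add: X_def V_def)
  have "eta2 x y = m1 * (X - r2 * V)" using eta2_ker[of x y] assms by (simp add: X_def V_def)
  also have "\<dots> = m1 * (X * (1 - r1 * r2))" unfolding V by (simp add: algebra_simps)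
  also have "\<dots> > 0"
  proof -
    have "r1 * r2 < 1 * 1" using pos by (intro mult_strict_mono) auto
    then show ?thesis using X pos by simp
  qed
  finally have e2: "eta2 x y > 0" .
  obtain \<rho> where r: "\<rho> > Yt" "gsum 1 \<rho>" using col_radius by blast
  have "P2r y \<ge> 0" by (rule P2r_facts(2)[OF r(2)]) (use assms r in auto)
  moreover have "eta0 x y > 0" unfolding eta0_def using assms pos by (simp add: add_pos_pos)
  ultimately show ?thesis unfolding NR_def using e2 assms p_pos
    by (intro add_nonneg_pos mult_nonneg_nonneg mult_pos_pos) auto
qed

text \<open>The expression is linear in \<open>P2r Yt\<close>, \<open>dP2r Yt\<close> and
  \<open>p 0 0\<close>, and each coefficient has a sign. The delicate one is \<open>Bk\<close>, the
  coefficient of \<open>P2r Yt\<close>; in terms of \<open>X\<close> and \<open>V\<close> it is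
  \<open>m1 * m2\<close> times the polynomial in \<open>main\<close>.\<close>

lemma branch_coeff_pos:
  assumes e: "eta1 xr Yt < 0"
  shows "- (dNR * eta1 xr Yt - NR xr Yt * l2) > 0"
proof -
  define X V where "X = 1 - 1 / xr" and "V = 1 - 1 / Yt"
  define E1 E2 where "E1 = eta1 xr Yt" and "E2 = eta2 xr Yt"
  have X: "0 < X" "X < 1" using xl_xr by (auto simp: X_def)
  have ker0: "ker xr Yt = 0" using ker_y0[of xr] w_xr by (simp add: y0_xr)
  have E1: "E1 = - (m2 * (r1 * X - V))" using eta1_ker[of xr Yt] ker0 by (simp add: E1_def X_def V_def algebra_simps)
  have E2: "E2 = m1 * (X - r2 * V)" using eta2_ker[of xr Yt] ker0 by (simp add: E2_def X_def V_def)
  have "E1 < 0" using e by (simp add: E1_def)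
  then have "m2 * (r1 * X - V) > 0" unfolding E1 by simp
  then have VX: "V < r1 * X" using pos by (simp add: zero_less_mult_iff)
  have r1X: "r1 * X < X" using X pos by simp
  have V1: "V < 1" using VX r1X X by linarith
  have X2: "X - r2 * V > 0"
  proof (cases "V \<ge> 0")
    case True
    then have "r2 * V \<le> 1 * V" using pos by (intro mult_right_mono) auto
    then show ?thesis using VX r1X by linarith
  next
    case False
    then have "r2 * V < 0" using pos by (simp add: mult_pos_neg)
    then show ?thesis using X by linarith
  qed
  then have E2p: "E2 > 0" unfolding E2 using pos by simp
  have Y: "Yt * (1 - V) = 1" using sg_Yt(2) by (simp add: V_def)
  have main: "X * (1 - r1 * r2) + r1 * X\<^sup>2 - 2 * X * V + r2 * V\<^sup>2 > 0"
  proof (cases "V \<ge> 0")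
    case True
    have rr: "r1 * r2 < 1"
    proof -
      have "r1 * r2 < 1 * 1" using pos by (intro mult_strict_mono) auto
      then show ?thesis by simp
    qed
    \<comment> \<open>Expansion around the extreme case \<open>V = r1 * X\<close>: the first summand
      is the value there, the second carries the factor \<open>r1 * X - V\<close>.\<close>
    have "X * (1 - r1 * r2) + r1 * X\<^sup>2 - 2 * X * V + r2 * V\<^sup>2
       = X * (1 - r1 * r2) * (1 - r1 * X) + (r1 * X - V) * (2 * X - r2 * (r1 * X + V))"
      by (simp add: power2_eq_square algebra_simps)
    moreover have "X * (1 - r1 * r2) * (1 - r1 * X) > 0"
    proof -
      have "r1 * X < 1" using r1X X(2) by linarith
      then show ?thesis using X rr by (intro mult_pos_pos) auto
    qed
    moreover have "(r1 * X - V) * (2 * X - r2 * (r1 * X + V)) \<ge> 0"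
    proof -
      have "r2 * (r1 * X + V) \<le> 1 * (r1 * X + V)" using pos X True by (intro mult_right_mono) auto
      then show ?thesis using VX r1X by (intro mult_nonneg_nonneg) auto
    qed
    ultimately show ?thesis by linarith
  next
    case False
    have "X * (1 - r1 * r2) > 0"
    proof -
      have "r1 * r2 < 1 * 1" using pos by (intro mult_strict_mono) auto
      then show ?thesis using X by simp
    qed
    moreover have "r1 * X\<^sup>2 \<ge> 0" "r2 * V\<^sup>2 \<ge> 0" using pos by auto
    moreover have "X * V < 0" using X False by (simp add: mult_pos_neg)
    ultimately show ?thesis by linarith
  qed
  have m2e: "l2 * Yt\<^sup>2 = m2" using sg_Yt(3) pos by simp
  have k2e: "k2 = m2 + r2 * m1" by (simp add: k2_def)
  define z where "z = l2 - k2 / Yt\<^sup>2"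
  have zY: "z * Yt\<^sup>2 = - (r2 * m1)"
    using sg_Yt(2) m2e k2e by (simp add: z_def left_diff_distrib)
  define Bk where "Bk = l2 * E2 * Yt - E1 * z * Yt - E1 * E2"
  have Bk: "Bk > 0"
  proof -
    have "Bk * Yt = (l2 * Yt\<^sup>2) * E2 - E1 * (z * Yt\<^sup>2) - E1 * E2 * Yt"
      by (simp add: Bk_def algebra_simps power2_eq_square)
    also have "\<dots> = m2 * E2 - E1 * (- (r2 * m1)) - E1 * E2 * Yt" by (simp only: m2e zY)
    also have "\<dots> = m1 * m2 * ((r1 * X - V) * (Yt * (X - r2 * V) - r2) + X - r2 * V)"
      unfolding E1 E2 by (simp add: algebra_simps)
    finally have e: "Bk * Yt = m1 * m2 * ((r1 * X - V) * (Yt * (X - r2 * V) - r2) + X - r2 * V)" .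
    \<comment> \<open>\<open>Yt * (1 - V)\<close> is 1, so this product clears the denominator
      without changing \<open>Bk\<close>.\<close>
    have "Bk * Yt * (1 - V) = m1 * m2 * ((r1 * X - V) * ((Yt * (1 - V)) * (X - r2 * V) - r2 * (1 - V)) + (X - r2 * V) * (1 - V))"
      unfolding e by (simp add: algebra_simps)
    also have "\<dots> = m1 * m2 * (X * (1 - r1 * r2) + r1 * X\<^sup>2 - 2 * X * V + r2 * V\<^sup>2)"
      unfolding Y by (simp add: power2_eq_square algebra_simps)
    finally have "Bk * (Yt * (1 - V)) > 0" using main pos by (simp add: mult.assoc)
    then show ?thesis unfolding Y by simp
  qed
  obtain \<rho> where r: "\<rho> > Yt" "gsum 1 \<rho>" using col_radius by blast
  have P: "P2r Yt \<ge> 0" "dP2r Yt \<ge> 0"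
    using P2r_facts(2,3)[OF r(2), of Yt] r sg_Yt by auto
  have e0: "eta0 xr Yt - E1 = k1 * X" by (simp add: eta0_def E1_def eta1_def X_def algebra_simps)
  have "- (dNR * eta1 xr Yt - NR xr Yt * l2) = P2r Yt * Bk + (- E1) * (E2 * Yt * dP2r Yt) + p 0 0 * l2 * (eta0 xr Yt - E1)"
    unfolding dNR_def NR_def Bk_def E1_def[symmetric] E2_def[symmetric] z_def[symmetric] by (simp add: algebra_simps)
  moreover have "P2r Yt * Bk \<ge> 0" using P Bk by simp
  moreover have "(- E1) * (E2 * Yt * dP2r Yt) \<ge> 0"
    using \<open>E1 < 0\<close> E2p P sg_Yt by (intro mult_nonneg_nonneg) auto
  moreover have "p 0 0 * l2 * (eta0 xr Yt - E1) > 0" unfolding e0 using p_pos pos k_pos X by simp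
  ultimately show ?thesis by linarith
qed

section \<open>Transfer from the bottom row to all rows\<close>

fun rowc :: "real \<Rightarrow> nat \<Rightarrow> real" where
  "rowc r 0 = 1"
| "rowc r (Suc 0) = (l1 + l2 + k1 - l1 * r - k1 / r) / m2"
| "rowc r (Suc (Suc n)) = (w r * rowc r (Suc n) - l2 * rowc r n) / m2"

text \<open>The balance equation, solved for the highest row in it, gives the limit of the next row
  from the two rows below; shifts in \<open>m\<close> contribute factors \<open>r\<close> and
  \<open>1 / r\<close>. This is the recurrence of \<open>rowc\<close>, whose first step differs
  because the bottom row has the down rate \<open>k1\<close>.\<close>

theorem rows_limit:
  assumes r: "r > 0" and c: "(\<lambda>m. p m 0 * r ^ m * real m powr a) \<longlonglongrightarrow> c"
  shows "(\<lambda>m. p m n * r ^ m * real m powr a) \<longlonglongrightarrow> c * rowc r n"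
proof -
  have step0: "(\<lambda>m. p m (Suc 0) * r ^ m * real m powr a) \<longlonglongrightarrow> c * rowc r (Suc 0)"
  proof -
    have "(\<lambda>m. ((l1 + l2 + k1) * (p m 0 * r ^ m * real m powr a) - l1 * (p (m - 1) 0 * r ^ m * real m powr a)
        - k1 * (p (Suc m) 0 * r ^ m * real m powr a)) / m2) \<longlonglongrightarrow> ((l1 + l2 + k1) * c - l1 * (c * r) - k1 * (c / r)) / m2"
      by (intro tendsto_intros c tendsto_shift[OF c r]) (use pos in auto)
    moreover have "eventually (\<lambda>m. ((l1 + l2 + k1) * (p m 0 * r ^ m * real m powr a) - l1 * (p (m - 1) 0 * r ^ m * real m powr a)
        - k1 * (p (Suc m) 0 * r ^ m * real m powr a)) / m2 = p m (Suc 0) * r ^ m * real m powr a) sequentially"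
      using eventually_gt_at_top[of 0]
    proof eventually_elim
      case (elim m)
      have "m2 * p m (Suc 0) = (l1 + l2 + k1) * p m 0 - l1 * p (m - 1) 0 - k1 * p (Suc m) 0"
        using balance[of m 0] elim by (simp add: k1_def algebra_simps)
      then have eq: "p m (Suc 0) = ((l1 + l2 + k1) * p m 0 - l1 * p (m - 1) 0 - k1 * p (Suc m) 0) / m2"
        using pos by (simp add: field_simps)
      show ?case unfolding eq by (simp add: algebra_simps diff_divide_distrib add_divide_distrib)
    qed
    ultimately have "(\<lambda>m. p m (Suc 0) * r ^ m * real m powr a) \<longlonglongrightarrow> ((l1 + l2 + k1) * c - l1 * (c * r) - k1 * (c / r)) / m2"
      by (rule Lim_transform_eventually)
    then show ?thesis by (simp add: algebra_simps)
  qed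
  have "(\<lambda>m. p m n * r ^ m * real m powr a) \<longlonglongrightarrow> c * rowc r n \<and>
      (\<lambda>m. p m (Suc n) * r ^ m * real m powr a) \<longlonglongrightarrow> c * rowc r (Suc n)"
  proof (induction n)
    case 0
    show ?case using c step0 by simp
  next
    case (Suc n)
    define T where "T = c * rowc r n"
    define T' where "T' = c * rowc r (Suc n)"
    have IH: "(\<lambda>m. p m n * r ^ m * real m powr a) \<longlonglongrightarrow> T" "(\<lambda>m. p m (Suc n) * r ^ m * real m powr a) \<longlonglongrightarrow> T'"
      using Suc by (auto simp: T_def T'_def)
    have "(\<lambda>m. ((l1 + l2 + m1 + m2) * (p m (Suc n) * r ^ m * real m powr a) - l1 * (p (m - 1) (Suc n) * r ^ m * real m powr a)
        - m1 * (p (Suc m) (Suc n) * r ^ m * real m powr a) - l2 * (p m n * r ^ m * real m powr a)) / m2) \<longlonglongrightarrow>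
          ((l1 + l2 + m1 + m2) * T' - l1 * (T' * r) - m1 * (T' / r) - l2 * T) / m2"
      by (intro tendsto_intros IH tendsto_shift[OF IH(2) r]) (use pos in auto)
    moreover have "eventually (\<lambda>m. ((l1 + l2 + m1 + m2) * (p m (Suc n) * r ^ m * real m powr a) - l1 * (p (m - 1) (Suc n) * r ^ m * real m powr a)
        - m1 * (p (Suc m) (Suc n) * r ^ m * real m powr a) - l2 * (p m n * r ^ m * real m powr a)) / m2
          = p m (Suc (Suc n)) * r ^ m * real m powr a) sequentially"
      using eventually_gt_at_top[of 0]
    proof eventually_elim
      case (elim m)
      have "m2 * p m (Suc (Suc n)) = (l1 + l2 + m1 + m2) * p m (Suc n) - l1 * p (m - 1) (Suc n) - m1 * p (Suc m) (Suc n) - l2 * p m n"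
        using balance[of m "Suc n"] elim by (simp add: algebra_simps)
      then have eq: "p m (Suc (Suc n)) = ((l1 + l2 + m1 + m2) * p m (Suc n) - l1 * p (m - 1) (Suc n) - m1 * p (Suc m) (Suc n) - l2 * p m n) / m2"
        using pos by (simp add: field_simps)
      show ?case unfolding eq by (simp add: algebra_simps diff_divide_distrib add_divide_distrib)
    qed
    ultimately have "(\<lambda>m. p m (Suc (Suc n)) * r ^ m * real m powr a) \<longlonglongrightarrow> ((l1 + l2 + m1 + m2) * T' - l1 * (T' * r) - m1 * (T' / r) - l2 * T) / m2"
      by (rule Lim_transform_eventually)
    moreover have "((l1 + l2 + m1 + m2) * T' - l1 * (T' * r) - m1 * (T' / r) - l2 * T) / m2 = c * rowc r (Suc (Suc n))"
      by (simp add: T_def T'_def w_def algebra_simps)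
    ultimately have "(\<lambda>m. p m (Suc (Suc n)) * r ^ m * real m powr a) \<longlonglongrightarrow> c * rowc r (Suc (Suc n))"
      by (simp only:)
    then show ?case using Suc by blast
  qed
  then show ?thesis by blast
qed

text \<open>The recurrence has the reciprocals of the two kernel roots as characteristic roots. The
  condition \<open>eta1 r y = 0\<close> makes the first step consistent with just one of them,
  \<open>l2 * y / m2\<close>, which is the reciprocal of the root other than
  \<open>y\<close>.\<close>

lemma rowc_pole:
  assumes "eta1 r y = 0" "ker r y = 0" "y > 0"
  shows "rowc r n = (l2 * y / m2) ^ n"
proof -
  have e: "l1 + l2 + k1 - l1 * r - k1 / r = l2 * y" using assms(1) by (simp add: eta1_def algebra_simps)
  have wy: "w r * y = l2 * y\<^sup>2 + m2" using ker_w[of y r] assms by simp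
  have "rowc r n = (l2 * y / m2) ^ n \<and> rowc r (Suc n) = (l2 * y / m2) ^ Suc n"
  proof (induction n)
    case 0
    then show ?case by (simp only: rowc.simps e) simp
  next
    case (Suc n)
    define u where "u = (l2 * y / m2) ^ n"
    have "rowc r (Suc (Suc n)) = (w r * (l2 * y / m2 * u) - l2 * u) / m2" using Suc by (simp add: u_def)
    also have "\<dots> = u * l2 * (w r * y - m2) / m2\<^sup>2" using pos by (simp add: field_simps power2_eq_square)
    also have "\<dots> = u * (l2 * y / m2)\<^sup>2" unfolding wy by (simp add: power2_eq_square)
    finally show ?case using Suc by (simp add: u_def power2_eq_square)
  qed
  then show ?thesis by simp
qed

text \<open>At \<open>xr\<close> both characteristic roots are \<open>1 / Yt\<close>, so a linear
  factor in \<open>n\<close> appears; its slope is fixed by the first step and measures how far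
  \<open>eta1\<close> is from vanishing at \<open>(xr, Yt)\<close>.\<close>

lemma rowc_branch:
  "rowc xr n = (1 + real n * (- eta1 xr Yt * Yt / m2)) * (1 / Yt) ^ n"
proof -
  define c where "c = - eta1 xr Yt * Yt / m2"
  define u where "u = 1 / Yt"
  have m2: "l2 * Yt\<^sup>2 = m2" using sg_Yt(3) pos by simp
  have wx: "w xr = 2 * l2 * Yt" using w_xr sg_Yt(4) by simp
  have Yp: "Yt > 0" by (rule sg_Yt)
  have e: "l1 + l2 + k1 - l1 * xr - k1 / xr = l2 * Yt - eta1 xr Yt" by (simp add: eta1_def algebra_simps)
  have 1: "(l2 * Yt - eta1 xr Yt) / m2 = (1 + c) * u"
  proof -
    have "l2 * Yt / (l2 * Yt\<^sup>2) = u" unfolding u_def using Yp pos by (simp add: field_simps power2_eq_square)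
    then have "l2 * Yt / m2 = u" by (simp only: m2)
    moreover have "- eta1 xr Yt / m2 = c * u" using Yp by (simp add: c_def u_def)
    ultimately show ?thesis by (simp add: diff_divide_distrib distrib_right)
  qed
  have rec: "(w xr * b - l2 * a) / m2 = 2 * u * b - u\<^sup>2 * a" for a b
  proof -
    have "(w xr * b - l2 * a) / (l2 * Yt\<^sup>2) = 2 * u * b - u\<^sup>2 * a"
      unfolding wx u_def using Yp pos by (simp add: field_simps power2_eq_square)
    then show ?thesis by (simp only: m2)
  qed
  have "rowc xr n = (1 + real n * c) * u ^ n \<and> rowc xr (Suc n) = (1 + real (Suc n) * c) * u ^ Suc n"
  proof (induction n)
    case 0
    then show ?case by (simp only: rowc.simps e 1) simp
  next
    case (Suc n)
    have "rowc xr (Suc (Suc n)) = 2 * u * rowc xr (Suc n) - u\<^sup>2 * rowc xr n" by (simp only: rowc.simps rec)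
    also have "\<dots> = (1 + real (Suc (Suc n)) * c) * u ^ Suc (Suc n)"
      using Suc by (simp add: algebra_simps power2_eq_square)
    finally show ?case using Suc by simp
  qed
  then show ?thesis by (simp add: c_def u_def)
qed

text \<open>The terms at \<open>xr\<close> behave like a positive constant times m^(-1/2) and are
  not summable, whereas for nonnegative coefficients boundedness on the real segment would give
  summability. This is what identifies \<open>x_dom\<close>.\<close>

lemma P1_unbounded_at_xr:
  assumes "yp = Yt"
  shows "\<not> (\<exists>B. \<forall>r. 1 < r \<and> r < xr \<longrightarrow> cmod (P1 (of_real r)) \<le> B)"
proof
  assume "\<exists>B. \<forall>r. 1 < r \<and> r < xr \<longrightarrow> cmod (P1 (of_real r)) \<le> B"
  then obtain B where B: "\<And>r. 1 < r \<Longrightarrow> r < xr \<Longrightarrow> cmod (P1 (of_real r)) \<le> B" by blast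
  have R: "R = xr" using assms by (simp add: R_def)
  have part: "(\<Sum>m<N. p (Suc m) 0 * r ^ m) \<le> B" if r: "1 < r" "r < xr" for r N
  proof -
    have s: "(\<lambda>m. complex_of_real (p (Suc m) 0 * r ^ m)) sums P1 (of_real r)"
      using P1_sums[of "of_real r"] r R by simp
    have sr: "summable (\<lambda>m. p (Suc m) 0 * r ^ m)"
      using sums_summable[OF s] by (subst (asm) summable_of_real_iff)
    have "P1 (of_real r) = of_real (\<Sum>m. p (Suc m) 0 * r ^ m)"
      using sums_unique2[OF s sums_of_real[OF summable_sums[OF sr]]] .
    moreover have "(\<Sum>m<N. p (Suc m) 0 * r ^ m) \<le> (\<Sum>m. p (Suc m) 0 * r ^ m)"
      by (rule sum_le_suminf[OF sr]) (use r p_nonneg in auto)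
    ultimately show ?thesis using B[OF r] by simp
  qed
  have part_xr: "(\<Sum>m<N. p (Suc m) 0 * xr ^ m) \<le> B" for N
  proof -
    have "((\<lambda>r. \<Sum>m<N. p (Suc m) 0 * r ^ m) \<longlongrightarrow> (\<Sum>m<N. p (Suc m) 0 * xr ^ m)) (at_left xr)"
      by (intro tendsto_intros)
    moreover have "eventually (\<lambda>r. (\<Sum>m<N. p (Suc m) 0 * r ^ m) \<le> B) (at_left xr)"
      using eventually_at_left_real[of 1 xr] xl_xr by (auto elim!: eventually_mono intro!: part)
    ultimately show ?thesis by (intro tendsto_upperbound) auto
  qed
  have "summable (\<lambda>m. p (Suc m) 0 * xr ^ m)"
    by (rule summableI_nonneg_bounded[of _ B]) (use p_nonneg xl_xr part_xr in auto)
  moreover have "summable (\<lambda>m. inverse (real m powr (1 / 2)))"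
  proof -
    define C where "C = NR xr Yt / (xr * l2 * kap) / sqrt pi"
    have xpr: "xp = xr" using row_limit_branch_pole(2)[OF assms] .
    have "NR xr Yt > 0"
    proof (rule NR_pos)
      show "1 < Yt" using yp_gt_1 assms by simp
      show "ker xr Yt = 0" using ker_xp_yp assms xpr by simp
      then show "eta1 xr Yt = 0" using eta1_yc[of xr Yt] xl_xr assms xpr by (simp add: yp_def)
    qed (use xl_xr in auto)
    then have "C > 0" using xl_xr pos kap_pos by (simp add: C_def)
    moreover have "(\<lambda>m. p (Suc m) 0 * xr ^ m * real m powr (1 / 2)) \<longlonglongrightarrow> C"
      unfolding C_def by (rule row_limit_branch_pole(1)[OF assms])
    ultimately have "eventually (\<lambda>m. p (Suc m) 0 * xr ^ m * real m powr (1 / 2) > C / 2) sequentially"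
      by (intro order_tendstoD) auto
    then have "eventually (\<lambda>m. norm (inverse (real m powr (1 / 2))) \<le> 2 / C * (p (Suc m) 0 * xr ^ m)) sequentially"
      using eventually_gt_at_top[of 0] by eventually_elim (use \<open>C > 0\<close> in \<open>simp add: field_simps\<close>)
    then show ?thesis
      by (rule summable_comparison_test_ev) (intro summable_mult \<open>summable (\<lambda>m. p (Suc m) 0 * xr ^ m)\<close>)
  qed
  ultimately show False
    using summable_real_powr_iff[of "- (1 / 2)"] by (simp add: powr_minus)
qed

end

section \<open>Analytic continuation of the generating functions\<close>

text \<open>The endpoint \<open>z\<close> may lie outside the disc. The identity theorem is applied
  on the component of 0 in the intersection of \<open>D\<close> with the disc, which contains the
  segment from 0 to \<open>w\<close>.\<close>

lemma continues_to_unique: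
  assumes hol: "f holomorphic_on ball 0 r" and F: "open D" "closed_segment 0 z \<subseteq> D" "F holomorphic_on D"
    "\<forall>\<^sub>F u in nhds 0. F u = f u" and z: "w \<in> closed_segment 0 z" "cmod w < r"
  shows "F w = f w"
proof -
  have seg: "closed_segment 0 w \<subseteq> D" using z(1) F(2) subset_closed_segment[of 0 w 0 z] by auto
  define U where "U = D \<inter> ball 0 r"
  have U: "open U" using F(1) by (simp add: U_def open_Int)
  define W where "W = connected_component_set U 0"
  have r: "r > 0" using z(2) norm_ge_zero[of w] by linarith
  have segU: "closed_segment 0 w \<subseteq> U"
  proof -
    have "closed_segment 0 w \<subseteq> ball 0 r" using r z(2) by (intro closed_segment_subset) auto
    then show ?thesis using seg by (auto simp: U_def)
  qed
  have W: "open W" "connected W" "W \<subseteq> U" "0 \<in> W" "w \<in> W"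
  proof -
    show "open W" unfolding W_def by (rule open_connected_component[OF U])
    show "connected W" "W \<subseteq> U" unfolding W_def by (auto simp: connected_component_subset)
    have "closed_segment 0 w \<subseteq> W" unfolding W_def
      by (rule connected_component_maximal) (use segU in auto)
    then show "0 \<in> W" "w \<in> W" by auto
  qed
  obtain V where V: "open V" "0 \<in> V" "\<And>u. u \<in> V \<Longrightarrow> F u = f u"
    using F(4) unfolding eventually_nhds by blast
  show ?thesis
  proof (rule analytic_continuation_open[of "V \<inter> W" W F f])
    show "F holomorphic_on W" by (rule holomorphic_on_subset[OF F(3)]) (use W U_def in auto)
    show "f holomorphic_on W" by (rule holomorphic_on_subset[OF hol]) (use W U_def in auto)
  qed (use V W in auto)
qed

lemma continues_to_ball:
  assumes "f holomorphic_on ball 0 r" "cmod z < r"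
  shows "continues_to f z w \<longleftrightarrow> w = f z"
proof
  assume "continues_to f z w"
  then show "w = f z" unfolding continues_to_def using continues_to_unique[OF assms(1) _ _ _ _ _ assms(2)] by fastforce
next
  assume "w = f z"
  have "r > 0" using assms(2) norm_ge_zero[of z] by linarith
  then have "closed_segment 0 z \<subseteq> ball 0 r" using assms(2) by (intro closed_segment_subset) auto
  then show "continues_to f z w" unfolding continues_to_def
    using assms(1) \<open>w = f z\<close> by (intro exI[of _ "ball 0 r"] exI[of _ f]) auto
qed

lemma ancont_ball:
  assumes "f holomorphic_on ball 0 r" "cmod z < r"
  shows "ancont f z = f z"
  unfolding ancont_def continues_to_ball[OF assms] by simp

text \<open>A continuation to \<open>r\<close> would be continuous on the compact segment and hence
  bounded, while it agrees with \<open>f\<close> before the endpoint. Inside the disc every point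
  admits a continuation, so no singularity has smaller modulus.\<close>

lemma dominant_singularity_eqI:
  assumes hol: "f holomorphic_on ball 0 r" and r: "r > 1"
    and unb: "\<not> (\<exists>B. \<forall>s. 1 < s \<and> s < r \<longrightarrow> cmod (f (of_real s)) \<le> B)"
  shows "dominant_singularity f = r"
proof -
  have nosing: "r \<le> cmod z" if "singularity f z" for z
  proof (rule ccontr)
    assume "\<not> r \<le> cmod z"
    then have "continues_to f z (f z)" using continues_to_ball[OF hol] by simp
    then show False using that by (auto simp: singularity_def)
  qed
  have seg: "of_real s \<in> closed_segment 0 (complex_of_real r)" if "0 \<le> s" "s \<le> r" for s
    using that r by (auto simp: closed_segment_def scaleR_conv_of_real intro!: exI[of _ "s / r"])
  have nc: "\<not> continues_to f (of_real r) v" for v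
  proof
    assume "continues_to f (of_real r) v"
    then obtain D F where F: "open D" "closed_segment 0 (complex_of_real r) \<subseteq> D" "F holomorphic_on D"
       "\<forall>\<^sub>F u in nhds 0. F u = f u" unfolding continues_to_def by blast
    have "continuous_on (closed_segment 0 (complex_of_real r)) F"
      using holomorphic_on_imp_continuous_on[OF F(3)] F(2) by (rule continuous_on_subset)
    then have "bounded (F ` closed_segment 0 (complex_of_real r))"
      by (intro compact_imp_bounded compact_continuous_image) auto
    then obtain B where B: "\<And>u. u \<in> closed_segment 0 (complex_of_real r) \<Longrightarrow> cmod (F u) \<le> B"
      unfolding bounded_iff by blast
    have "cmod (f (of_real s)) \<le> B" if "1 < s" "s < r" for s
    proof -
      have "F (of_real s) = f (of_real s)"
        by (rule continues_to_unique[OF hol F seg]) (use that in auto)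
      then show ?thesis using B[OF seg[of s]] that by simp
    qed
    then show False using unb by blast
  qed
  have sing: "singularity f (of_real r)"
    unfolding singularity_def
  proof (intro conjI ballI)
    fix w assume w: "w \<in> closed_segment 0 (complex_of_real r) - {of_real r}"
    then obtain u where u: "0 \<le> u" "u \<le> 1" "w = of_real (u * r)"
      by (auto simp: closed_segment_def scaleR_conv_of_real)
    then have "u \<noteq> 1" using w by auto
    then have "u * r < 1 * r" using u r by (intro mult_strict_right_mono) auto
    moreover have "cmod w = u * r" unfolding u(3) norm_of_real using u r by simp
    ultimately have "cmod w < r" by simp
    then show "\<exists>v. continues_to f w v" using continues_to_ball[OF hol] by blast
  qed (use nc in blast)
  show ?thesis unfolding dominant_singularity_def
  proof (rule the_equality)
    show "r > 0 \<and> singularity f (of_real r) \<and> (\<forall>z. singularity f z \<longrightarrow> r \<le> cmod z)"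
      using r sing nosing by simp
    fix s assume s: "s > 0 \<and> singularity f (of_real s) \<and> (\<forall>z. singularity f z \<longrightarrow> s \<le> cmod z)"
    then have "s \<le> cmod (complex_of_real r)" using sing by blast
    moreover have "r \<le> cmod (complex_of_real s)" using s nosing by blast
    ultimately show "s = r" using s r by simp
  qed
qed

section \<open>The retrial queue as a walk\<close>

lemma infsum_finite_support:
  fixes f :: "'a \<Rightarrow> real"
  assumes "finite B" "\<And>x. x \<notin> B \<Longrightarrow> f x = 0"
  shows "(f has_sum sum f B) UNIV" "infsum f UNIV = sum f B"
proof -
  show "(f has_sum sum f B) UNIV" by (rule has_sum_finite_neutralI[of B]) (use assms in auto)
  then show "infsum f UNIV = sum f B" by (rule infsumI)
qed

locale retrial_queue =
  fixes Q :: queue and \<pi> :: "state pmf"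
  assumes valid: "valid_queue Q" and stabq: "stable_queue Q" and h1_less: "hlam1 Q < hmu1 Q"
    and stat: "stationary Q \<pi>"
begin

lemma params_pos: "lam1 Q > 0" "lam2 Q > 0" "mu Q > 0" "mu1 Q > 0" "mu2 Q > 0" "lam Q > 0" "alpha Q > 0"
  using valid by (auto simp: valid_queue_def lam_def alpha_def)

lemma balance_idle:
  "pmf \<pi> (m, n, Idle) * (lam Q + (if m = 0 then 0 else mu1 Q) + (if n = 0 then 0 else mu2 Q)) = mu Q * pmf \<pi> (m, n, Busy)"
proof -
  have "((\<lambda>s. pmf \<pi> s * rate Q s (m, n, Idle)) has_sum (pmf \<pi> (m, n, Idle) * (\<Sum>\<^sub>\<infinity>u. rate Q (m, n, Idle) u))) UNIV"
    using stat unfolding stationary_def by blast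
  moreover have "((\<lambda>s. pmf \<pi> s * rate Q s (m, n, Idle)) has_sum (\<Sum>s\<in>{(m, n, Busy)}. pmf \<pi> s * rate Q s (m, n, Idle))) UNIV"
  proof (rule infsum_finite_support(1))
    fix s :: state assume "s \<notin> {(m, n, Busy)}"
    moreover obtain a b k where "s = (a, b, k)" by (cases s) auto
    ultimately show "pmf \<pi> s * rate Q s (m, n, Idle) = 0" by (cases k) auto
  qed auto
  ultimately have "pmf \<pi> (m, n, Idle) * (\<Sum>\<^sub>\<infinity>u. rate Q (m, n, Idle) u) = (\<Sum>s\<in>{(m, n, Busy)}. pmf \<pi> s * rate Q s (m, n, Idle))"
    by (rule has_sum_unique)
  moreover have "(\<Sum>\<^sub>\<infinity>u. rate Q (m, n, Idle) u) = lam Q + (if m = 0 then 0 else mu1 Q) + (if n = 0 then 0 else mu2 Q)"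
  proof -
    define B where "B = {(m, n, Busy)} \<union> (if m = 0 then {} else {(m - 1, n, Busy)}) \<union> (if n = 0 then {} else {(m, n - 1, Busy)})"
    have "(\<Sum>\<^sub>\<infinity>u. rate Q (m, n, Idle) u) = (\<Sum>u\<in>B. rate Q (m, n, Idle) u)"
    proof (rule infsum_finite_support(2))
      fix s :: state assume s: "s \<notin> B"
      obtain a b k where "s = (a, b, k)" by (cases s) auto
      then show "rate Q (m, n, Idle) s = 0" using s by (cases k) (auto simp: B_def split: if_splits)
    qed (auto simp: B_def)
    also have "\<dots> = lam Q + (if m = 0 then 0 else mu1 Q) + (if n = 0 then 0 else mu2 Q)"
      by (cases m; cases n) (auto simp: B_def)
    finally show ?thesis .
  qed
  ultimately show ?thesis by simp
qed

lemma balance_busy: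
  "pmf \<pi> (m, n, Busy) * (lam1 Q + lam2 Q + mu Q) = lam Q * pmf \<pi> (m, n, Idle)
     + mu1 Q * pmf \<pi> (Suc m, n, Idle) + mu2 Q * pmf \<pi> (m, Suc n, Idle)
     + (if m = 0 then 0 else lam1 Q * pmf \<pi> (m - 1, n, Busy)) + (if n = 0 then 0 else lam2 Q * pmf \<pi> (m, n - 1, Busy))"
proof -
  define B where "B = {(m, n, Idle), (Suc m, n, Idle), (m, Suc n, Idle)}
    \<union> (if m = 0 then {} else {(m - 1, n, Busy)}) \<union> (if n = 0 then {} else {(m, n - 1, Busy)})"
  have "((\<lambda>s. pmf \<pi> s * rate Q s (m, n, Busy)) has_sum (pmf \<pi> (m, n, Busy) * (\<Sum>\<^sub>\<infinity>u. rate Q (m, n, Busy) u))) UNIV"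
    using stat unfolding stationary_def by blast
  moreover have "((\<lambda>s. pmf \<pi> s * rate Q s (m, n, Busy)) has_sum (\<Sum>s\<in>B. pmf \<pi> s * rate Q s (m, n, Busy))) UNIV"
  proof (rule infsum_finite_support(1))
    fix s :: state assume s: "s \<notin> B"
    obtain a b k where "s = (a, b, k)" by (cases s) auto
    then show "pmf \<pi> s * rate Q s (m, n, Busy) = 0" using s by (cases k) (auto simp: B_def split: if_splits)
  qed (auto simp: B_def)
  ultimately have "pmf \<pi> (m, n, Busy) * (\<Sum>\<^sub>\<infinity>u. rate Q (m, n, Busy) u) = (\<Sum>s\<in>B. pmf \<pi> s * rate Q s (m, n, Busy))"
    by (rule has_sum_unique)
  moreover have "(\<Sum>\<^sub>\<infinity>u. rate Q (m, n, Busy) u) = lam1 Q + lam2 Q + mu Q"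
  proof -
    have "(\<Sum>\<^sub>\<infinity>u. rate Q (m, n, Busy) u) = (\<Sum>u\<in>{(Suc m, n, Busy), (m, Suc n, Busy), (m, n, Idle)}. rate Q (m, n, Busy) u)"
    proof (rule infsum_finite_support(2))
      fix s :: state assume "s \<notin> {(Suc m, n, Busy), (m, Suc n, Busy), (m, n, Idle)}"
      moreover obtain a b k where "s = (a, b, k)" by (cases s) auto
      ultimately show "rate Q (m, n, Busy) s = 0" by (cases k) auto
    qed auto
    then show ?thesis by simp
  qed
  moreover have "(\<Sum>s\<in>B. pmf \<pi> s * rate Q s (m, n, Busy)) = lam Q * pmf \<pi> (m, n, Idle)
     + mu1 Q * pmf \<pi> (Suc m, n, Idle) + mu2 Q * pmf \<pi> (m, Suc n, Idle)
     + (if m = 0 then 0 else lam1 Q * pmf \<pi> (m - 1, n, Busy)) + (if n = 0 then 0 else lam2 Q * pmf \<pi> (m, n - 1, Busy))"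
    by (cases m; cases n) (auto simp: B_def)
  ultimately show ?thesis by simp
qed

lemma idle_eq:
  "pmf \<pi> (m, n, Idle) = mu Q * pmf \<pi> (m, n, Busy) / (lam Q + (if m = 0 then 0 else mu1 Q) + (if n = 0 then 0 else mu2 Q))"
proof -
  have "lam Q + (if m = 0 then 0 else mu1 Q) + (if n = 0 then 0 else mu2 Q) > 0" using params_pos by auto
  then show ?thesis using balance_idle[of m n] by (simp add: field_simps)
qed

text \<open>A down step of the reduced walk is a service completion whose next event is a retrial.
  \<open>M1\<close> is \<open>mu Q\<close> times the probability that this event is a retrial from
  orbit 1 while both orbits are occupied; \<open>\<rho>1\<close> is the same probability while orbit
  2 is empty.\<close>

definition M1 :: real where "M1 = mu Q * mu1 Q / alpha Q"
definition M2 :: real where "M2 = mu Q * mu2 Q / alpha Q"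
definition \<rho>1 :: real where "\<rho>1 = mu1 Q / (lam Q + mu1 Q)"
definition \<rho>2 :: real where "\<rho>2 = mu2 Q / (lam Q + mu2 Q)"

lemma boundary_rates: "M1 + \<rho>1 * M2 = mu Q * mu1 Q / (lam Q + mu1 Q)" "M2 + \<rho>2 * M1 = mu Q * mu2 Q / (lam Q + mu2 Q)"
proof -
  have a: "alpha Q = lam Q + mu1 Q + mu2 Q" by (simp add: alpha_def)
  have "lam Q + mu1 Q > 0" "lam Q + mu2 Q > 0" "lam Q + mu1 Q + mu2 Q > 0" using params_pos by simp_all
  then show "M1 + \<rho>1 * M2 = mu Q * mu1 Q / (lam Q + mu1 Q)" "M2 + \<rho>2 * M1 = mu Q * mu2 Q / (lam Q + mu2 Q)"
    unfolding M1_def M2_def \<rho>1_def \<rho>2_def a by (simp_all add: divide_simps) (simp_all add: algebra_simps)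
qed

text \<open>By \<open>idle_eq\<close> the idle probabilities are multiples of the busy ones. A
  service completion followed by an outside arrival leaves the orbits unchanged and cancels from
  both sides.\<close>

lemma walk_balance:
  "pmf \<pi> (m, n, Busy) * (lam1 Q + lam2 Q + (if m = 0 then 0 else if n = 0 then M1 + \<rho>1 * M2 else M1)
          + (if n = 0 then 0 else if m = 0 then M2 + \<rho>2 * M1 else M2))
       = (if m = 0 then 0 else lam1 Q * pmf \<pi> (m - 1, n, Busy)) + (if n = 0 then 0 else lam2 Q * pmf \<pi> (m, n - 1, Busy))
       + (if n = 0 then M1 + \<rho>1 * M2 else M1) * pmf \<pi> (Suc m, n, Busy)
       + (if m = 0 then M2 + \<rho>2 * M1 else M2) * pmf \<pi> (m, Suc n, Busy)"
proof -
  define I where "I = (\<lambda>m n. pmf \<pi> (m, n, Idle))"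
  have Ieq: "pmf \<pi> (m, n, Idle) = I m n" for m n by (simp add: I_def)
  have a: "alpha Q = lam Q + mu1 Q + mu2 Q" by (simp add: alpha_def)
  have up1: "mu1 Q * I (Suc m) n = (if n = 0 then M1 + \<rho>1 * M2 else M1) * pmf \<pi> (Suc m, n, Busy)" for m n
    unfolding boundary_rates I_def idle_eq[of "Suc m" n] by (simp add: M1_def a)
  have up2: "mu2 Q * I m (Suc n) = (if m = 0 then M2 + \<rho>2 * M1 else M2) * pmf \<pi> (m, Suc n, Busy)" for m n
    unfolding boundary_rates I_def idle_eq[of m "Suc n"] by (simp add: M2_def a add_ac)
  have dn1: "(if m = 0 then 0 else mu1 Q) * I m n = (if m = 0 then 0 else if n = 0 then M1 + \<rho>1 * M2 else M1) * pmf \<pi> (m, n, Busy)"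
    using up1[of "m - 1" n] by (cases m) auto
  have dn2: "(if n = 0 then 0 else mu2 Q) * I m n = (if n = 0 then 0 else if m = 0 then M2 + \<rho>2 * M1 else M2) * pmf \<pi> (m, n, Busy)"
    using up2[of m "n - 1"] by (cases n) auto
  have idle: "lam Q * I m n = mu Q * pmf \<pi> (m, n, Busy) - (if m = 0 then 0 else mu1 Q) * I m n - (if n = 0 then 0 else mu2 Q) * I m n"
    using balance_idle[of m n] unfolding Ieq by (simp only: distrib_left distrib_right mult.commute[of "I m n"])
  show ?thesis
    using balance_busy[of m n] unfolding Ieq idle dn1 dn2 up1 up2
    by (simp only: distrib_left distrib_right mult.commute[of "pmf \<pi> (m, n, Busy)"])
qed

text \<open>If the corner had mass 0, its balance equation, a sum of nonnegative terms, would force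
  mass 0 on both upper neighbours and by induction on all states, which is impossible for a
  probability distribution.\<close>

lemma walk_pos: "pmf \<pi> (0, 0, Busy) > 0"
proof (rule ccontr)
  assume "\<not> pmf \<pi> (0, 0, Busy) > 0"
  then have z: "pmf \<pi> (0, 0, Busy) = 0" using pmf_nonneg[of \<pi> "(0, 0, Busy)"] by linarith
  have M: "M1 > 0" "M2 > 0" "\<rho>1 > 0" "\<rho>2 > 0" using params_pos by (auto simp: M1_def M2_def \<rho>1_def \<rho>2_def)
  have step: "pmf \<pi> (Suc m, n, Busy) = 0 \<and> pmf \<pi> (m, Suc n, Busy) = 0" if "pmf \<pi> (m, n, Busy) = 0" for m n
  proof -
    define c1 where "c1 = (if n = 0 then M1 + \<rho>1 * M2 else M1)"
    define c2 where "c2 = (if m = 0 then M2 + \<rho>2 * M1 else M2)"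
    have c: "c1 > 0" "c2 > 0" using M by (auto simp: c1_def c2_def add_pos_pos)
    have "0 = (if m = 0 then 0 else lam1 Q * pmf \<pi> (m - 1, n, Busy)) + (if n = 0 then 0 else lam2 Q * pmf \<pi> (m, n - 1, Busy))
       + c1 * pmf \<pi> (Suc m, n, Busy) + c2 * pmf \<pi> (m, Suc n, Busy)"
      using walk_balance[of m n] that by (simp add: c1_def c2_def)
    moreover have "(if m = 0 then 0 else lam1 Q * pmf \<pi> (m - 1, n, Busy)) \<ge> 0" "(if n = 0 then 0 else lam2 Q * pmf \<pi> (m, n - 1, Busy)) \<ge> 0"
      "c1 * pmf \<pi> (Suc m, n, Busy) \<ge> 0" "c2 * pmf \<pi> (m, Suc n, Busy) \<ge> 0"
      using params_pos c by auto
    ultimately have "c1 * pmf \<pi> (Suc m, n, Busy) = 0" "c2 * pmf \<pi> (m, Suc n, Busy) = 0" by linarith+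
    then show ?thesis using c by simp
  qed
  have m0: "pmf \<pi> (m, 0, Busy) = 0" for m by (induction m) (use z step in auto)
  have busy: "pmf \<pi> (m, n, Busy) = 0" for m n by (induction n) (use m0 step in auto)
  have idle: "pmf \<pi> (m, n, Idle) = 0" for m n by (simp add: idle_eq busy)
  obtain s where "s \<in> set_pmf \<pi>" using set_pmf_not_empty[of \<pi>] by blast
  moreover obtain m n k where "s = (m, n, k)" by (cases s) auto
  ultimately show False using busy idle by (cases k) (auto simp: set_pmf_iff)
qed

sublocale orbit_walk "lam1 Q" "lam2 Q" M1 M2 \<rho>1 \<rho>2 "\<lambda>m n. pmf \<pi> (m, n, Busy)"
proof
  show "lam1 Q > 0" "lam2 Q > 0" "M1 > 0" "M2 > 0" "0 < \<rho>1" "\<rho>1 < 1" "0 < \<rho>2" "\<rho>2 < 1"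
    using params_pos by (auto simp: M1_def M2_def \<rho>1_def \<rho>2_def)
  show "lam1 Q < M1" using h1_less params_pos by (simp add: M1_def hlam1_def hmu1_def field_simps)
  \<comment> \<open>This is the stability inequality for orbit 1 divided by
    \<open>lam Q + mu1 Q\<close>.\<close>
  show "lam1 Q + \<rho>1 * lam2 Q < M1 + \<rho>1 * M2"
  proof -
    have d: "lam Q + mu1 Q > 0" using params_pos by simp
    have "lam1 Q + \<rho>1 * lam2 Q = lam Q * (lam1 Q + mu1 Q) / (lam Q + mu1 Q)"
      using d by (simp add: \<rho>1_def field_simps) (simp add: lam_def algebra_simps)
    then show ?thesis unfolding boundary_rates using stabq d by (simp add: stable_queue_def divide_strict_right_mono)
  qed
  show "(\<lambda>(m, n). pmf \<pi> (m, n, Busy)) summable_on UNIV"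
  proof -
    have "pmf \<pi> summable_on range (\<lambda>(m, n). (m, n, Busy))"
    proof (rule nonneg_bounded_partial_sums_imp_summable_on)
      have "sum (pmf \<pi>) A \<le> 1" if "finite A" for A
        using measure_measure_pmf_finite[OF that, of \<pi>] measure_pmf.prob_le_1[of \<pi> A] by simp
      then show "eventually (\<lambda>A. sum (pmf \<pi>) A \<le> 1) (finite_subsets_at_top (range (\<lambda>(m, n). (m, n, Busy))))"
        by (intro eventually_finite_subsets_at_top_weakI) auto
    qed auto
    then show ?thesis
      by (subst (asm) summable_on_reindex) (auto simp: inj_on_def o_def case_prod_unfold)
  qed
qed (use walk_balance walk_pos in auto)

end

section \<open>The constants of the queue\<close>

context retrial_queue
begin

lemma scaled: "hlam1 Q = alpha Q * lam1 Q" "hlam2 Q = alpha Q * lam2 Q" "hmu1 Q = alpha Q * M1" "hmu2 Q = alpha Q * M2"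
  using params_pos by (auto simp: hlam1_def hlam2_def hmu1_def hmu2_def M1_def M2_def)

lemma k1_eq: "k1 = hmu1 Q / (lam Q + mu1 Q)" "k2 = hmu2 Q / (lam Q + mu2 Q)"
  unfolding k1_def k2_def boundary_rates by (simp_all add: hmu1_def hmu2_def)

lemma bhat_poly: "bhat Q x = alpha Q * (lam1 Q * x\<^sup>2 - (lam1 Q + lam2 Q + M1 + M2) * x + M1)"
  by (simp add: bhat_def scaled algebra_simps)

lemma bhat_w: "x \<noteq> 0 \<Longrightarrow> bhat Q x = - (alpha Q * x * w x)"
  by (simp add: bhat_poly w_def field_simps power2_eq_square)

lemma sqrt_hat: "sqrt (hlam2 Q * hmu2 Q) = alpha Q * sg" "sqrt (hmu2 Q / hlam2 Q) = Yt"
proof -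
  have "hlam2 Q * hmu2 Q = (alpha Q)\<^sup>2 * (lam2 Q * M2)" by (simp add: scaled power2_eq_square)
  then show "sqrt (hlam2 Q * hmu2 Q) = alpha Q * sg"
    using params_pos by (simp add: real_sqrt_mult sg_def)
  show "sqrt (hmu2 Q / hlam2 Q) = Yt"
    using params_pos by (simp add: scaled Yt_def)
qed

lemma b_plus_factor: "b_plus Q x = alpha Q * lam1 Q * ((x - xl) * (x - xr))"
proof -
  have "alpha Q * lam1 Q * ((x - xl) * (x - xr)) = alpha Q * (lam1 Q * x\<^sup>2 - lam1 Q * (xl + xr) * x + lam1 Q * (xl * xr))"
    by (simp add: algebra_simps power2_eq_square)
  also have "\<dots> = alpha Q * (lam1 Q * x\<^sup>2 - xS * x + M1)"
    using params_pos by (simp only: xlr_sum_prod) simp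
  also have "\<dots> = b_plus Q x"
    unfolding b_plus_def bhat_poly sqrt_hat by (simp add: xS_def algebra_simps)
  finally show ?thesis by simp
qed

text \<open>The construction of \<open>xS\<close>, \<open>xl\<close> and \<open>xr\<close> with
  \<open>sg\<close> replaced by its negative: \<open>zl\<close> and \<open>zr\<close> are the zeros
  of \<open>b_minus\<close>, that is x_1 and x_4.\<close>

definition zS :: real where "zS = xS + 4 * sg"
definition zl :: real where "zl = (zS - sqrt (zS\<^sup>2 - 4 * lam1 Q * M1)) / (2 * lam1 Q)"
definition zr :: real where "zr = (zS + sqrt (zS\<^sup>2 - 4 * lam1 Q * M1)) / (2 * lam1 Q)"

lemma zdisc_pos: "zS\<^sup>2 - 4 * lam1 Q * M1 > 0"
proof -
  have "xS \<ge> 0" using xS_ge pos by simp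
  then have "xS\<^sup>2 \<le> zS\<^sup>2" using sg_Yt(1) by (intro power_mono) (auto simp: zS_def)
  then show ?thesis using xdisc_pos by simp
qed

lemma b_minus_factor: "b_minus Q x = alpha Q * lam1 Q * ((x - zl) * (x - zr))"
proof -
  have s: "lam1 Q * (zl + zr) = zS" using pos by (simp add: zl_def zr_def field_simps)
  have "(zS - sqrt (zS\<^sup>2 - 4 * lam1 Q * M1)) * (zS + sqrt (zS\<^sup>2 - 4 * lam1 Q * M1)) = zS\<^sup>2 - (sqrt (zS\<^sup>2 - 4 * lam1 Q * M1))\<^sup>2"
    by (simp add: power2_eq_square algebra_simps)
  also have "\<dots> = 4 * lam1 Q * M1" using zdisc_pos by simp
  finally have "zl * zr = 4 * lam1 Q * M1 / (2 * lam1 Q * (2 * lam1 Q))" by (simp add: zl_def zr_def)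
  then have p: "lam1 Q * (zl * zr) = M1" using pos by (simp add: field_simps)
  have "alpha Q * lam1 Q * ((x - zl) * (x - zr)) = alpha Q * (lam1 Q * x\<^sup>2 - lam1 Q * (zl + zr) * x + lam1 Q * (zl * zr))"
    by (simp add: algebra_simps power2_eq_square)
  also have "\<dots> = b_minus Q x"
    unfolding s p b_minus_def bhat_poly sqrt_hat by (simp add: zS_def xS_def algebra_simps)
  finally show ?thesis by simp
qed

lemma x1234: "x1 Q = zl" "x2 Q = xl" "x3 Q = xr" "x4 Q = zr"
proof -
  have "{x. b_plus Q x = 0} = {xl, xr}" "{x. b_minus Q x = 0} = {zl, zr}"
    unfolding b_plus_factor b_minus_factor using params_pos by auto
  moreover have "zl < zr" using zdisc_pos pos by (simp add: zl_def zr_def divide_strict_right_mono)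
  ultimately show "x1 Q = zl" "x2 Q = xl" "x3 Q = xr" "x4 Q = zr"
    using xl_xr by (auto simp: x1_def x2_def x3_def x4_def)
qed

lemma b_minus_b_plus: "b_minus Q x = b_plus Q x - 4 * x * (alpha Q * sg)"
  by (simp add: b_minus_def b_plus_def sqrt_hat)

lemma sqrt_Delta:
  assumes "x > 0"
  shows "sqrt (Delta Q x) = alpha Q * x * sqrt ((w x)\<^sup>2 - 4 * lam2 Q * M2)"
proof -
  have bp: "b_plus Q x = - (alpha Q * x) * (w x - 2 * sg)" and bm: "b_minus Q x = - (alpha Q * x) * (w x + 2 * sg)"
    unfolding b_plus_def b_minus_def sqrt_hat using assms by (simp_all add: bhat_w algebra_simps)
  have "Delta Q x = (alpha Q * x)\<^sup>2 * ((w x)\<^sup>2 - 4 * sg\<^sup>2)"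
    unfolding Delta_def bp bm by (simp add: power2_eq_square algebra_simps)
  also have "\<dots> = (alpha Q * x)\<^sup>2 * ((w x)\<^sup>2 - 4 * lam2 Q * M2)" by (simp add: sg_Yt(5))
  finally show ?thesis using assms params_pos by (simp add: real_sqrt_mult)
qed

lemma Y_pm:
  assumes "x > 0"
  shows "Y_plus Q x = y1 x" "Y_minus Q x = y0 x"
proof -
  define s where "s = sqrt ((w x)\<^sup>2 - 4 * lam2 Q * M2)"
  define a where "a = alpha Q * x"
  have a: "a > 0" using assms params_pos by (simp add: a_def)
  have "Y_plus Q x = (a * w x + a * s) / (2 * lam2 Q * a)" "Y_minus Q x = (a * w x - a * s) / (2 * lam2 Q * a)"
    unfolding Y_plus_def Y_minus_def sqrt_Delta[OF assms] using assms
    by (simp_all add: bhat_w scaled a_def s_def mult_ac)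
  moreover have "(a * u + a * v) / (2 * lam2 Q * a) = (u + v) / (2 * lam2 Q)"
    "(a * u - a * v) / (2 * lam2 Q * a) = (u - v) / (2 * lam2 Q)" for u v
    using a by (simp_all flip: distrib_left right_diff_distrib)
  ultimately show "Y_plus Q x = y1 x" "Y_minus Q x = y0 x"
    by (simp_all add: y0_def y1_def s_def)
qed

lemma Y01:
  assumes "x > 0" "w x \<ge> 2 * sg"
  shows "Y0 Q x = y0 x" "Y1 Q x = y1 x"
  using y01_sum_prod(3,4,5)[OF assms(2)] by (auto simp: Y0_def Y1_def Y_pm[OF assms(1)])

lemma rho1_eq: "1 - \<rho>1 = lam Q / (lam Q + mu1 Q)"
  using params_pos by (simp add: \<rho>1_def field_simps)

lemma g_poly_gq: "g_poly Q x = (lam Q + mu1 Q)\<^sup>2 * gq x"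
proof -
  define d where "d = lam Q + mu1 Q"
  have d: "d > 0" using params_pos by (simp add: d_def)
  have L: "lam1 Q + lam2 Q = lam Q" by (simp add: lam_def)
  have e: "gq x = lam1 Q * (lam Q / d) * x\<^sup>2 + (mu1 Q / d * lam Q - lam Q / d * (mu Q * mu1 Q / d)) * x - mu1 Q / d * (mu Q * mu1 Q / d)"
    unfolding gq_def L k1_eq rho1_eq unfolding \<rho>1_def hmu1_def d_def by simp
  have "d\<^sup>2 * gq x = lam Q * lam1 Q * d * x\<^sup>2 + lam Q * mu1 Q * (d - mu Q) * x - mu Q * (mu1 Q)\<^sup>2"
    unfolding e using d by (simp add: field_simps power2_eq_square)
  then show ?thesis by (simp add: g_poly_def d_def)
qed

lemma x_plus_minus: "x_plus Q = xp" "x_minus Q = xm"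
proof -
  have d: "lam Q + mu1 Q \<noteq> 0" "lam1 Q * (1 - \<rho>1) \<noteq> 0" using params_pos pos by auto
  have "g_poly Q x = 0 \<longleftrightarrow> x = xp \<or> x = xm" for x
    unfolding g_poly_gq gq_factor using d by auto
  then show "x_plus Q = xp" "x_minus Q = xm"
    unfolding x_plus_def x_minus_def using xp_gt_1 xm_less by (auto intro!: the_equality)
qed

lemma eta1_xp_yp: "eta1 xp yp = 0"
  using eta1_yc[of xp yp] ker_xp_yp xp_gt_1 by (simp add: yp_def)

text \<open>Solving \<open>eta1 xp yp = 0\<close> for \<open>yp\<close> gives the formula for
  Y(x_+).\<close>

lemma Y_at_x_plus_eq: "Y_at_x_plus Q = yp"
proof -
  define d where "d = lam Q + mu1 Q"
  have d: "d > 0" using params_pos by (simp add: d_def)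
  have xp: "xp > 0" using xp_gt_1 by simp
  have "lam2 Q * (yp - 1) * xp = - (lam1 Q * xp - k1) * (xp - 1)"
    using eta1_xp_yp xp by (simp add: eta1_def field_simps)
  then have "lam2 Q * (yp - 1) * xp * d = - (lam1 Q * d * xp - mu Q * mu1 Q) * (xp - 1)"
    using d by (simp add: k1_eq hmu1_def d_def[symmetric] field_simps)
  then have "yp - 1 = - (lam1 Q * d * xp - mu Q * mu1 Q) * (xp - 1) / (lam2 Q * d * xp)"
    using d xp pos by (simp add: field_simps)
  then have "yp - 1 = - ((lam1 Q * d * xp - mu Q * mu1 Q) * (xp - 1) / (lam2 Q * d * xp))"
    by (simp only: mult_minus_left minus_divide_left)
  then show ?thesis unfolding Y_at_x_plus_def x_plus_minus d_def[symmetric] by linarith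
qed

lemma condition1D: "condition1 Q \<Longrightarrow> yp < Yt"
  by (simp add: condition1_def Y_at_x_plus_eq sqrt_hat)

lemma condition2D: "condition2 Q \<Longrightarrow> yp = Yt"
  using yp_Yt_iff by (simp add: condition2_def x_plus_minus x1234)

text \<open>In the first alternative Yt \<le> 1 < yp. In the second, lam1 xp \<le> M1 makes the
  \<open>x\<close> part of \<open>ker xp yp\<close> nonpositive; the \<open>y\<close> part must
  compensate, which gives yp \<ge> M2 / lam2, the square of a number \<open>Yt > 1\<close>. In the
  third, equality is excluded because it would move \<open>xp\<close> to \<open>xr\<close>.\<close>

lemma condition3D:
  assumes "condition3 Q"
  shows "Yt < yp"
proof -
  consider "hmu2 Q \<le> hlam2 Q" | "hmu2 Q > hlam2 Q" "xp \<le> hmu1 Q / hlam1 Q"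
    | "xp < xr" "yp \<ge> Yt"
    using assms by (auto simp: condition3_def x_plus_minus x1234 Y_at_x_plus_eq sqrt_hat)
  then show ?thesis
  proof cases
    case 1
    then have "M2 \<le> lam2 Q" using params_pos by (simp add: scaled)
    then have "Yt \<le> 1" using pos by (simp add: Yt_def)
    then show ?thesis using yp_gt_1 by simp
  next
    case 2
    have M: "M2 > lam2 Q" using 2 params_pos by (simp add: scaled)
    have "lam1 Q * xp \<le> M1" using 2 params_pos by (simp add: scaled field_simps)
    then have "lam1 Q * (xp - 1) + M1 * (1 / xp - 1) \<le> 0"
    proof -
      have "lam1 Q * (xp - 1) + M1 * (1 / xp - 1) = (xp - 1) * (lam1 Q * xp - M1) / xp"
        using xp_gt_1 by (simp add: field_simps)
      then show ?thesis using \<open>lam1 Q * xp \<le> M1\<close> xp_gt_1 by (simp add: divide_nonpos_pos mult_nonneg_nonpos)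
    qed
    then have "lam2 Q * (yp - 1) + M2 * (1 / yp - 1) \<ge> 0" using ker_xp_yp by (simp add: ker_def)
    moreover have "lam2 Q * (yp - 1) + M2 * (1 / yp - 1) = (yp - 1) * (lam2 Q * yp - M2) / yp"
      using yp_gt_1 by (simp add: field_simps)
    ultimately have "lam2 Q * yp - M2 \<ge> 0" using yp_gt_1 by (simp add: zero_le_divide_iff zero_le_mult_iff)
    then have "yp \<ge> M2 / lam2 Q" using pos by (simp add: field_simps)
    moreover have "Yt < M2 / lam2 Q"
    proof -
      have "M2 / lam2 Q > 1" using M pos by simp
      then have "Yt > 1" by (simp add: Yt_def)
      then have "Yt * 1 < Yt * Yt" by (intro mult_strict_left_mono) auto
      then show ?thesis using sg_Yt(3) by (simp add: power2_eq_square)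
    qed
    ultimately show ?thesis by simp
  next
    case 3
    then show ?thesis using yp_Yt_iff by auto
  qed
qed

lemma h_eta: "x \<noteq> 0 \<Longrightarrow> h1 Q x y = x * eta1 x y" "y \<noteq> 0 \<Longrightarrow> h2 Q x y = y * eta2 x y" "h0 Q x y = eta0 x y"
  unfolding h1_def a1_def b1_def h2_def h0_def eta1_def eta2_def eta0_def k1_eq[symmetric]
  by (simp_all add: lam_def field_simps power2_eq_square)

lemma gen_P: "gen1 \<pi> = P1" "gen2 \<pi> = P2"
  by (auto simp: gen1_def gen2_def P1_def P2_def)

text \<open>The arguments Y_0(x) that occur never exceed \<open>Yt\<close>, so the continuation of
  the column series is needed only inside its disc of convergence, where it is the series
  itself.\<close>

lemma pi2_P2r:
  obtains \<rho> where "\<rho> > Yt" "\<And>y. 0 < y \<Longrightarrow> y < \<rho> \<Longrightarrow> pi2 \<pi> y = P2r y"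
proof -
  obtain \<rho> where r: "\<rho> > Yt" "gsum 1 \<rho>" using col_radius by blast
  have r0: "\<rho> > 0" using r sg_Yt by simp
  have hol: "P2 holomorphic_on ball 0 \<rho>"
    by (rule power_series_holomorphic[where a = "\<lambda>n. of_real (pmf \<pi> (0, Suc n, Busy))"])
       (use P2_sums[OF r(2) r0] in auto)
  have "pi2 \<pi> y = P2r y" if "0 < y" "y < \<rho>" for y
    using ancont_ball[OF hol, of "of_real y"] P2r_facts(1)[OF r(2) that] that
    by (simp add: pi2_def gen_P)
  then show thesis using that r by blast
qed

lemma N_num_NR:
  obtains \<rho> where "\<rho> > Yt" "\<And>x y. 0 < y \<Longrightarrow> y < \<rho> \<Longrightarrow> N_num Q \<pi> x y = NR x y"
proof -
  obtain \<rho> where r: "\<rho> > Yt" "\<And>y. 0 < y \<Longrightarrow> y < \<rho> \<Longrightarrow> pi2 \<pi> y = P2r y" using pi2_P2r by blast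
  have "N_num Q \<pi> x y = NR x y" if "0 < y" "y < \<rho>" for x y
    using r(2)[OF that] that by (simp add: N_num_def NR_def h_eta mult_ac)
  then show thesis using that r by blast
qed

lemma x_dom_eq: "yp = Yt \<Longrightarrow> x_dom \<pi> = xr"
  unfolding x_dom_def gen_P
  using dominant_singularity_eqI[OF P1_holomorphic R_bounds(1)] P1_unbounded_at_xr by (simp add: R_def)

lemma c_coeff_eq: "c_coeff Q x = M2 * x"
  using params_pos by (simp add: c_coeff_def scaled)

lemma b1_eta: "x \<noteq> 0 \<Longrightarrow> b1 Q x = x * eta1 x y - lam2 Q * x * y"
  using h_eta(1)[of x y] by (simp add: h1_def a1_def)

lemma C10_eq:
  assumes "yp < Yt"
  shows "C10 Q \<pi> = NR xp yp * (lam2 Q * (y1 xp - y0 xp)) / (M2 * (xp - 1) * (lam1 Q * (1 - \<rho>1)) * (xp - xm))"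
proof -
  obtain \<rho> where r: "\<rho> > Yt" "\<And>x y. 0 < y \<Longrightarrow> y < \<rho> \<Longrightarrow> N_num Q \<pi> x y = NR x y" using N_num_NR by blast
  have xp: "xp > 0" using xp_gt_1 by simp
  have wx: "w xp \<ge> 2 * sg" using row_limit_pole(3)[OF assms] by simp
  have Y0: "Y0 Q xp = yp" using Y01(1)[OF xp wx] row_limit_pole(2)[OF assms] by simp
  have N: "N_num Q \<pi> xp yp = NR xp yp" using r assms yp_gt_1 by simp
  define S where "S = lam2 Q * (y1 xp - y0 xp)"
  have S: "sqrt (Delta Q xp) = alpha Q * xp * S"
    unfolding sqrt_Delta[OF xp] using pos by (simp add: S_def y0_def y1_def field_simps)
  define d where "d = lam Q + mu1 Q"
  define E where "E = (xp - 1) * (xp - xm)"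
  have nz: "d > 0" "E > 0" "lam Q > 0" "alpha Q > 0" "M2 > 0" "lam1 Q > 0"
    using params_pos pos xp_gt_1 xm_less by (auto simp: d_def E_def)
  have "C10 Q \<pi> = d * (alpha Q * xp * S) * NR xp yp / (alpha Q * M2 * lam Q * lam1 Q * xp * E)"
    unfolding C10_def x_plus_minus Y0 N S scaled by (simp add: d_def E_def mult_ac)
  also have "\<dots> = NR xp yp * S / (M2 * E * (lam1 Q * (lam Q / d)))"
    using nz xp by (simp add: field_simps)
  finally show ?thesis unfolding rho1_eq S_def E_def d_def by (simp add: mult_ac)
qed

lemma C20_eq:
  assumes "yp = Yt"
  shows "C20 Q \<pi> = NR xr Yt / (xr * lam2 Q * kap)" "Y1 Q xr = Yt"
proof -
  obtain \<rho> where r: "\<rho> > Yt" "\<And>x y. 0 < y \<Longrightarrow> y < \<rho> \<Longrightarrow> N_num Q \<pi> x y = NR x y" using N_num_NR by blast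
  have xr: "xr > 0" using xl_xr by simp
  have wx: "w xr \<ge> 2 * sg" using w_xr by simp
  have Y0: "Y0 Q xr = Yt" and Y1: "Y1 Q xr = Yt" using Y01[OF xr wx] by (simp_all add: y0_xr)
  show "Y1 Q xr = Yt" by fact
  have N: "N_num Q \<pi> xr Yt = NR xr Yt" using r sg_Yt by simp
  \<comment> \<open>\<open>b_plus\<close> vanishes at \<open>xr\<close>, so \<open>b_minus\<close>
    takes the value \<open>- 4 * xr * (alpha Q * sg)\<close> there; this evaluates the factors with
    x_1 and x_4.\<close>
  have "alpha Q * lam1 Q * ((xr - zl) * (zr - xr)) = - b_minus Q xr" unfolding b_minus_factor by (simp add: algebra_simps)
  also have "\<dots> = 4 * xr * (alpha Q * sg)" unfolding b_minus_b_plus b_plus_factor by simp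
  finally have "alpha Q * (lam1 Q * ((xr - zl) * (zr - xr))) = alpha Q * (4 * xr * sg)" by (simp only: mult_ac)
  then have "lam1 Q * ((xr - zl) * (zr - xr)) = 4 * xr * sg" using params_pos by (simp only: mult_cancel_left) auto
  then have z: "(xr - zl) * (zr - xr) = 4 * xr * sg / lam1 Q" using params_pos by (simp only: eq_divide_eq mult.commute) auto
  have "xr * (xr - zl) * (xr - xl) * (zr - xr) = xr * (xr - xl) * ((xr - zl) * (zr - xr))" by (simp add: mult_ac)
  also have "\<dots> = (2 * xr / lam1 Q)\<^sup>2 * (sg * (lam1 Q * (xr - xl)))"
    unfolding z using pos by (simp add: field_simps power2_eq_square)
  finally have e: "xr * (xr - zl) * (xr - xl) * (zr - xr) = (2 * xr / lam1 Q)\<^sup>2 * (sg * (lam1 Q * (xr - xl)))" .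
  have "sqrt (xr * (xr - zl) * (xr - xl) * (zr - xr)) = 2 * xr / lam1 Q * (sqrt sg * sqrt (lam1 Q * (xr - xl)))"
    unfolding e real_sqrt_mult[of "(2 * xr / lam1 Q)\<^sup>2"] real_sqrt_mult[of sg] using xr pos by simp
  also have "sqrt sg * sqrt (lam1 Q * (xr - xl)) = lam2 Q * kap" using pos by (simp add: kap_def)
  finally have s: "sqrt (xr * (xr - zl) * (xr - xl) * (zr - xr)) = 2 * xr / lam1 Q * (lam2 Q * kap)" .
  show "C20 Q \<pi> = NR xr Yt / (xr * lam2 Q * kap)"
    unfolding C20_def Let_def x_dom_eq[OF assms] x1234 Y0 N s using pos by simp
qed

text \<open>The zero of \<open>b_plus\<close> at \<open>xr\<close> cancels against
  \<open>1 - x / xr\<close>; the limit is the value of a function that is continuous at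
  \<open>xr\<close> and agrees with \<open>q_fun\<close> elsewhere.\<close>

lemma q_at_x3_eq: "q_at_x3 Q = - kap"
proof -
  have xr: "xr > 0" using xl_xr by simp
  define f where "f = (\<lambda>x. - (1 / (2 * hlam2 Q * x)) * sqrt (- (alpha Q * lam1 Q * xr * (x - xl)) * b_minus Q x))"
  have "(f \<longlongrightarrow> f xr) (at xr)" unfolding f_def b_minus_factor
    using xr params_pos by (intro tendsto_intros) (auto simp: scaled)
  moreover have "eventually (\<lambda>x. f x = q_fun Q x) (at xr)"
  proof (rule eventually_at_topological[THEN iffD2], intro exI[of _ UNIV] conjI ballI impI)
    fix x assume x: "x \<noteq> xr"
    have "1 - x / xr = (xr - x) / xr" using xr by (simp add: field_simps)
    then have "Delta Q x / (1 - x / xr) = - (alpha Q * lam1 Q * xr * (x - xl)) * b_minus Q x"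
      using x xr by (simp add: Delta_def b_plus_factor divide_simps) (simp add: algebra_simps)
    then show "f x = q_fun Q x" by (simp add: f_def q_fun_def x1234)
  qed auto
  ultimately have "(q_fun Q \<longlongrightarrow> f xr) (at xr)" by (rule Lim_transform_eventually)
  then have "q_at_x3 Q = f xr" unfolding q_at_x3_def x1234 by (intro tendsto_Lim) auto
  also have "f xr = - kap"
  proof -
    have "- (alpha Q * lam1 Q * xr * (xr - xl)) * b_minus Q xr = (2 * (alpha Q * xr))\<^sup>2 * (sg * (lam1 Q * (xr - xl)))"
      unfolding b_minus_b_plus b_plus_factor by (simp add: power2_eq_square algebra_simps)
    then have "sqrt (- (alpha Q * lam1 Q * xr * (xr - xl)) * b_minus Q xr) = 2 * (alpha Q * xr) * (sqrt sg * sqrt (lam1 Q * (xr - xl)))"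
      using xr params_pos by (simp add: real_sqrt_mult)
    also have "sqrt sg * sqrt (lam1 Q * (xr - xl)) = lam2 Q * kap" using pos by (simp add: kap_def)
    finally show ?thesis using xr params_pos by (simp add: f_def scaled)
  qed
  finally show ?thesis .
qed

definition D3 :: real where
  "D3 = - (dNR * eta1 xr Yt - NR xr Yt * lam2 Q) / (xr * (eta1 xr Yt)\<^sup>2)"

lemma C30_eq:
  assumes "Yt < yp"
  shows "C30 Q \<pi> = kap / (2 * xr) * D3" "D3 > 0"
proof -
  obtain \<rho> where r: "\<rho> > Yt" "\<And>x y. 0 < y \<Longrightarrow> y < \<rho> \<Longrightarrow> N_num Q \<pi> x y = NR x y" using N_num_NR by blast
  have xr: "xr > 0" using xl_xr by simp
  have wx: "w xr \<ge> 2 * sg" using w_xr by simp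
  have Y0: "Y0 Q xr = Yt" using Y01[OF xr wx] by (simp add: y0_xr)
  have "((\<lambda>y. - (NR xr y / (xr * eta1 xr y))) has_field_derivative D3) (at Yt)"
    unfolding D3_def by (rule row_limit_branch(2)[OF assms])
  then have "((\<lambda>y. - (N_num Q \<pi> xr y / h1 Q xr y)) has_field_derivative D3) (at Yt)"
    by (rule has_field_derivative_transform_within_open[where S = "{0<..<\<rho>}"])
       (use r sg_Yt xr in \<open>auto simp: h_eta\<close>)
  then have "deriv (\<lambda>y. - (N_num Q \<pi> xr y / h1 Q xr y)) Yt = D3" by (rule DERIV_imp_deriv)
  then show "C30 Q \<pi> = kap / (2 * xr) * D3"
    unfolding C30_def x1234 Y0 q_at_x3_eq by simp
  show "D3 > 0" unfolding D3_def
    using branch_coeff_pos[OF row_limit_branch(1)[OF assms]] row_limit_branch(1)[OF assms] xr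
    by (intro divide_pos_pos) auto
qed

text \<open>With both orbits occupied the idle probability is \<open>mu Q / alpha Q\<close> times
  the busy one. The number \<open>k\<close> is the shift in the exponent \<open>m - k\<close>, a
  truncated subtraction, so \<open>v\<close> is compared only from \<open>m = 2\<close> on.\<close>

lemma tail_equiv_idle:
  assumes n: "n \<ge> 1" and r: "r > 0" and T: "(\<lambda>m. pmf \<pi> (m, n, Busy) * r ^ m * real m powr a) \<longlonglongrightarrow> T" "T \<noteq> 0"
    and V: "V * r ^ k = T" "k \<le> 2"
    and v: "\<And>m. m \<ge> 2 \<Longrightarrow> v m = mu Q / alpha Q * V * real m powr (- a) * (1 / r) ^ (m - k)"
  shows "tail_equiv (\<lambda>m. pmf \<pi> (m, n, Idle)) v"
  unfolding tail_equiv_def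
proof (rule Lim_transform_eventually)
  show "(\<lambda>m. pmf \<pi> (m, n, Busy) * r ^ m * real m powr a / T) \<longlonglongrightarrow> 1"
    using tendsto_divide[OF T(1) tendsto_const[of T] T(2)] T(2) by simp
  show "eventually (\<lambda>m. pmf \<pi> (m, n, Busy) * r ^ m * real m powr a / T = pmf \<pi> (m, n, Idle) / v m) sequentially"
    using eventually_ge_at_top[of 2]
  proof eventually_elim
    case (elim m)
    define s where "s = real m powr a"
    define c where "c = mu Q / alpha Q"
    have s: "s > 0" using elim by (simp add: s_def)
    have c: "c > 0" using params_pos by (simp add: c_def)
    have idle: "pmf \<pi> (m, n, Idle) = c * pmf \<pi> (m, n, Busy)"
      using idle_eq[of m n] elim n by (simp add: alpha_def c_def)
    have rm: "r ^ m = r ^ (m - k) * r ^ k" using elim V(2) by (simp flip: power_add)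
    have V0: "V \<noteq> 0" using V T by auto
    have vm: "v m = c * V / (s * r ^ (m - k))"
      using v[OF elim] by (simp add: c_def s_def powr_minus divide_inverse power_inverse mult_ac)
    show ?case unfolding idle vm s_def[symmetric] V(1)[symmetric] rm
      using s c r V0 by (simp add: field_simps)
  qed
qed

end

theorem theorem6p6:
  fixes Q :: queue and \<pi> :: "state pmf" and n :: nat
  assumes "valid_queue Q"
    and "stable_queue Q"
    and "hlam1 Q < hmu1 Q"
    and "stationary Q \<pi>"
    and "n \<ge> 1"
  shows
    "(condition1 Q \<longrightarrow>
        tail_equiv (\<lambda>m. pmf \<pi> (m, n, Idle))
          (\<lambda>m. mu Q / alpha Q * A1 Q \<pi> (x_plus Q)
               * (1 / Y1 Q (x_plus Q)) ^ (n - 1) * (1 / x_plus Q) ^ (m - 1))) \<and>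
     (condition2 Q \<longrightarrow>
        tail_equiv (\<lambda>m. pmf \<pi> (m, n, Idle))
          (\<lambda>m. mu Q / alpha Q * (A2 Q \<pi> (x_dom \<pi>) / sqrt pi)
               * (1 / Y1 Q (x_dom \<pi>)) ^ (n - 1) * real m powr (- 1 / 2)
               * (1 / x_dom \<pi>) ^ (m - 1))) \<and>
     (condition3 Q \<longrightarrow>
        tail_equiv (\<lambda>m. pmf \<pi> (m, n, Idle))
          (\<lambda>m. mu Q / alpha Q * ((A3 Q \<pi> (x3 Q) + real (n - 1) * B3 Q \<pi> (x3 Q)) / sqrt pi)
               * (1 / Y1 Q (x3 Q)) ^ (n - 1) * real m powr (- 3 / 2)
               * (1 / x3 Q) ^ (m - 2)))"
proof -
  interpret retrial_queue Q \<pi> by unfold_locales (use assms in auto)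
  obtain j where n: "n = Suc j" using assms(5) by (cases n) auto
  have xr: "xr > 0" using xl_xr by simp
  have xp: "xp > 0" using xp_gt_1 by simp
  show ?thesis
  proof (intro conjI impI)
    assume "condition1 Q"
    then have y: "yp < Yt" by (rule condition1D)
    have wx: "w xp \<ge> 2 * sg" using row_limit_pole(3)[OF y] by simp
    have Y1: "Y1 Q xp = y1 xp" using Y01(2)[OF xp wx] .
    have lt: "y0 xp < y1 xp" using y01_sum_prod(5)[OF wx] y row_limit_pole(2)[OF y] by simp
    \<comment> \<open>The product of the two kernel roots is \<open>M2 / lam2 Q\<close>, so the
      ratio of consecutive rows is the reciprocal of the upper root.\<close>
    have u: "lam2 Q * yp / M2 = 1 / y1 xp"
    proof -
      have "yp * y1 xp = M2 / lam2 Q" using y01_sum_prod(2)[OF wx] row_limit_pole(2)[OF y] by simp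
      moreover have "y1 xp > 0" using y01_sum_prod(5)[OF wx] sg_Yt by linarith
      ultimately show ?thesis using pos by (simp add: field_simps)
    qed
    define C where "C = C10 Q \<pi>"
    have "(\<lambda>m. pmf \<pi> (Suc m, 0, Busy) * xp ^ m) \<longlonglongrightarrow> C"
      unfolding C_def C10_eq[OF y] by (rule row_limit_pole(1)[OF y])
    moreover have "eventually (\<lambda>m. pmf \<pi> (Suc m, 0, Busy) * xp ^ m = pmf \<pi> (Suc m, 0, Busy) * xp ^ m * real m powr 0) sequentially"
      using eventually_gt_at_top[of 0] by eventually_elim simp
    ultimately have "(\<lambda>m. pmf \<pi> (Suc m, 0, Busy) * xp ^ m * real m powr 0) \<longlonglongrightarrow> C" by (rule Lim_transform_eventually)
    from rows_limit[OF xp tendsto_unshift[OF this xp], of n]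
    have T: "(\<lambda>m. pmf \<pi> (m, n, Busy) * xp ^ m * real m powr 0) \<longlonglongrightarrow> C * xp * (1 / y1 xp) ^ n"
      unfolding rowc_pole[OF eta1_xp_yp ker_xp_yp order.strict_trans[OF zero_less_one yp_gt_1]] u .
    have "NR xp yp > 0" by (rule NR_pos) (use xp_gt_1 yp_gt_1 y ker_xp_yp eta1_xp_yp in auto)
    moreover have "M2 * (xp - 1) * (lam1 Q * (1 - \<rho>1)) * (xp - xm) > 0"
      using pos xp_gt_1 xm_less by (intro mult_pos_pos) auto
    ultimately have C0: "C > 0" unfolding C_def C10_eq[OF y] using lt pos xp_gt_1 xm_less_xp by (intro divide_pos_pos mult_pos_pos) auto
    \<comment> \<open>Since \<open>eta1 xp yp = 0\<close>, the quotient -b_1 / c is exactly one row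
      factor: \<open>A1\<close> accounts for one of the \<open>n\<close> factors and
      \<open>n - 1\<close> remain.\<close>
    have A: "A1 Q \<pi> xp = C * (1 / y1 xp)"
    proof -
      have "- (b1 Q xp / c_coeff Q xp) = lam2 Q * yp / M2"
        using b1_eta[of xp yp] xp by (simp add: eta1_xp_yp c_coeff_eq)
      then show ?thesis unfolding A1_def C_def u by simp
    qed
    show "tail_equiv (\<lambda>m. pmf \<pi> (m, n, Idle))
          (\<lambda>m. mu Q / alpha Q * A1 Q \<pi> (x_plus Q)
               * (1 / Y1 Q (x_plus Q)) ^ (n - 1) * (1 / x_plus Q) ^ (m - 1))"
      unfolding x_plus_minus Y1
      by (rule tail_equiv_idle[OF assms(5) xp T, where k = 1 and V = "A1 Q \<pi> xp * (1 / y1 xp) ^ (n - 1)"])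
         (use C0 xp lt y01_sum_prod(3)[OF wx] in \<open>auto simp: A n mult_ac\<close>)
  next
    assume "condition2 Q"
    then have y: "yp = Yt" by (rule condition2D)
    have xpr: "xp = xr" using y yp_Yt_iff by simp
    have e: "eta1 xr Yt = 0" "ker xr Yt = 0" using eta1_xp_yp ker_xp_yp by (simp_all add: xpr y)
    have u: "lam2 Q * Yt / M2 = 1 / Yt"
      using sg_Yt(2,3) pos by (simp add: field_simps power2_eq_square)
    define C where "C = C20 Q \<pi>"
    have "(\<lambda>m. pmf \<pi> (Suc m, 0, Busy) * xr ^ m * real m powr (1 / 2)) \<longlonglongrightarrow> C / sqrt pi"
      unfolding C_def C20_eq(1)[OF y] by (rule row_limit_branch_pole(1)[OF y])
    from rows_limit[OF xr tendsto_unshift[OF this xr], of n]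
    have T: "(\<lambda>m. pmf \<pi> (m, n, Busy) * xr ^ m * real m powr (1 / 2)) \<longlonglongrightarrow> C / sqrt pi * xr * (1 / Yt) ^ n"
      unfolding rowc_pole[OF e sg_Yt(2)] u .
    have "NR xr Yt > 0" by (rule NR_pos) (use xl_xr yp_gt_1 y e in auto)
    then have C0: "C > 0" unfolding C_def C20_eq(1)[OF y] using xr pos kap_pos by simp
    have A: "A2 Q \<pi> xr = C * (1 / Yt)"
    proof -
      have "- (b1 Q xr / c_coeff Q xr) = lam2 Q * Yt / M2"
        using b1_eta[of xr Yt] xr by (simp add: e c_coeff_eq)
      then show ?thesis unfolding A2_def C_def u by simp
    qed
    show "tail_equiv (\<lambda>m. pmf \<pi> (m, n, Idle))
          (\<lambda>m. mu Q / alpha Q * (A2 Q \<pi> (x_dom \<pi>) / sqrt pi)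
               * (1 / Y1 Q (x_dom \<pi>)) ^ (n - 1) * real m powr (- 1 / 2)
               * (1 / x_dom \<pi>) ^ (m - 1))"
      unfolding x_dom_eq[OF y] C20_eq(2)[OF y]
      by (rule tail_equiv_idle[OF assms(5) xr T, where k = 1 and V = "A2 Q \<pi> xr / sqrt pi * (1 / Yt) ^ (n - 1)"])
         (use C0 xr sg_Yt(2) in \<open>auto simp: A n mult_ac\<close>)
  next
    assume "condition3 Q"
    then have y: "Yt < yp" by (rule condition3D)
    have wx: "w xr \<ge> 2 * sg" using w_xr by simp
    have Y1: "Y1 Q xr = Yt" using Y01(2)[OF xr wx] by (simp add: y0_xr)
    define c where "c = - eta1 xr Yt * Yt / M2"
    have c: "c > 0" using row_limit_branch(1)[OF y] sg_Yt(2) pos by (simp add: c_def mult_neg_pos divide_neg_pos)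
    define C where "C = C30 Q \<pi>"
    have C0: "C > 0" unfolding C_def using C30_eq[OF y] kap_pos xr by simp
    \<comment> \<open>One factor \<open>xr\<close> is left over here and another arises from undoing
      the index shift; together they produce the exponent \<open>m - 2\<close>.\<close>
    have "kap * D3 / (2 * sqrt pi) = C * xr / sqrt pi"
      unfolding C_def C30_eq(1)[OF y] using xr by (simp add: field_simps)
    then have "(\<lambda>m. pmf \<pi> (Suc m, 0, Busy) * xr ^ m * real m powr (3 / 2)) \<longlonglongrightarrow> C * xr / sqrt pi"
      using row_limit_branch(3)[OF y] unfolding D3_def[symmetric] by simp
    from rows_limit[OF xr tendsto_unshift[OF this xr], of n]
    have T: "(\<lambda>m. pmf \<pi> (m, n, Busy) * xr ^ m * real m powr (3 / 2)) \<longlonglongrightarrow>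
        C * xr / sqrt pi * xr * ((1 + real n * c) * (1 / Yt) ^ n)"
      unfolding rowc_branch c_def .
    have cu: "- eta1 xr Yt / M2 = c * (1 / Yt)" using sg_Yt(2) by (simp add: c_def)
    have lu: "lam2 Q * Yt / M2 = 1 / Yt"
      using sg_Yt(2,3) pos by (simp add: field_simps power2_eq_square)
    have A: "A3 Q \<pi> xr = C * ((1 + c) * (1 / Yt))"
    proof -
      have "- (b1 Q xr / c_coeff Q xr) = lam2 Q * Yt / M2 + (- eta1 xr Yt / M2)"
        unfolding b1_eta[OF less_imp_neq[OF xr, symmetric], of Yt] c_coeff_eq using xr pos by (simp add: field_simps)
      then show ?thesis unfolding A3_def C_def lu cu by (simp add: algebra_simps add_divide_distrib)
    qed
    have B: "B3 Q \<pi> xr = C * (c * (1 / Yt))"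
    proof -
      \<comment> \<open>At the branch point \<open>w xr = 2 * sg\<close> and
        \<open>sg = lam2 Q * Yt\<close>, so the first term of p_1 cancels against the
        \<open>y\<close> term in b_1 and only \<open>eta1\<close> remains.\<close>
      have "p1 Q xr = xr * (sg - lam2 Q * Yt + eta1 xr Yt)"
        unfolding p1_def b1_eta[OF less_imp_neq[OF xr, symmetric], of Yt] a1_def bhat_w[OF less_imp_neq[OF xr, symmetric]] w_xr scaled
        using xr params_pos by (simp add: field_simps)
      also have "\<dots> = xr * eta1 xr Yt" using sg_Yt(4) by simp
      finally have "- (p1 Q xr / c_coeff Q xr) = - eta1 xr Yt / M2" unfolding c_coeff_eq using xr by simp
      then show ?thesis unfolding B3_def C_def cu by simp
    qed
    \<comment> \<open>Up to the common factor, \<open>A3\<close> contributes \<open>1 + c\<close>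
      and each of the \<open>n - 1\<close> copies of \<open>B3\<close> contributes \<open>c\<close>,
      which adds up to the linear factor of \<open>rowc_branch\<close>.\<close>
    have AB: "A3 Q \<pi> xr + real (n - 1) * B3 Q \<pi> xr = C * ((1 + real n * c) * (1 / Yt))"
      unfolding A B n by (simp add: algebra_simps add_divide_distrib)
    have nc: "1 + real n * c > 0" using c by (simp add: add_pos_nonneg)
    show "tail_equiv (\<lambda>m. pmf \<pi> (m, n, Idle))
          (\<lambda>m. mu Q / alpha Q * ((A3 Q \<pi> (x3 Q) + real (n - 1) * B3 Q \<pi> (x3 Q)) / sqrt pi)
               * (1 / Y1 Q (x3 Q)) ^ (n - 1) * real m powr (- 3 / 2)
               * (1 / x3 Q) ^ (m - 2))"
      unfolding x1234 Y1 AB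
    proof (rule tail_equiv_idle[OF assms(5) xr T, where k = 2 and V = "C * ((1 + real n * c) * (1 / Yt)) / sqrt pi * (1 / Yt) ^ (n - 1)"])
      show "C * xr / sqrt pi * xr * ((1 + real n * c) * (1 / Yt) ^ n) \<noteq> 0"
        using C0 xr nc sg_Yt(2) by simp
      show "C * ((1 + real n * c) * (1 / Yt)) / sqrt pi * (1 / Yt) ^ (n - 1) * xr ^ 2 = C * xr / sqrt pi * xr * ((1 + real n * c) * (1 / Yt) ^ n)"
        unfolding n by (simp add: power2_eq_square mult_ac)
    qed auto
  qed
qed

end
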